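(* Let $t^{(e)}(n)$ denote the number of e-squarefree e-divisors of $n$; it is the multiplicative function with $t^{(e)}(1)=1$ and $t^{(e)}(p^a)=2^{\omega(a)}$ for every prime $p$ and every $a\ge 1$. (i) The Dirichlet series of $t^{(e)}$ is of the form \[ \sum_{n=1}^{\infty}\frac{t^{(e)}(n)}{n^s}=\zeta(s)\zeta(2s)V(s),\qquad \operatorname{Re} s>1, \] where $V(s)=\sum_{n=1}^{\infty}\frac{v(n)}{n^s}$ is a Dirichlet series that is absolutely convergent for $\operatorname{Re} s>1/4$. (ii) For every $\varepsilon>0$, \[ \sum_{n\le x}t^{(e)}(n)=C_1x+C_2x^{1/2}+O(x^{1/4+\varepsilon}), \] where $C_1,C_2$ are the constants given by \[ C_1:=\prod_p\left(1+\frac1{p^2}+\sum_{a=6}^{\infty}\frac{2^{\omega(a)}-2^{\omega(a-1)}}{p^a}\right), \] \[ C_2:=\zeta(1/2)\prod_p\left(1+\sum_{a=4}^{\infty}\frac{2^{\omega(a)}-2^{\omega(a-1)}-2^{\omega(a-2)}+2^{\omega(a-3)}}{p^{a/2}}\right). \]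
   Context: $\omega(m)$ denotes the number of distinct prime divisors of $m$ (so $\omega(1)=0$), $\zeta$ is the Riemann zeta function, and products over $p$ run over all primes. For $n=p_1^{a_1}\cdots p_r^{a_r}>1$ (canonical prime factorization), an exponential divisor (e-divisor) of $n$ is an integer $d=p_1^{b_1}\cdots p_r^{b_r}$ with $b_i\mid a_i$ ($b_i\ge1$) for all $i$; by convention $1$ is the only e-divisor of $1$. The e-divisor $d$ is e-squarefree if all $b_1,\dots,b_r$ are squarefree; $1$ is e-squarefree by convention. Hence $t^{(e)}(n)=2^{\omega(a_1)}\cdots2^{\omega(a_r)}$. The $O$-estimate is as $x\to\infty$, with implied constant depending on $\varepsilon$. *)

theory Defs
  imports
    "HOL-Complex_Analysis.Complex_Analysis"
    "HOL-Computational_Algebra.Computational_Algebra"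
    "HOL-Library.Landau_Symbols"
begin

(* The equality of prime supports encodes b_i >= 1 for all i, and that d has no other prime
   factors. For n = 1 the condition says d = 1. *)
definition e_divisor :: "nat \<Rightarrow> nat \<Rightarrow> bool" where
  "e_divisor d n \<longleftrightarrow> d > 0 \<and> n > 0 \<and> prime_factors d = prime_factors n \<and>
     (\<forall>p\<in>prime_factors n. multiplicity p d dvd multiplicity p n)"

definition e_squarefree :: "nat \<Rightarrow> bool" where
  "e_squarefree d \<longleftrightarrow> d > 0 \<and> (\<forall>p\<in>prime_factors d. squarefree (multiplicity p d))"

definition t_e :: "nat \<Rightarrow> nat" where
  "t_e n = card {d. e_divisor d n \<and> e_squarefree d}"

definition omega :: "nat \<Rightarrow> nat" where
  "omega m = card (prime_factors m)"

(* Riemann zeta, as the analytic continuation of its Dirichlet series to a punctured half-plane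
   Re w > c containing s; by zeta_eqI below the value does not depend on the choice of c and f.
   This determines zeta s for every s \<noteq> 1; zeta 1 is unspecified. *)
definition zeta :: "complex \<Rightarrow> complex" where
  "zeta s = (THE z. \<exists>c f. c < Re s \<and> f holomorphic_on ({w. c < Re w} - {1}) \<and>
     (\<forall>w. Re w > 1 \<longrightarrow> (\<lambda>n. 1 / of_nat (Suc n) powr w) sums f w) \<and> f s = z)"

lemma zeta_continuation_unique:
  fixes f g :: "complex \<Rightarrow> complex"
  assumes "s \<noteq> 1" and "c < Re s" and "c' < Re s"
    and f: "f holomorphic_on ({w. c < Re w} - {1})"
    and g: "g holomorphic_on ({w. c' < Re w} - {1})"
    and fs: "\<And>w. Re w > 1 \<Longrightarrow> (\<lambda>n. 1 / of_nat (Suc n) powr w) sums f w"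
    and gs: "\<And>w. Re w > 1 \<Longrightarrow> (\<lambda>n. 1 / of_nat (Suc n) powr w) sums g w"
  shows "f s = g s"
proof -
  define b where "b = max c c'"
  define S where "S = {w. b < Re w} - {1::complex}"
  have b: "b < Re s" using assms by (simp add: b_def)
  have open_half: "open {w::complex. r < Re w}" for r
    by (rule open_halfspace_Re_gt)
  have "open S" unfolding S_def using open_half by (intro open_Diff) auto
  have "connected {w::complex. b < Re w}"
    by (intro convex_connected convex_halfspace_Re_gt)
  then have "connected S"
    unfolding S_def using open_half by (intro connected_open_delete) auto
  have "{w. max 1 b < Re w} \<noteq> ({}::complex set)"
    by (auto intro!: exI[of _ "of_real (max 1 b + 1)"])
  show ?thesis
  proof (rule analytic_continuation_open[of "{w. max 1 b < Re w}" S f g s])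
    show "f holomorphic_on S"
      by (rule holomorphic_on_subset[OF f]) (auto simp: S_def b_def)
    show "g holomorphic_on S"
      by (rule holomorphic_on_subset[OF g]) (auto simp: S_def b_def)
    show "f z = g z" if "z \<in> {w. max 1 b < Re w}" for z
      using that fs[of z] gs[of z] by (auto intro: sums_unique2)
    show "s \<in> S" using b assms(1) by (simp add: S_def)
    show "open {w::complex. max 1 b < Re w}"
      by (rule open_half)
    show "{w. max 1 b < Re w} \<subseteq> S"
      by (auto simp: S_def)
  qed fact+
qed

lemma zeta_eqI:
  fixes f :: "complex \<Rightarrow> complex"
  assumes "s \<noteq> 1" and "c < Re s"
    and "f holomorphic_on ({w. c < Re w} - {1})"
    and "\<And>w. Re w > 1 \<Longrightarrow> (\<lambda>n. 1 / of_nat (Suc n) powr w) sums f w"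
  shows "zeta s = f s"
  unfolding zeta_def
proof (rule the_equality)
  show "\<exists>c' g. c' < Re s \<and> g holomorphic_on ({w. c' < Re w} - {1}) \<and>
      (\<forall>w. Re w > 1 \<longrightarrow> (\<lambda>n. 1 / of_nat (Suc n) powr w) sums g w) \<and> g s = f s"
    using assms by blast
qed (use zeta_continuation_unique[OF assms(1) _ assms(2) _ assms(3) _ assms(4)] in blast)

definition C1_term :: "nat \<Rightarrow> nat \<Rightarrow> real" where
  "C1_term p a = (2 ^ omega a - 2 ^ omega (a - 1)) / real p ^ a"

definition C2_term :: "nat \<Rightarrow> nat \<Rightarrow> real" where
  "C2_term p a =
     (2 ^ omega a - 2 ^ omega (a - 1) - 2 ^ omega (a - 2) + 2 ^ omega (a - 3))
       / real p powr (real a / 2)"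

(* Products over primes are infinite products over all natural numbers with factor 1 at
   the non-primes. *)
definition C1_factor :: "nat \<Rightarrow> real" where
  "C1_factor p = (if prime p then 1 + 1 / real p ^ 2 + (\<Sum>a. C1_term p (a + 6)) else 1)"

definition C2_factor :: "nat \<Rightarrow> real" where
  "C2_factor p = (if prime p then 1 + (\<Sum>a. C2_term p (a + 4)) else 1)"

definition C1 :: real where
  "C1 = (\<Prod>p. C1_factor p)"

(* zeta (1/2) is real; Re only converts the type. *)
definition C2 :: real where
  "C2 = Re (zeta (1/2)) * (\<Prod>p. C2_factor p)"

end

theory Submission
  imports Defs "HOL-Real_Asymp.Real_Asymp"
begin

text \<open>For a fixed prime p put T(X) = \<Sum>_a 2^\<omega>(a) X^a, so that the Euler factor of the Dirichlet
series of t^(e) is T(p^(-s)). Since 2^\<omega>(a) starts with 1, 1, 2, 2, 2, 2, 4, the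
product (1 - X)(1 - X^2) T(X) is 1 - X^4 + ..., with coefficients of at most linear growth. Hence the
multiplicative function v (\<open>v_coeff\<close>) with these coefficients at prime powers has a Dirichlet series V
that converges absolutely for Re s > 1/4, and t^(e) = r * v, where r
(\<open>square_divisor_count\<close>), the convolution of 1 with the indicator of the squares, has the Dirichlet series
\<zeta>(s) \<zeta>(2s). Multiplying absolutely convergent series gives part (i). The Euler
products for \<zeta>(2) V(1) and V(1/2) are exactly the products in C1 and C2 (\<open>euler_product\<close>).

For part (ii) let D(x) (\<open>lattice_count\<close>) be the summatory function of r, that is, the number of pairs
(a,b) with a b^2 \<le> x. Then \<Sum>_(n \<le> x) t^(e)(n) = \<Sum>_d v(d) D(x/d), so it suffices that
D(x) = \<zeta>(2) x + \<zeta>(1/2) x^(1/2) + O(x^(1/4+\<epsilon>)) uniformly for all x > 0, including x < 1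
(\<open>lattice_count_asymptotic\<close>). The main terms then sum exactly to C1 x and C2 x^(1/2), and the error terms
are summed against the convergent series \<Sum>|v(d)| d^(-1/4-\<epsilon>).

The trivial hyperbola method only gives the error O(x^(1/3)) for D(x). It leaves the two sums of the
sawtooth function y - \<lfloor>y\<rfloor> - 1/2 at x/n^2 and at sqrt(x/n), over n \<le> x^(1/3); all
other terms cancel down to a bounded error plus O(x^(1/6)). These sums are treated by an elementary
method of Vinogradov (\<open>abs_sum_sawtooth_le\<close>). Around a point s the function is
nearly linear, with a slope that Dirichlet's theorem approximates by a fraction a/q with q \<le> \<tau>. On
the next q integers the values nearly run through a complete residue system modulo 1 with
step 1/q, and the sawtooth sum over such a block is bounded. The range is cut greedily into such blocks.
As the slope increases at a rate bounded from below, it stays near one fraction a/q only for a short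
time, so there are few blocks. For dyadic ranges starting at N \<ge> x^(1/4) and \<tau> about N / x^(1/4) the result is
O(x^(1/4) log x) in both cases, and the range n \<le> x^(1/4) is trivial.\<close>

(* Absolute summability below is meant in the sense of the theory Infinite_Sum. *)
no_notation Infinite_Set_Sum.abs_summable_on (infix \<open>abs'_summable'_on\<close> 50)

section \<open>Multiplicative functions and the coefficients of the factorization\<close>

definition dirichlet_conv :: "(nat \<Rightarrow> real) \<Rightarrow> (nat \<Rightarrow> real) \<Rightarrow> nat \<Rightarrow> real" where
  "dirichlet_conv f g n = (\<Sum>d | d dvd n. f d * g (n div d))"

definition multiplicative :: "(nat \<Rightarrow> real) \<Rightarrow> bool" where
  "multiplicative f \<longleftrightarrow> f 1 = 1 \<and> (\<forall>m n. m > 0 \<longrightarrow> n > 0 \<longrightarrow> coprime m n \<longrightarrow> f (m * n) = f m * f n)"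

lemma multiplicative_1 [simp]: "multiplicative f \<Longrightarrow> f (Suc 0) = 1"
  by (simp add: multiplicative_def)

lemma multiplicative_mult:
  "multiplicative f \<Longrightarrow> m > 0 \<Longrightarrow> n > 0 \<Longrightarrow> coprime m n \<Longrightarrow> f (m * n) = f m * f n"
  by (simp add: multiplicative_def)

lemma multiplicative_eqI:
  assumes f: "multiplicative f" and g: "multiplicative g"
    and eq: "\<And>p k. prime p \<Longrightarrow> k \<ge> 1 \<Longrightarrow> f (p ^ k) = g (p ^ k)"
    and n: "n > 0"
  shows "f n = g n"
  using n
proof (induction n rule: less_induct)
  case (less n)
  show ?case
  proof (cases "n = 1")
    case False
    then obtain p where p: "prime p" "p dvd n" using prime_factor_nat by blast
    define k where "k = multiplicity p n"
    have "p \<noteq> 1" using p by auto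
    then obtain m where m: "n = p ^ k * m" "\<not> p dvd m"
      using multiplicity_decompose'[of n p] p less.prems unfolding k_def by auto
    have k: "k \<ge> 1" using m p by (cases k) auto
    have m0: "m > 0" using m less.prems by (cases m) auto
    have p1: "p ^ k > 1" using one_less_power[of p k] prime_gt_1_nat[OF p(1)] k by simp
    have "coprime p m" using p m by (simp add: prime_imp_coprime)
    then have cop: "coprime (p ^ k) m" by simp
    have "m < n" using m(1) p1 m0 by simp
    then have "f m = g m" using less.IH m0 by simp
    then show ?thesis unfolding m(1)
      using multiplicative_mult[OF f _ m0 cop] multiplicative_mult[OF g _ m0 cop] less_trans[OF zero_less_one p1] eq[OF p(1) k] by auto
  qed (use f g in auto)
qed

text \<open>For coprime m and n, the divisors of m n are the products of a divisor of m and a divisor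
of n; the two factors are recovered as greatest common divisors with m and n.\<close>

lemma multiplicative_dirichlet_conv:
  assumes f: "multiplicative f" and g: "multiplicative g"
  shows "multiplicative (dirichlet_conv f g)"
  unfolding multiplicative_def
proof (intro conjI allI impI)
  show "dirichlet_conv f g 1 = 1" using f g by (simp add: dirichlet_conv_def)
next
  fix m n :: nat
  assume mn: "m > 0" "n > 0" "coprime m n"
  have gcds: "gcd (a * b) m = a" "gcd (a * b) n = b" if "a dvd m" "b dvd n" for a b
  proof -
    have "coprime b m" "coprime a n" using mn that by (auto elim: coprime_divisors[rotated 2] simp: coprime_commute)
    then show "gcd (a * b) m = a" "gcd (a * b) n = b"
      using that by (simp_all add: gcd_mult_left_left_cancel gcd_mult_left_right_cancel gcd_nat.absorb1 coprime_commute)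
  qed
  have "dirichlet_conv f g m * dirichlet_conv f g n =
      (\<Sum>(a, b)\<in>{a. a dvd m} \<times> {b. b dvd n}. (f a * g (m div a)) * (f b * g (n div b)))"
    unfolding dirichlet_conv_def by (simp add: sum_product sum.cartesian_product)
  also have "\<dots> = (\<Sum>d | d dvd m * n. f d * g (m * n div d))"
  proof (rule sum.reindex_bij_witness[of _ "\<lambda>d. (gcd d m, gcd d n)" "\<lambda>(a, b). a * b"])
    fix d assume "d \<in> {d. d dvd m * n}"
    then obtain a b where "d = a * b" "a dvd m" "b dvd n" using division_decomp by blast
    then show "(case (gcd d m, gcd d n) of (a, b) \<Rightarrow> a * b) = d" using gcds by simp
  next
    fix ab assume "ab \<in> {a. a dvd m} \<times> {b. b dvd n}"
    then obtain a b where ab: "ab = (a, b)" "a dvd m" "b dvd n" by auto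
    then obtain a' b' where a': "m = a * a'" "n = b * b'" by (auto elim!: dvdE)
    have pos: "a > 0" "b > 0" "a' > 0" "b' > 0" using mn a' by auto
    have cop: "coprime a b" "coprime a' b'" using mn(3) unfolding a' by auto
    have "m * n div (a * b) = a' * b'" unfolding a' using pos by (simp add: div_mult2_eq)
    then have "f (a * b) * g (m * n div (a * b)) = (f a * f b) * (g a' * g b')"
      using pos cop by (simp add: multiplicative_mult[OF f] multiplicative_mult[OF g])
    moreover have "m div a = a'" "n div b = b'" using a' pos by auto
    ultimately show "f (case ab of (a, b) \<Rightarrow> a * b) * g (m * n div (case ab of (a, b) \<Rightarrow> a * b)) =
        (case ab of (a, b) \<Rightarrow> f a * g (m div a) * (f b * g (n div b)))" by (simp add: ab)
  qed (use gcds in \<open>auto intro: mult_dvd_mono\<close>)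
  finally show "dirichlet_conv f g (m * n) = dirichlet_conv f g m * dirichlet_conv f g n"
    by (simp add: dirichlet_conv_def)
qed

text \<open>At the powers of one prime the Dirichlet convolution is the Cauchy product. This turns
identities between multiplicative functions into identities of formal power series.\<close>

lemma dirichlet_conv_prime_power:
  assumes "prime p"
  shows "dirichlet_conv f g (p ^ k) = (\<Sum>i=0..k. f (p ^ i) * g (p ^ (k - i)))"
proof -
  have p: "p > 1" using assms prime_gt_1_nat by simp
  have "(\<Sum>i=0..k. f (p ^ i) * g (p ^ (k - i))) = (\<Sum>i=0..k. f (p ^ i) * g (p ^ k div p ^ i))"
    using p by (intro sum.cong) (auto simp: power_diff)
  also have "\<dots> = (\<Sum>d\<in>(\<lambda>i. p ^ i) ` {0..k}. f d * g (p ^ k div d))"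
    using p by (subst sum.reindex) (auto simp: inj_on_def)
  also have "(\<lambda>i. p ^ i) ` {0..k} = {d. d dvd p ^ k}"
    using divides_primepow_nat[OF assms] by auto
  finally show ?thesis by (simp add: dirichlet_conv_def)
qed

text \<open>The multiplicative function with value \<open>c k\<close> at every p^k. The value 0 at 0 lets sums range over all
natural numbers.\<close>

definition prime_power_ext :: "(nat \<Rightarrow> real) \<Rightarrow> nat \<Rightarrow> real" where
  "prime_power_ext c n = (if n = 0 then 0 else \<Prod>p\<in>prime_factors n. c (multiplicity p n))"

lemma prime_power_ext_0 [simp]: "prime_power_ext c 0 = 0"
  by (simp add: prime_power_ext_def)

lemma multiplicative_prime_power_ext: "multiplicative (prime_power_ext c)"
  unfolding multiplicative_def
proof (intro conjI allI impI)
  fix m n :: nat assume mn: "m > 0" "n > 0" "coprime m n"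
  have disj: "prime_factors m \<inter> prime_factors n = {}"
  proof (rule ccontr)
    assume "prime_factors m \<inter> prime_factors n \<noteq> {}"
    then obtain p where "prime p" "p dvd m" "p dvd n" by (auto simp: in_prime_factors_iff)
    then show False using mn(3) coprime_common_divisor_nat prime_nat_iff by blast
  qed
  have mult: "multiplicity p (m * n) = multiplicity p m" if "p \<in> prime_factors m" for p
  proof -
    have "prime p" "\<not> p dvd n" using that disj mn by (auto simp: in_prime_factors_iff)
    then show ?thesis using mn by (simp add: prime_elem_multiplicity_mult_distrib not_dvd_imp_multiplicity_0)
  qed
  have mult': "multiplicity p (m * n) = multiplicity p n" if "p \<in> prime_factors n" for p
  proof -
    have "prime p" "\<not> p dvd m" using that disj mn by (auto simp: in_prime_factors_iff)
    then show ?thesis using mn by (simp add: prime_elem_multiplicity_mult_distrib not_dvd_imp_multiplicity_0)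
  qed
  show "prime_power_ext c (m * n) = prime_power_ext c m * prime_power_ext c n"
    using mn disj mult mult' by (simp add: prime_power_ext_def prime_factors_product prod.union_disjoint)
qed (simp add: prime_power_ext_def)

lemma prime_power_ext_prime_power:
  assumes "prime p" "c 0 = 1"
  shows "prime_power_ext c (p ^ k) = c k"
proof (cases "k = 0")
  case False
  then have "prime_factors (p ^ k) = {p}" using assms by (simp add: prime_factorization_prime_power)
  then show ?thesis using assms False by (simp add: prime_power_ext_def prime_gt_0_nat)
qed (use assms in \<open>simp add: prime_power_ext_def\<close>)

text \<open>A squarefree number is the product of its prime divisors, so squarefree divisors of a correspond to sets
of prime divisors of a.\<close>

lemma card_squarefree_divisors:
  assumes a: "a > 0"
  shows "card {b. b dvd a \<and> squarefree b} = 2 ^ omega a"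
proof -
  have "bij_betw (\<lambda>Q. \<Prod>Q) (Pow (prime_factors a)) {b. b dvd a \<and> squarefree b}"
  proof (rule bij_betw_byWitness[where f' = prime_factors])
    have pf: "prime_factors (\<Prod>Q) = Q" if "Q \<subseteq> prime_factors a" for Q
    proof -
      have fin: "finite Q" and pr: "\<And>q. q \<in> Q \<Longrightarrow> prime q" using that finite_subset by (auto simp: in_prime_factors_iff)
      have "0 \<notin> Q" using pr by force
      then have "prime_factors (\<Prod>Q) = (\<Union>q\<in>Q. prime_factors q)"
        using prime_factors_prod[OF fin, of "\<lambda>q. q"] by auto
      also have "\<dots> = (\<Union>q\<in>Q. {q})" using pr by (intro SUP_cong refl) (simp add: prime_factorization_prime)
      finally show ?thesis by simp
    qed
    then show "\<forall>Q\<in>Pow (prime_factors a). prime_factors (\<Prod>Q) = Q" by blast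
    show "\<forall>b\<in>{b. b dvd a \<and> squarefree b}. \<Prod>(prime_factors b) = b"
    proof safe
      fix b assume b: "b dvd a" "squarefree b"
      then have "b > 0" by (cases b) auto
      then have "b = (\<Prod>p\<in>prime_factors b. p ^ multiplicity p b)" by (rule prime_factorization_nat)
      also have "\<dots> = (\<Prod>p\<in>prime_factors b. p)"
        using b \<open>b > 0\<close> squarefree_factorial_semiring'[of b] by (intro prod.cong) auto
      finally show "\<Prod>(prime_factors b) = b" by simp
    qed
    show "(\<lambda>Q. \<Prod>Q) ` Pow (prime_factors a) \<subseteq> {b. b dvd a \<and> squarefree b}"
    proof safe
      fix Q assume Q: "Q \<subseteq> prime_factors a"
      then have pr: "\<And>q. q \<in> Q \<Longrightarrow> prime q" by (auto simp: in_prime_factors_iff)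
      show "squarefree (\<Prod>Q)"
        using pr by (intro squarefree_prod_coprime squarefree_prime primes_coprime) auto
      have "\<Prod>Q dvd (\<Prod>p\<in>prime_factors a. p)"
        using Q by (intro prod_dvd_prod_subset) auto
      also have "\<dots> dvd (\<Prod>p\<in>prime_factors a. p ^ multiplicity p a)"
        by (intro prod_dvd_prod) (auto simp: prime_factors_multiplicity)
      also have "\<dots> = a" using prime_factorization_nat[OF a] by simp
      finally show "\<Prod>Q dvd a" .
    qed
    show "prime_factors ` {b. b dvd a \<and> squarefree b} \<subseteq> Pow (prime_factors a)"
      using a dvd_prime_factors by blast
  qed
  then have "card {b. b dvd a \<and> squarefree b} = card (Pow (prime_factors a))"
    by (metis bij_betw_same_card)
  then show ?thesis by (simp add: card_Pow omega_def)
qed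

text \<open>An e-divisor is given by choosing its exponents independently for each prime, so the count is
the cardinality of a dependent product.\<close>

lemma t_e_eq_prod:
  assumes n: "n > 0"
  shows "t_e n = (\<Prod>p\<in>prime_factors n. 2 ^ omega (multiplicity p n))"
proof -
  let ?P = "prime_factors n"
  define T where "T p = {b. b dvd multiplicity p n \<and> squarefree b}" for p
  have "bij_betw (\<lambda>d. \<lambda>p\<in>?P. multiplicity p d) {d. e_divisor d n \<and> e_squarefree d} (PiE ?P T)"
  proof (rule bij_betw_byWitness[where f' = "\<lambda>b. \<Prod>p\<in>?P. p ^ b p"])
    have mult: "multiplicity q (\<Prod>p\<in>?P. p ^ b p) = (if q \<in> ?P then b q else 0)" if "prime q" for q and b :: "nat \<Rightarrow> nat"
      using that by (intro multiplicity_prod_prime_powers) (auto simp: in_prime_factors_iff)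
    have pos: "(\<Prod>p\<in>?P. p ^ b p) > 0" for b :: "nat \<Rightarrow> nat"
      by (intro prod_pos) (auto simp: in_prime_factors_iff prime_gt_0_nat)
    show "\<forall>d\<in>{d. e_divisor d n \<and> e_squarefree d}. (\<Prod>p\<in>?P. p ^ (\<lambda>p\<in>?P. multiplicity p d) p) = d"
    proof safe
      fix d assume d: "e_divisor d n"
      then have "d > 0" "prime_factors d = ?P" by (auto simp: e_divisor_def)
      then show "(\<Prod>p\<in>?P. p ^ (\<lambda>p\<in>?P. multiplicity p d) p) = d"
        using prime_factorization_nat[of d] by simp
    qed
    show "\<forall>b\<in>PiE ?P T. (\<lambda>p\<in>?P. multiplicity p (\<Prod>p\<in>?P. p ^ b p)) = b"
      using mult by (auto simp: fun_eq_iff PiE_def extensional_def in_prime_factors_iff)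
    show "(\<lambda>d. \<lambda>p\<in>?P. multiplicity p d) ` {d. e_divisor d n \<and> e_squarefree d} \<subseteq> PiE ?P T"
      by (auto simp: T_def e_divisor_def e_squarefree_def)
    show "(\<lambda>b. \<Prod>p\<in>?P. p ^ b p) ` PiE ?P T \<subseteq> {d. e_divisor d n \<and> e_squarefree d}"
    proof (rule image_subsetI)
      fix b assume b: "b \<in> PiE ?P T"
      define d where "d = (\<Prod>p\<in>?P. p ^ b p)"
      have bp: "b p dvd multiplicity p n" "squarefree (b p)" "b p > 0" if "p \<in> ?P" for p
      proof -
        show "b p dvd multiplicity p n" "squarefree (b p)" using b that by (auto simp: T_def PiE_def Pi_def)
        then show "b p > 0" by (cases "b p") auto
      qed
      have d0: "d > 0" unfolding d_def by (rule pos)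
      have md: "multiplicity q d = (if q \<in> ?P then b q else 0)" if "prime q" for q
        unfolding d_def using mult[OF that] .
      have pfd: "prime_factors d = ?P"
        using md bp d0 by (auto simp: prime_factors_multiplicity split: if_splits)
      have "e_divisor d n"
        using d0 n pfd md bp by (auto simp: e_divisor_def in_prime_factors_iff)
      moreover have "e_squarefree d"
        using d0 pfd md bp by (auto simp: e_squarefree_def in_prime_factors_iff)
      ultimately show "(\<Prod>p\<in>?P. p ^ b p) \<in> {d. e_divisor d n \<and> e_squarefree d}"
        by (simp add: d_def)
    qed
  qed
  then have "t_e n = card (PiE ?P T)" unfolding t_e_def by (rule bij_betw_same_card)
  also have "\<dots> = (\<Prod>p\<in>?P. card (T p))" by (rule card_PiE) simp
  also have "\<dots> = (\<Prod>p\<in>?P. 2 ^ omega (multiplicity p n))"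
    unfolding T_def by (intro prod.cong refl card_squarefree_divisors) (auto simp: prime_factors_multiplicity)
  finally show ?thesis .
qed

lemma omega_0 [simp]: "omega 0 = 0" and omega_1 [simp]: "omega (Suc 0) = 0"
  by (simp_all add: omega_def)

lemma real_t_e: "n > 0 \<Longrightarrow> real (t_e n) = prime_power_ext (\<lambda>a. 2 ^ omega a) n"
  by (simp add: t_e_eq_prod prime_power_ext_def)

lemma t_e_1: "t_e 1 = 1"
  using t_e_eq_prod[of 1] by simp

lemma t_e_mult:
  assumes "m > 0" "n > 0" "coprime m n"
  shows "t_e (m * n) = t_e m * t_e n"
proof -
  have "real (t_e (m * n)) = real (t_e m) * real (t_e n)"
    using assms multiplicative_mult[OF multiplicative_prime_power_ext] by (simp add: real_t_e)
  then show ?thesis by (simp flip: of_nat_mult)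
qed

lemma t_e_prime_power:
  assumes "prime p"
  shows "t_e (p ^ a) = 2 ^ omega a"
proof -
  have "real (t_e (p ^ a)) = 2 ^ omega a"
    using assms prime_power_ext_prime_power[OF assms, of "\<lambda>a. 2 ^ omega a"] by (simp add: real_t_e prime_gt_0_nat)
  then show ?thesis by (metis numeral_power_eq_of_nat_cancel_iff of_nat_eq_iff of_nat_numeral of_nat_power)
qed

text \<open>Replace each prime in the factorization of a by 2.\<close>

lemma two_power_omega_le: "a > 0 \<Longrightarrow> 2 ^ omega a \<le> a"
proof -
  assume a: "a > 0"
  have "2 ^ omega a = (\<Prod>p\<in>prime_factors a. 2::nat)" by (simp add: omega_def)
  also have "\<dots> \<le> (\<Prod>p\<in>prime_factors a. p ^ multiplicity p a)"
  proof (intro prod_mono conjI)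
    fix p assume p: "p \<in> prime_factors a"
    then have "p \<ge> 2" "multiplicity p a \<ge> 1" by (auto simp: prime_factors_multiplicity prime_ge_2_nat)
    then show "2 \<le> p ^ multiplicity p a"
      using power_increasing[of 1 "multiplicity p a" p] by simp
  qed simp
  also have "\<dots> = a" using prime_factorization_nat[OF a] by simp
  finally show ?thesis .
qed

definition square_ind :: "nat \<Rightarrow> real" where
  "square_ind n = (if n > 0 \<and> is_nth_power 2 n then 1 else 0)"

lemma multiplicative_square_ind: "multiplicative square_ind"
  by (auto simp: multiplicative_def square_ind_def is_nth_power_mult_coprime_nat_iff)

lemma square_ind_prime_power: "prime p \<Longrightarrow> square_ind (p ^ k) = (if even k then 1 else 0)"
  by (simp add: square_ind_def is_nth_power_prime_power_nat_iff prime_gt_0_nat)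

text \<open>The Euler factor of t^(e), as a power series in X = p^(-s).\<close>

definition two_pow_omega_fps :: "real fps" where
  "two_pow_omega_fps = Abs_fps (\<lambda>a. 2 ^ omega a)"

text \<open>The Euler factor of V: dividing by \<zeta>(s) \<zeta>(2s) is multiplication by (1 - X)(1 - X^2).\<close>

definition v_fps :: "real fps" where
  "v_fps = (1 - fps_X) * (1 - fps_X ^ 2) * two_pow_omega_fps"

definition v_coeff :: "nat \<Rightarrow> real" where
  "v_coeff = prime_power_ext (fps_nth v_fps)"

text \<open>The coefficients of \<zeta>(2s) V(s), needed for C1 = \<zeta>(2) V(1).\<close>

definition w_coeff :: "nat \<Rightarrow> real" where
  "w_coeff = dirichlet_conv square_ind v_coeff"

text \<open>The coefficients of \<zeta>(s) \<zeta>(2s): the number of b with b^2 dvd n.\<close>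

definition square_divisor_count :: "nat \<Rightarrow> real" where
  "square_divisor_count = dirichlet_conv (\<lambda>_. 1) square_ind"

lemma omega_prime_power: "prime p \<Longrightarrow> k > 0 \<Longrightarrow> omega (p ^ k) = 1"
  by (simp add: omega_def prime_factorization_prime_power)

lemma omega_small: "omega 2 = 1" "omega 3 = 1" "omega 4 = 1" "omega 5 = 1"
  using omega_prime_power[of 2 1] omega_prime_power[of 3 1] omega_prime_power[of 2 2] omega_prime_power[of 5 1]
  by simp_all

lemma v_fps_nth_ge_3:
  assumes "k \<ge> 3"
  shows "fps_nth v_fps k = 2 ^ omega k - 2 ^ omega (k - 1) - 2 ^ omega (k - 2) + 2 ^ omega (k - 3)"
proof -
  have eq: "v_fps = two_pow_omega_fps - fps_X * two_pow_omega_fps - fps_X ^ 2 * two_pow_omega_fps + fps_X ^ 3 * two_pow_omega_fps"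
    by (simp add: v_fps_def algebra_simps eval_nat_numeral)
  show ?thesis unfolding eq using assms by (simp add: two_pow_omega_fps_def fps_X_power_mult_nth)
qed

text \<open>The vanishing of the coefficients 1, 2 and 3 is what moves the abscissa of absolute convergence of V
down to 1/4.\<close>

lemma v_fps_nth_less_4: "fps_nth v_fps 0 = 1" "fps_nth v_fps 1 = 0" "fps_nth v_fps 2 = 0" "fps_nth v_fps 3 = 0"
proof -
  have eq: "v_fps = two_pow_omega_fps - fps_X * two_pow_omega_fps - fps_X ^ 2 * two_pow_omega_fps + fps_X ^ 3 * two_pow_omega_fps"
    by (simp add: v_fps_def algebra_simps eval_nat_numeral)
  show "fps_nth v_fps 0 = 1" "fps_nth v_fps 1 = 0" "fps_nth v_fps 2 = 0" "fps_nth v_fps 3 = 0"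
    unfolding eq by (simp_all add: two_pow_omega_fps_def fps_X_power_mult_nth omega_small)
qed

lemma abs_v_fps_nth_le: "\<bar>fps_nth v_fps (k + 4)\<bar> \<le> 4 * real (k + 4)"
proof -
  have le: "0 \<le> (2::real) ^ omega a \<and> 2 ^ omega a \<le> real (k + 4)" if "a > 0" "a \<le> k + 4" for a
  proof -
    have "2 ^ omega a \<le> k + 4" using two_power_omega_le[OF that(1)] that(2) by linarith
    then have "real (2 ^ omega a) \<le> real (k + 4)" by (simp only: of_nat_le_iff)
    then show ?thesis by simp
  qed
  have "fps_nth v_fps (k + 4) =
      2 ^ omega (k + 4) - 2 ^ omega (k + 3) - 2 ^ omega (k + 2) + 2 ^ omega (k + 1)"
    using v_fps_nth_ge_3[of "k + 4"] by (simp add: eval_nat_numeral)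
  moreover have "0 \<le> (2::real) ^ omega (k + 4) \<and> 2 ^ omega (k + 4) \<le> real (k + 4)"
      "0 \<le> (2::real) ^ omega (k + 3) \<and> 2 ^ omega (k + 3) \<le> real (k + 4)"
      "0 \<le> (2::real) ^ omega (k + 2) \<and> 2 ^ omega (k + 2) \<le> real (k + 4)"
      "0 \<le> (2::real) ^ omega (k + 1) \<and> 2 ^ omega (k + 1) \<le> real (k + 4)"
    by (rule le; simp)+
  moreover have "\<bar>a - b - c + d\<bar> \<le> 4 * K"
    if "0 \<le> a \<and> a \<le> K" "0 \<le> b \<and> b \<le> K" "0 \<le> c \<and> c \<le> K" "0 \<le> d \<and> d \<le> K" for a b c d K :: real
    using that by linarith
  ultimately show ?thesis by metis
qed

lemma multiplicative_v_coeff: "multiplicative v_coeff"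
  unfolding v_coeff_def by (rule multiplicative_prime_power_ext)

lemma v_coeff_prime_power: "prime p \<Longrightarrow> v_coeff (p ^ k) = fps_nth v_fps k"
  unfolding v_coeff_def by (rule prime_power_ext_prime_power) (simp_all add: v_fps_nth_less_4)

lemma v_coeff_0 [simp]: "v_coeff 0 = 0"
  by (simp add: v_coeff_def)

lemma multiplicative_w_coeff: "multiplicative w_coeff"
  unfolding w_coeff_def by (intro multiplicative_dirichlet_conv multiplicative_square_ind multiplicative_v_coeff)

lemma multiplicative_square_divisor_count: "multiplicative square_divisor_count"
  unfolding square_divisor_count_def by (intro multiplicative_dirichlet_conv multiplicative_square_ind) (simp add: multiplicative_def)

lemma fps_geometric_squares: "Abs_fps (\<lambda>k. if even k then 1 else 0 :: real) * (1 - fps_X ^ 2) = 1"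
proof (rule fps_ext)
  fix k
  show "fps_nth (Abs_fps (\<lambda>k. if even k then 1 else 0 :: real) * (1 - fps_X ^ 2)) k = fps_nth 1 k"
  proof -
    have "k = 0 \<or> k = 1 \<or> (\<exists>j. k = j + 2)" by presburger
    then show ?thesis by (auto simp: right_diff_distrib fps_X_power_mult_right_nth)
  qed
qed

lemma w_coeff_prime_power:
  assumes p: "prime p"
  shows "w_coeff (p ^ Suc k) = 2 ^ omega (Suc k) - 2 ^ omega k"
proof -
  have "w_coeff (p ^ j) = fps_nth (Abs_fps (\<lambda>k. if even k then 1 else 0) * v_fps) j" for j
    unfolding w_coeff_def dirichlet_conv_prime_power[OF p] fps_mult_nth
    by (simp add: square_ind_prime_power v_coeff_prime_power p)
  moreover have "Abs_fps (\<lambda>k. if even k then 1 else 0) * v_fps =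
      (Abs_fps (\<lambda>k. if even k then 1 else 0) * (1 - fps_X ^ 2)) * ((1 - fps_X) * two_pow_omega_fps)"
    by (simp add: v_fps_def mult_ac)
  then have "Abs_fps (\<lambda>k. if even k then 1 else 0) * v_fps = two_pow_omega_fps - fps_X * two_pow_omega_fps"
    by (simp add: fps_geometric_squares left_diff_distrib)
  ultimately have "w_coeff (p ^ Suc k) = fps_nth (two_pow_omega_fps - fps_X * two_pow_omega_fps) (Suc k)" by metis
  then show ?thesis by (simp add: two_pow_omega_fps_def)
qed

text \<open>Both sides are multiplicative, and at prime powers the geometric series of X and of X^2 cancel the
factors 1 - X and 1 - X^2 of the Euler factor of V.\<close>

lemma t_e_eq_dirichlet_conv:
  assumes "n > 0"
  shows "real (t_e n) = dirichlet_conv square_divisor_count v_coeff n"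
proof -
  have "real (t_e n) = prime_power_ext (\<lambda>a. 2 ^ omega a) n" using assms by (rule real_t_e)
  also have "\<dots> = dirichlet_conv square_divisor_count v_coeff n"
  proof (rule multiplicative_eqI[OF _ _ _ assms])
    show "multiplicative (prime_power_ext (\<lambda>a. 2 ^ omega a))" by (rule multiplicative_prime_power_ext)
    show "multiplicative (dirichlet_conv square_divisor_count v_coeff)"
      by (intro multiplicative_dirichlet_conv multiplicative_square_divisor_count multiplicative_v_coeff)
    fix p k :: nat assume p: "prime p"
    let ?I = "Abs_fps (\<lambda>_. 1 :: real)" and ?E = "Abs_fps (\<lambda>k. if even k then 1 else 0 :: real)"
    have I: "?I * (1 - fps_X) = 1"
      by (rule fps_ext) (auto simp: right_diff_distrib)
    have r: "square_divisor_count (p ^ j) = fps_nth (?I * ?E) j" for j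
      unfolding square_divisor_count_def dirichlet_conv_prime_power[OF p] fps_mult_nth
      by (simp add: square_ind_prime_power p)
    have "dirichlet_conv square_divisor_count v_coeff (p ^ k) = fps_nth ((?I * ?E) * v_fps) k"
      unfolding dirichlet_conv_prime_power[OF p] fps_mult_nth[of "?I * ?E"]
      by (simp add: r v_coeff_prime_power p)
    also have "(?I * ?E) * v_fps = (?I * (1 - fps_X)) * (?E * (1 - fps_X ^ 2)) * two_pow_omega_fps"
      by (simp only: v_fps_def mult_ac)
    also have "\<dots> = two_pow_omega_fps" by (simp add: I fps_geometric_squares)
    finally show "prime_power_ext (\<lambda>a. 2 ^ omega a) (p ^ k) = dirichlet_conv square_divisor_count v_coeff (p ^ k)"
      by (simp add: prime_power_ext_prime_power p two_pow_omega_fps_def)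
  qed
  finally show ?thesis .
qed

section \<open>Dirichlet products and Euler products\<close>

lemma abs_summable_on_times:
  fixes F G :: "'b \<Rightarrow> 'a :: real_normed_field"
  assumes F: "F abs_summable_on A" and G: "G abs_summable_on B"
  shows "(\<lambda>(x, y). F x * G y) abs_summable_on A \<times> B"
proof (subst Infinite_Sum.abs_summable_on_Sigma_iff, intro conjI ballI)
  fix x
  show "(\<lambda>y. case (x, y) of (x, y) \<Rightarrow> F x * G y) abs_summable_on B"
    using summable_on_cmult_right[OF G, of "norm (F x)"] by (simp add: norm_mult)
next
  have "(\<lambda>x. norm (F x) * infsum (\<lambda>y. norm (G y)) B) summable_on A"
    by (rule summable_on_cmult_left[OF F])
  then show "(\<lambda>x. \<Sum>\<^sub>\<infinity>y\<in>B. norm (case (x, y) of (x, y) \<Rightarrow> F x * G y)) abs_summable_on A"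
    by (simp add: norm_mult infsum_cmult_right' infsum_nonneg abs_mult)
qed

lemma has_sum_times:
  fixes F G :: "'b \<Rightarrow> 'a :: {real_normed_field, banach}"
  assumes F: "F abs_summable_on A" "(F has_sum a) A" and G: "G abs_summable_on B" "(G has_sum b) B"
  shows "((\<lambda>(x, y). F x * G y) has_sum a * b) (A \<times> B)"
proof (rule has_sum_SigmaI)
  show "((\<lambda>y. case (x, y) of (x, y) \<Rightarrow> F x * G y) has_sum F x * b) B" for x
    using has_sum_cmult_right[OF G(2), of "F x"] by simp
  show "((\<lambda>x. F x * b) has_sum a * b) A" by (rule has_sum_cmult_left[OF F(2)])
  show "(\<lambda>(x, y). F x * G y) summable_on A \<times> B"
    by (rule abs_summable_summable[OF abs_summable_on_times[OF F(1) G(1)]])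
qed

text \<open>The weight \<open>h\<close> is completely multiplicative, so grouping the product of the two series by the value of the
product of the indices gives the series of the convolution. A general weight covers the real series at s = 1 and the
complex series at once.\<close>

lemma has_sum_dirichlet_conv:
  fixes h :: "nat \<Rightarrow> 'a :: {real_normed_field, banach}"
  assumes h: "h 0 = 0" "\<And>m n. m > 0 \<Longrightarrow> n > 0 \<Longrightarrow> h (m * n) = h m * h n"
    and f: "(\<lambda>n. of_real (f n) * h n) abs_summable_on UNIV" "((\<lambda>n. of_real (f n) * h n) has_sum a) UNIV"
    and g: "(\<lambda>n. of_real (g n) * h n) abs_summable_on UNIV" "((\<lambda>n. of_real (g n) * h n) has_sum b) UNIV"
  shows "((\<lambda>n. of_real (dirichlet_conv f g n) * h n) has_sum a * b) UNIV"
proof -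
  define F where "F n = of_real (f n) * h n" for n
  define G where "G n = of_real (g n) * h n" for n
  have 0: "F 0 = 0" "G 0 = 0" by (simp_all add: F_def G_def h)
  let ?D = "SIGMA n:{0<..}. {d. d dvd n}"
  have "((\<lambda>(x, y). F x * G y) has_sum a * b) (UNIV \<times> UNIV)"
    using has_sum_times[OF f g] unfolding F_def G_def .
  then have "((\<lambda>(x, y). F x * G y) has_sum a * b) ({0<..} \<times> {0<..})"
    by (subst has_sum_cong_neutral[where T = "UNIV \<times> UNIV" and g = "\<lambda>(x, y). F x * G y"]) (use 0 in \<open>auto intro!: gr0I\<close>)
  also have "?this \<longleftrightarrow> ((\<lambda>(n, d). F d * G (n div d)) has_sum a * b) ?D"
    by (rule has_sum_reindex_bij_witness[of _ "\<lambda>(n, d). (d, n div d)" "\<lambda>(x, y). (x * y, x)"])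
       (auto simp: dvd_pos_nat dvd_div_eq_0_iff intro!: gr0I)
  finally have "((\<lambda>n. \<Sum>d | d dvd n. F d * G (n div d)) has_sum a * b) {0<..}"
  proof (rule has_sum_SigmaD)
    fix n :: nat assume "n \<in> {0<..}"
    then have "finite {d. d dvd n}" by simp
    from has_sum_finite[OF this, of "\<lambda>d. F d * G (n div d)"]
    show "((\<lambda>d. case (n, d) of (n, d) \<Rightarrow> F d * G (n div d)) has_sum (\<Sum>d | d dvd n. F d * G (n div d))) {d. d dvd n}"
      by simp
  qed
  then show ?thesis
  proof (subst has_sum_cong_neutral[where T = "{0<..}" and g = "\<lambda>n. \<Sum>d | d dvd n. F d * G (n div d)"])
    fix n assume "n \<in> UNIV \<inter> {0::nat<..}"
    then have n: "n > 0" by simp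
    have "h d * h (n div d) = h n" if "d dvd n" for d
    proof -
      obtain e where e: "n = d * e" using \<open>d dvd n\<close> by (rule dvdE)
      have "d > 0" "e > 0" using n e by auto
      then show ?thesis using h(2) e by simp
    qed
    then have "of_real (f d * g (n div d)) * h n = F d * G (n div d)" if "d dvd n" for d
      using that by (simp add: F_def G_def flip: \<open>\<And>d. d dvd n \<Longrightarrow> h d * h (n div d) = h n\<close>)
    then show "of_real (dirichlet_conv f g n) * h n = (\<Sum>d | d dvd n. F d * G (n div d))"
      by (simp add: dirichlet_conv_def sum_distrib_right del: of_real_mult)
  qed (use h in auto)
qed

text \<open>The preceding lemma for absolute values supplies a convergent majorant.\<close>

lemma abs_summable_dirichlet_conv:
  fixes h :: "nat \<Rightarrow> 'a :: {real_normed_field, banach}"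
  assumes h: "h 0 = 0" "\<And>m n. m > 0 \<Longrightarrow> n > 0 \<Longrightarrow> h (m * n) = h m * h n"
    and f: "(\<lambda>n. of_real (f n) * h n) abs_summable_on UNIV"
    and g: "(\<lambda>n. of_real (g n) * h n) abs_summable_on UNIV"
  shows "(\<lambda>n. of_real (dirichlet_conv f g n) * h n) abs_summable_on UNIV"
proof -
  let ?f = "\<lambda>n. \<bar>f n\<bar>" and ?g = "\<lambda>n. \<bar>g n\<bar>" and ?h = "\<lambda>n. norm (h n)"
  have f': "(\<lambda>n. of_real (?f n) * ?h n) abs_summable_on UNIV"
    and g': "(\<lambda>n. of_real (?g n) * ?h n) abs_summable_on UNIV"
    using f g by (simp_all add: norm_mult abs_mult)
  have "((\<lambda>n. of_real (dirichlet_conv ?f ?g n) * ?h n) has_sum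
      infsum (\<lambda>n. of_real (?f n) * ?h n) UNIV * infsum (\<lambda>n. of_real (?g n) * ?h n) UNIV) UNIV"
    using has_sum_dirichlet_conv[OF _ _ f' has_sum_infsum[OF abs_summable_summable[OF f']]
        g' has_sum_infsum[OF abs_summable_summable[OF g']]] h by (simp add: norm_mult)
  then have "(\<lambda>n. dirichlet_conv ?f ?g n * ?h n) summable_on UNIV"
    by (auto simp: summable_on_def)
  then show ?thesis
  proof (rule Infinite_Sum.abs_summable_on_comparison_test')
    fix n
    have "\<bar>dirichlet_conv f g n\<bar> \<le> dirichlet_conv ?f ?g n"
      unfolding dirichlet_conv_def by (rule order_trans[OF sum_abs]) (simp add: abs_mult)
    then show "norm (of_real (dirichlet_conv f g n) * h n) \<le> dirichlet_conv ?f ?g n * ?h n"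
      by (simp add: norm_mult mult_right_mono)
  qed
qed

definition smooth_numbers :: "nat \<Rightarrow> nat set" where
  "smooth_numbers N = {n. n > 0 \<and> (\<forall>p\<in>prime_factors n. p < N)}"

definition euler_factor :: "(nat \<Rightarrow> real) \<Rightarrow> nat \<Rightarrow> real" where
  "euler_factor f p = (if prime p then (\<Sum>k. f (p ^ k)) else 1)"

lemma smooth_numbers_Suc_nonprime:
  assumes "\<not> prime N"
  shows "smooth_numbers (Suc N) = smooth_numbers N"
  using assms by (auto simp: smooth_numbers_def in_prime_factors_iff less_Suc_eq)

text \<open>Allowing one more prime multiplies each smooth number by an arbitrary power of that prime. This is
the induction step for the finite Euler product.\<close>

lemma bij_betw_smooth_numbers_Suc:
  assumes N: "prime N"
  shows "bij_betw (\<lambda>(n, k). n * N ^ k) (smooth_numbers N \<times> UNIV) (smooth_numbers (Suc N))"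
proof (rule bij_betw_byWitness[where f' = "\<lambda>m. (m div N ^ multiplicity N m, multiplicity N m)"])
  have N0: "N > 0" using N by (simp add: prime_gt_0_nat)
  have mult: "multiplicity N (n * N ^ k) = k" if "n \<in> smooth_numbers N" for n k
  proof -
    have "n > 0" "\<not> N dvd n" using that N by (auto simp: smooth_numbers_def in_prime_factors_iff)
    then show ?thesis
      using N N0 by (simp add: prime_elem_multiplicity_mult_distrib not_dvd_imp_multiplicity_0)
  qed
  show "\<forall>a\<in>smooth_numbers N \<times> UNIV. ((case a of (n, k) \<Rightarrow> n * N ^ k) div N ^ multiplicity N (case a of (n, k) \<Rightarrow> n * N ^ k),
          multiplicity N (case a of (n, k) \<Rightarrow> n * N ^ k)) = a"
    using mult N0 by auto
  show "\<forall>m\<in>smooth_numbers (Suc N). (case (m div N ^ multiplicity N m, multiplicity N m) of (n, k) \<Rightarrow> n * N ^ k) = m"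
    by (simp add: multiplicity_dvd)
  show "(\<lambda>(n, k). n * N ^ k) ` (smooth_numbers N \<times> UNIV) \<subseteq> smooth_numbers (Suc N)"
  proof safe
    fix n k assume n: "n \<in> smooth_numbers N"
    have "p < Suc N" if p: "p \<in> prime_factors (n * N ^ k)" for p
    proof -
      have "prime p" "p dvd n * N ^ k" using p by (auto simp: in_prime_factors_iff)
      then have "p dvd n \<or> p dvd N" by (auto simp: prime_dvd_mult_iff dest: prime_dvd_power)
      moreover have "p < N" if "p dvd n" using that n \<open>prime p\<close> by (auto simp: smooth_numbers_def in_prime_factors_iff)
      moreover have "p \<le> N" if "p dvd N" using that N0 by (simp add: dvd_imp_le)
      ultimately show ?thesis by auto
    qed
    then show "n * N ^ k \<in> smooth_numbers (Suc N)"
      using n N0 by (auto simp: smooth_numbers_def)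
  qed
  show "(\<lambda>m. (m div N ^ multiplicity N m, multiplicity N m)) ` smooth_numbers (Suc N) \<subseteq> smooth_numbers N \<times> UNIV"
  proof safe
    fix m assume m: "m \<in> smooth_numbers (Suc N)"
    then have m0: "m > 0" by (simp add: smooth_numbers_def)
    define n where "n = m div N ^ multiplicity N m"
    have mn: "m = N ^ multiplicity N m * n" unfolding n_def by (simp add: multiplicity_dvd)
    then have n0: "n > 0" using m0 by (cases n) auto
    have "\<not> N dvd n" unfolding n_def using m0 N by (intro multiplicity_decompose) auto
    moreover have "p < Suc N" if "p \<in> prime_factors n" for p
    proof -
      have "p \<in> prime_factors m" using that m0 n0 mn by (metis dvd_prime_factors dvd_triv_right gr_implies_not0 subsetD)
      then show ?thesis using m by (auto simp: smooth_numbers_def)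
    qed
    ultimately show "m div N ^ multiplicity N m \<in> smooth_numbers N"
      using n0 unfolding n_def[symmetric] smooth_numbers_def
      by (auto simp: less_Suc_eq in_prime_factors_iff)
  qed simp_all
qed

lemma euler_product_smooth:
  assumes f: "multiplicative f"
    and pp: "\<And>p. prime p \<Longrightarrow> summable (\<lambda>k. \<bar>f (p ^ k)\<bar>)"
  shows "(\<lambda>n. \<bar>f n\<bar>) summable_on smooth_numbers N \<and>
         (f has_sum (\<Prod>p<N. euler_factor f p)) (smooth_numbers N)"
proof (induction N)
  case 0
  have "n = 1" if "prime_factors n = {}" "n > 0" for n :: nat
    using prime_factorization_nat[OF that(2)] that(1) by simp
  then have "smooth_numbers 0 = {1}" by (auto simp: smooth_numbers_def)
  then show ?case using f has_sum_finite[of "{1::nat}" f] by simp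
next
  case (Suc N)
  show ?case
  proof (cases "prime N")
    case False
    then show ?thesis using Suc by (simp add: smooth_numbers_Suc_nonprime euler_factor_def)
  next
    case True
    have N: "(\<lambda>k. f (N ^ k)) abs_summable_on UNIV"
      using pp[OF True] by (intro summable_nonneg_imp_summable_on) auto
    have "summable (\<lambda>k. f (N ^ k))" using pp[OF True] by (rule summable_rabs_cancel)
    then have N': "((\<lambda>k. f (N ^ k)) has_sum euler_factor f N) UNIV"
      using True pp[OF True] by (auto simp: euler_factor_def intro!: norm_summable_imp_has_sum)
    have eq: "f n * f (N ^ k) = f (n * N ^ k)" if "n \<in> smooth_numbers N" for n k
    proof -
      have "n > 0" "\<not> N dvd n" using that True by (auto simp: smooth_numbers_def in_prime_factors_iff)
      moreover have "coprime N n" using \<open>\<not> N dvd n\<close> True by (simp add: prime_imp_coprime)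
      ultimately show ?thesis using True
        by (intro multiplicative_mult[OF f, symmetric]) (auto simp: coprime_commute prime_gt_0_nat)
    qed
    have "(\<lambda>(n, k). f n * f (N ^ k)) abs_summable_on smooth_numbers N \<times> UNIV"
      by (rule abs_summable_on_times) (use Suc N in auto)
    then have "(\<lambda>x. norm (f (case x of (n, k) \<Rightarrow> n * N ^ k))) summable_on smooth_numbers N \<times> UNIV"
      by (rule summable_on_cong[THEN iffD1, rotated]) (auto simp: eq)
    then have 1: "f abs_summable_on smooth_numbers (Suc N)"
      using summable_on_reindex_bij_betw[OF bij_betw_smooth_numbers_Suc[OF True], of "\<lambda>x. norm (f x)"] by simp
    have "((\<lambda>(n, k). f n * f (N ^ k)) has_sum (\<Prod>p<N. euler_factor f p) * euler_factor f N) (smooth_numbers N \<times> UNIV)"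
      by (rule has_sum_times) (use Suc N N' in auto)
    then have "((\<lambda>x. f (case x of (n, k) \<Rightarrow> n * N ^ k)) has_sum (\<Prod>p<N. euler_factor f p) * euler_factor f N) (smooth_numbers N \<times> UNIV)"
      by (rule has_sum_cong[THEN iffD1, rotated]) (auto simp: eq)
    then have "(f has_sum (\<Prod>p<N. euler_factor f p) * euler_factor f N) (smooth_numbers (Suc N))"
      using has_sum_reindex_bij_betw[OF bij_betw_smooth_numbers_Suc[OF True], of f] by simp
    then show ?thesis using 1 by simp
  qed
qed

lemma multiplicative_abs: "multiplicative f \<Longrightarrow> multiplicative (\<lambda>n. \<bar>f n\<bar>)"
  by (simp add: multiplicative_def abs_mult)

text \<open>Every finite set of positive integers consists of smooth numbers for some bound, so a partial sum of
absolute values never exceeds a finite Euler product.\<close>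

lemma abs_summable_multiplicative:
  assumes f: "multiplicative f" "f 0 = 0"
    and pp: "\<And>p. prime p \<Longrightarrow> summable (\<lambda>k. \<bar>f (p ^ k)\<bar>)"
    and bound: "\<And>N. (\<Prod>p<N. euler_factor (\<lambda>n. \<bar>f n\<bar>) p) \<le> B"
  shows "f abs_summable_on UNIV"
proof (rule nonneg_bdd_above_summable_on)
  show "bdd_above (sum (\<lambda>n. norm (f n)) ` {F. F \<subseteq> UNIV \<and> finite F})"
  proof (rule bdd_aboveI2)
    fix F :: "nat set" assume "F \<in> {F. F \<subseteq> UNIV \<and> finite F}"
    then have F: "finite F" by simp
    define N where "N = Suc (Max (insert 0 F))"
    have less: "n < N" if "n \<in> F" for n using F that by (simp add: N_def less_Suc_eq_le)
    have sub: "F - {0} \<subseteq> smooth_numbers N"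
    proof
      fix n assume n: "n \<in> F - {0}"
      then have "p < N" if "p \<in> prime_factors n" for p
        using less[of n] that dvd_imp_le[of p n] by (auto simp: in_prime_factors_iff)
      then show "n \<in> smooth_numbers N" using n by (auto simp: smooth_numbers_def)
    qed
    have *: "((\<lambda>n. \<bar>f n\<bar>) has_sum (\<Prod>p<N. euler_factor (\<lambda>n. \<bar>f n\<bar>) p)) (smooth_numbers N)"
      using euler_product_smooth[OF multiplicative_abs[OF f(1)]] pp by simp
    have "(\<Sum>n\<in>F. norm (f n)) = (\<Sum>n\<in>F - {0}. \<bar>f n\<bar>)"
      using F f(2) by (intro sum.mono_neutral_cong_right) auto
    also have "\<dots> \<le> (\<Prod>p<N. euler_factor (\<lambda>n. \<bar>f n\<bar>) p)"
      by (rule finite_sum_le_has_sum[OF *]) (use F sub in auto)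
    finally show "(\<Sum>n\<in>F. norm (f n)) \<le> B" using bound[of N] by linarith
  qed
qed auto

lemma summable_prime_powers:
  fixes f :: "nat \<Rightarrow> real"
  assumes "f abs_summable_on UNIV" "prime p"
  shows "summable (\<lambda>k. \<bar>f (p ^ k)\<bar>)"
proof -
  have "p > 1" using assms prime_gt_1_nat by simp
  then have "inj (\<lambda>k. p ^ k)" by (auto simp: inj_on_def)
  then have "(\<lambda>k. \<bar>f (p ^ k)\<bar>) summable_on UNIV"
    using summable_on_reindex[of "\<lambda>k. p ^ k" UNIV "\<lambda>n. \<bar>f n\<bar>"] assms
      summable_on_subset_banach[of "\<lambda>n. \<bar>f n\<bar>" UNIV] by (auto simp: o_def)
  then show ?thesis by (rule summable_on_imp_summable)
qed

text \<open>The finite products are sums over smooth numbers, and these exhaust the positive integers, so they converge to the full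
sum by dominated convergence. That is not yet convergence as an infinite product, which excludes
a limit 0 without a zero factor; it follows since the deviations from 1 of the factors of |f| have sums
bounded by the finite products, hence by \<Sum>|f(n)|.\<close>

lemma euler_product:
  assumes f: "multiplicative f" "f 0 = 0" "f abs_summable_on UNIV"
  shows "convergent_prod (euler_factor f)" and "prodinf (euler_factor f) = infsum f UNIV"
proof -
  have sm: "summable (\<lambda>n. \<bar>f n\<bar>)" using f(3) summable_on_imp_summable by force
  have pp: "summable (\<lambda>k. \<bar>f (p ^ k)\<bar>)" if "prime p" for p
    by (rule summable_prime_powers[OF f(3) that])
  define e where "e p = euler_factor (\<lambda>n. \<bar>f n\<bar>) p - 1" for p
  have split: "(\<Sum>k. g (p ^ k)) = 1 + (\<Sum>k. g (p ^ Suc k))" if "summable (\<lambda>k. g (p ^ k))" "g 1 = 1" for g :: "nat \<Rightarrow> real" and p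
    using suminf_split_head[OF that(1)] that(2) by simp
  have e: "\<bar>euler_factor f p - 1\<bar> \<le> e p" for p
  proof (cases "prime p")
    case True
    have s: "summable (\<lambda>k. \<bar>f (p ^ Suc k)\<bar>)" using pp[OF True] by (subst summable_Suc_iff)
    have "\<bar>\<Sum>k. f (p ^ Suc k)\<bar> \<le> (\<Sum>k. \<bar>f (p ^ Suc k)\<bar>)" by (rule summable_rabs[OF s])
    then show ?thesis
      using True f(1) split[OF pp[OF True]] split[OF summable_rabs_cancel[OF pp[OF True]]]
      by (simp add: e_def euler_factor_def)
  qed (simp add: e_def euler_factor_def)
  have e0: "e p \<ge> 0" for p using e[of p] by linarith
  have "summable e"
  proof (rule summableI_nonneg_bounded)
    fix N
    have "(\<Sum>p<N. e p) \<le> (\<Prod>p<N. 1 + e p)" by (rule sum_le_prod) (use e0 in auto)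
    also have "\<dots> = (\<Prod>p<N. euler_factor (\<lambda>n. \<bar>f n\<bar>) p)" by (simp add: e_def)
    also have "\<dots> \<le> infsum (\<lambda>n. \<bar>f n\<bar>) UNIV"
    proof (rule has_sum_mono2)
      show "((\<lambda>n. \<bar>f n\<bar>) has_sum (\<Prod>p<N. euler_factor (\<lambda>n. \<bar>f n\<bar>) p)) (smooth_numbers N)"
        using euler_product_smooth[OF multiplicative_abs[OF f(1)]] pp by simp
      show "((\<lambda>n. \<bar>f n\<bar>) has_sum infsum (\<lambda>n. \<bar>f n\<bar>) UNIV) UNIV"
        using f(3) by (simp add: has_sum_infsum)
    qed auto
    finally show "(\<Sum>p<N. e p) \<le> infsum (\<lambda>n. \<bar>f n\<bar>) UNIV" .
  qed (use e0 in auto)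
  then have "summable (\<lambda>p. norm (euler_factor f p - 1))"
    by (rule summable_comparison_test_ev[rotated]) (use e in auto)
  then show conv: "convergent_prod (euler_factor f)"
    by (intro abs_convergent_prod_imp_convergent_prod summable_imp_abs_convergent_prod)
  have lim1: "(\<lambda>N. \<Prod>p<Suc N. euler_factor f p) \<longlonglongrightarrow> prodinf (euler_factor f)"
    using convergent_prod_LIMSEQ[OF conv] by (simp add: lessThan_Suc_atMost)
  \<comment> \<open>extension by 0 outside the smooth numbers, to apply dominated convergence\<close>
  have prod_eq: "(\<Prod>p<N. euler_factor f p) = (\<Sum>n. if n \<in> smooth_numbers N then f n else 0)" for N
  proof -
    have "(f has_sum (\<Prod>p<N. euler_factor f p)) (smooth_numbers N)"
      using euler_product_smooth[OF f(1) pp] by simp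
    then have "((\<lambda>n. if n \<in> smooth_numbers N then f n else 0) has_sum (\<Prod>p<N. euler_factor f p)) UNIV"
      by (subst has_sum_cong_neutral[where T = "smooth_numbers N" and g = f]) auto
    then show ?thesis using has_sum_imp_sums sums_unique by blast
  qed
  have "(\<lambda>N. \<Sum>n. if n \<in> smooth_numbers N then f n else 0) \<longlonglongrightarrow> (\<Sum>n. f n)"
  proof (rule tannerys_theorem[THEN conjunct2, THEN conjunct2])
    show "(\<lambda>N. if n \<in> smooth_numbers N then f n else 0) \<longlonglongrightarrow> f n" for n
    proof (rule tendsto_eventually, rule eventually_mono[OF eventually_gt_at_top[of n]])
      fix N assume "n < N"
      moreover have "p \<le> n" if "p \<in> prime_factors n" for p
        using that by (auto simp: in_prime_factors_iff intro: dvd_imp_le)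
      ultimately have "n = 0 \<or> n \<in> smooth_numbers N"
        unfolding smooth_numbers_def using le_less_trans by blast
      then show "(if n \<in> smooth_numbers N then f n else 0) = f n" using f(2) by auto
    qed
    show "\<forall>\<^sub>F (n, N) in at_top \<times>\<^sub>F sequentially. norm (if n \<in> smooth_numbers N then f n else 0) \<le> \<bar>f n\<bar>"
      by (intro always_eventually) auto
  qed (use sm in auto)
  then have "(\<lambda>N. \<Prod>p<N. euler_factor f p) \<longlonglongrightarrow> (\<Sum>n. f n)" by (simp add: prod_eq)
  then have "(\<lambda>N. \<Prod>p<Suc N. euler_factor f p) \<longlonglongrightarrow> (\<Sum>n. f n)" by (rule LIMSEQ_Suc)
  with lim1 have "prodinf (euler_factor f) = (\<Sum>n. f n)" by (rule LIMSEQ_unique)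
  also have "(\<Sum>n. f n) = infsum f UNIV"
    using has_sum_imp_sums[OF has_sum_infsum[OF abs_summable_summable[OF f(3)]]] sums_unique by metis
  finally show "prodinf (euler_factor f) = infsum f UNIV" .
qed

section \<open>Sums of the sawtooth function along convex sequences\<close>

text \<open>The value at integers is -1/2, so that \<lfloor>y\<rfloor> = y - 1/2 - sawtooth y holds for all y.\<close>

definition sawtooth :: "real \<Rightarrow> real" where
  "sawtooth y = frac y - 1/2"

lemma abs_sawtooth_le: "\<bar>sawtooth y\<bar> \<le> 1/2"
  using frac_ge_0[of y] frac_lt_1[of y] unfolding sawtooth_def abs_le_iff by linarith

lemma bij_betw_affine_mod:
  fixes a m :: int and q :: nat
  assumes "q > 0" and "coprime a (int q)"
  shows "bij_betw (\<lambda>k. nat ((m + a * int k) mod int q)) {..<q} {..<q}"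
proof -
  have inj: "inj_on (\<lambda>k. nat ((m + a * int k) mod int q)) {..<q}"
  proof (rule inj_onI)
    fix k l assume kl: "k \<in> {..<q}" "l \<in> {..<q}"
      and "nat ((m + a * int k) mod int q) = nat ((m + a * int l) mod int q)"
    then have "(m + a * int k) mod int q = (m + a * int l) mod int q"
      using assms(1) by (simp add: nat_eq_iff)
    then have "int q dvd (m + a * int k) - (m + a * int l)"
      by (simp add: mod_eq_dvd_iff)
    then have "int q dvd a * (int k - int l)" by (simp add: algebra_simps)
    then have "int q dvd int k - int l"
      using assms(2) by (metis coprime_commute coprime_dvd_mult_right_iff)
    then have "int k mod int q = int l mod int q"
      by (simp add: mod_eq_dvd_iff)
    then show "k = l" using kl by simp
  qed
  moreover have "(\<lambda>k. nat ((m + a * int k) mod int q)) ` {..<q} \<subseteq> {..<q}"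
    using assms(1) by (auto simp: nat_less_iff)
  ultimately show ?thesis
    by (simp add: bij_betw_def endo_inj_surj)
qed

text \<open>If q y = m + \<theta> with m an integer and 0 \<le> \<theta> < 1, then the fractional parts are
((m + a k) mod q + \<theta>) / q, and m + a k runs through all residues modulo q.\<close>

lemma sum_frac_complete_residues:
  fixes y :: real and a :: int and q :: nat
  assumes "q > 0" and "coprime a (int q)"
  shows "(\<Sum>k<q. frac (y + of_int a * real k / real q)) = frac (real q * y) + (real q - 1) / 2"
proof -
  define m where "m = \<lfloor>real q * y\<rfloor>"
  define \<theta> where "\<theta> = frac (real q * y)"
  define c where "c k = nat ((m + a * int k) mod int q)" for k
  have \<theta>: "0 \<le> \<theta>" "\<theta> < 1" by (auto simp: \<theta>_def frac_lt_1)
  have qy: "real q * y = of_int m + \<theta>" by (simp add: m_def \<theta>_def frac_def)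
  have "frac (y + of_int a * real k / real q) = (real (c k) + \<theta>) / real q" for k
  proof -
    define d where "d = (m + a * int k) div int q"
    have "m + a * int k = d * int q + int (c k)"
      using assms(1) by (simp add: d_def c_def)
    then have *: "of_int m + of_int a * real k = of_int d * real q + real (c k)"
      by (metis of_int_add of_int_mult of_int_of_nat_eq)
    have "y + of_int a * real k / real q = (of_int m + \<theta> + of_int a * real k) / real q"
      using qy assms(1) by (simp add: field_simps)
    also have "\<dots> = of_int d + (real (c k) + \<theta>) / real q"
      using * assms(1) by (simp add: field_simps)
    finally have e: "y + of_int a * real k / real q = of_int d + (real (c k) + \<theta>) / real q" .
    have "c k < q" using assms(1) by (simp add: c_def nat_less_iff)
    then have "real (c k) + 1 \<le> real q" by linarith
    then have "0 \<le> (real (c k) + \<theta>) / real q" "(real (c k) + \<theta>) / real q < 1"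
      using \<theta> assms(1) by (auto simp: field_simps)
    then show ?thesis unfolding e
      by (metis add.commute frac_add_of_int_right frac_eq)
  qed
  then have "(\<Sum>k<q. frac (y + of_int a * real k / real q)) = (\<Sum>k<q. (real (c k) + \<theta>) / real q)"
    by simp
  also have "\<dots> = (\<Sum>j<q. (real j + \<theta>) / real q)"
    using sum.reindex_bij_betw[OF bij_betw_affine_mod[OF assms, of m],
        of "\<lambda>j. (real j + \<theta>) / real q"] by (simp add: c_def)
  also have "\<dots> = ((\<Sum>j<q. real j) + real q * \<theta>) / real q"
    by (simp add: sum.distrib flip: sum_divide_distrib)
  also have "(\<Sum>j<q. real j) = real q * (real q - 1) / 2"
    by (induction q) (auto simp: field_simps)
  also have "(real q * (real q - 1) / 2 + real q * \<theta>) / real q = \<theta> + (real q - 1) / 2"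
    using assms(1) by (simp add: add_divide_distrib)
  finally show ?thesis by (simp add: \<theta>_def)
qed

text \<open>Since the floor function is monotone, moving the values by at most \<delta> can be compared
with shifting the whole rational line by \<plusminus>\<delta>. For the shifted lines the sum is a single sawtooth
value.\<close>

lemma abs_sum_sawtooth_near_rational_line:
  fixes g :: "nat \<Rightarrow> real" and a :: int and q :: nat
  assumes q: "q > 0" "coprime a (int q)"
    and near: "\<And>k. k < q \<Longrightarrow> \<bar>g k - (\<beta> + of_int a * real k / real q)\<bar> \<le> \<delta>"
  shows "\<bar>\<Sum>k<q. sawtooth (g k)\<bar> \<le> 2 * real q * \<delta> + 1/2"
proof -
  define L where "L y k = y + of_int a * real k / real q" for y k
  have total: "\<bar>\<Sum>k<q. sawtooth (L y k)\<bar> \<le> 1/2" for y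
  proof -
    have "(\<Sum>k<q. sawtooth (L y k)) = sawtooth (real q * y)"
      using sum_frac_complete_residues[OF q, of y] q(1)
      by (simp add: sawtooth_def L_def sum_subtractf diff_divide_distrib)
    then show ?thesis using abs_sawtooth_le by simp
  qed
  have up: "sawtooth (g k) \<le> 2 * \<delta> + sawtooth (L (\<beta> - \<delta>) k)" if "k < q" for k
  proof -
    have "L (\<beta> - \<delta>) k \<le> g k" using near[OF that] by (simp add: L_def abs_le_iff)
    then have "\<lfloor>L (\<beta> - \<delta>) k\<rfloor> \<le> \<lfloor>g k\<rfloor>" by (rule floor_mono)
    then have "real_of_int \<lfloor>L (\<beta> - \<delta>) k\<rfloor> \<le> of_int \<lfloor>g k\<rfloor>" by simp
    then show ?thesis using near[OF that] by (simp add: sawtooth_def frac_def L_def abs_le_iff)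
  qed
  have lo: "sawtooth (g k) \<ge> sawtooth (L (\<beta> + \<delta>) k) - 2 * \<delta>" if "k < q" for k
  proof -
    have "g k \<le> L (\<beta> + \<delta>) k" using near[OF that] by (simp add: L_def abs_le_iff)
    then have "\<lfloor>g k\<rfloor> \<le> \<lfloor>L (\<beta> + \<delta>) k\<rfloor>" by (rule floor_mono)
    then have "real_of_int \<lfloor>g k\<rfloor> \<le> of_int \<lfloor>L (\<beta> + \<delta>) k\<rfloor>" by simp
    then show ?thesis using near[OF that] by (simp add: sawtooth_def frac_def L_def abs_le_iff)
  qed
  have "(\<Sum>k<q. sawtooth (g k)) \<le> (\<Sum>k<q. 2 * \<delta> + sawtooth (L (\<beta> - \<delta>) k))"
    using up by (intro sum_mono) auto
  moreover have "(\<Sum>k<q. sawtooth (g k)) \<ge> (\<Sum>k<q. sawtooth (L (\<beta> + \<delta>) k) - 2 * \<delta>)"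
    using lo by (intro sum_mono) auto
  ultimately have
    "(\<Sum>k<q. sawtooth (g k)) \<le> 2 * real q * \<delta> + (\<Sum>k<q. sawtooth (L (\<beta> - \<delta>) k))"
    "(\<Sum>k<q. sawtooth (g k)) \<ge> (\<Sum>k<q. sawtooth (L (\<beta> + \<delta>) k)) - 2 * real q * \<delta>"
    by (simp_all add: sum.distrib sum_subtractf algebra_simps)
  then show ?thesis
    using total[of "\<beta> - \<delta>"] total[of "\<beta> + \<delta>"] by linarith
qed

text \<open>Starting at m, take the block of length \<open>q m\<close>, continue behind it, and stop when the next block does
not fit; fewer than \<tau> terms are then left over.\<close>

lemma greedy_blocks:
  fixes \<phi> :: "nat \<Rightarrow> real" and q :: "nat \<Rightarrow> nat"
  assumes q: "\<And>m. m \<ge> A \<Longrightarrow> 0 < q m \<and> q m \<le> \<tau>"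
    and small: "\<And>n. \<bar>\<phi> n\<bar> \<le> 1"
    and block: "\<And>m. m \<ge> A \<Longrightarrow> m + q m \<le> B \<Longrightarrow> \<bar>\<Sum>n\<in>{m..<m + q m}. \<phi> n\<bar> \<le> K"
    and m: "m \<ge> A"
  shows "\<exists>S\<subseteq>{m..<B}. (\<forall>s\<in>S. \<forall>s'\<in>S. s < s' \<longrightarrow> s + q s \<le> s') \<and>
           \<bar>\<Sum>n\<in>{m..<B}. \<phi> n\<bar> \<le> K * real (card S) + real \<tau>"
  using m
proof (induction "B - m" arbitrary: m rule: less_induct)
  case less
  show ?case
  proof (cases "m + q m \<le> B")
    case False
    have "\<bar>\<Sum>n\<in>{m..<B}. \<phi> n\<bar> \<le> (\<Sum>n\<in>{m..<B}. 1)"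
      by (rule order_trans[OF sum_abs sum_mono]) (use small in auto)
    also have "\<dots> \<le> real \<tau>" using False conjunct2[OF q[OF less.prems]] by simp
    finally show ?thesis by (intro exI[of _ "{}"]) auto
  next
    case True
    let ?m = "m + q m"
    have qm: "0 < q m" using q less.prems by auto
    have "B - ?m < B - m" "?m \<ge> A" using True qm less.prems by auto
    from less.hyps[OF this] obtain S where S: "S \<subseteq> {?m..<B}"
      "\<And>s s'. s \<in> S \<Longrightarrow> s' \<in> S \<Longrightarrow> s < s' \<Longrightarrow> s + q s \<le> s'"
      "\<bar>\<Sum>n\<in>{?m..<B}. \<phi> n\<bar> \<le> K * real (card S) + real \<tau>" by blast
    have fin: "finite S" using S(1) finite_subset by blast
    have "m \<notin> S" using S(1) qm by auto
    then have card: "card (insert m S) = Suc (card S)" using fin by simp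
    have "(\<Sum>n\<in>{m..<B}. \<phi> n) = (\<Sum>n\<in>{m..<?m}. \<phi> n) + (\<Sum>n\<in>{?m..<B}. \<phi> n)"
      by (rule sum.atLeastLessThan_concat[symmetric]) (use True in auto)
    then have "\<bar>\<Sum>n\<in>{m..<B}. \<phi> n\<bar> \<le> K * real (card (insert m S)) + real \<tau>"
      using S(3) block[OF less.prems True] unfolding card by (simp add: algebra_simps)
    moreover have "insert m S \<subseteq> {m..<B}" using S(1) True qm by auto
    moreover have "\<forall>s\<in>insert m S. \<forall>s'\<in>insert m S. s < s' \<longrightarrow> s + q s \<le> s'"
      using S(1,2) by auto
    ultimately show ?thesis by blast
  qed
qed

lemma card_le_of_separated:
  fixes S :: "nat set" and L :: real
  assumes fin: "finite S" and q: "q > 0"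
    and sep: "\<And>s s'. s \<in> S \<Longrightarrow> s' \<in> S \<Longrightarrow> s < s' \<Longrightarrow> s + q \<le> s'"
    and len: "\<And>s s'. s \<in> S \<Longrightarrow> s' \<in> S \<Longrightarrow> s < s' \<Longrightarrow> real s' - real s \<le> L"
    and L: "L \<ge> 0"
  shows "real (card S) \<le> 1 + L / real q"
proof (cases "S = {}")
  case True
  then show ?thesis using L by simp
next
  case False
  define u where "u = Min S"
  have u: "u \<in> S" "\<And>s. s \<in> S \<Longrightarrow> u \<le> s" using fin False by (auto simp: u_def)
  let ?h = "\<lambda>s. (s - u) div q"
  have less: "?h s < ?h s'" if "s \<in> S" "s' \<in> S" "s < s'" for s s'
  proof -
    have "s - u + q \<le> s' - u" using sep[OF that] u(2)[OF that(1)] by linarith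
    then have "(s - u + q) div q \<le> ?h s'" by (rule div_le_mono)
    then show ?thesis using q by simp
  qed
  have inj: "inj_on ?h S"
    by (rule linorder_inj_onI) (use less in \<open>auto dest: less_imp_neq\<close>)
  have sub: "?h ` S \<subseteq> {..nat \<lfloor>L / real q\<rfloor>}"
  proof safe
    fix s assume s: "s \<in> S"
    have "real (s - u) \<le> L" using len[OF u(1) s] u(2)[OF s] L by (cases "u = s") auto
    then have "real (s - u) / real q \<le> L / real q" by (simp add: divide_right_mono)
    moreover have "real (?h s) \<le> real (s - u) / real q" by (simp add: of_nat_div_le_of_nat)
    ultimately have "real (?h s) \<le> L / real q" by linarith
    then show "?h s \<le> nat \<lfloor>L / real q\<rfloor>" by (simp add: le_nat_floor)
  qed
  have "card S \<le> card {..nat \<lfloor>L / real q\<rfloor>}"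
    using card_mono[OF _ sub] card_image[OF inj] by simp
  then have "real (card S) \<le> 1 + real (nat \<lfloor>L / real q\<rfloor>)" by simp
  also have "real (nat \<lfloor>L / real q\<rfloor>) \<le> L / real q" using L by simp
  finally show ?thesis by simp
qed

lemma card_int_interval_le:
  fixes u v :: real
  assumes "u \<le> v + 1"
  shows "finite {a::int. u \<le> of_int a \<and> of_int a \<le> v}"
    and "real (card {a::int. u \<le> of_int a \<and> of_int a \<le> v}) \<le> v - u + 1"
proof -
  have eq: "{a::int. u \<le> of_int a \<and> of_int a \<le> v} = {\<lceil>u\<rceil>..\<lfloor>v\<rfloor>}"
    by (auto simp: ceiling_le_iff le_floor_iff)
  show "finite {a::int. u \<le> of_int a \<and> of_int a \<le> v}" unfolding eq by simp
  show "real (card {a::int. u \<le> of_int a \<and> of_int a \<le> v}) \<le> v - u + 1"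
    unfolding eq using assms by (simp, linarith)
qed

text \<open>Group the block starts by their fraction a/q. For given q, the slopes on the whole range lie in an interval of
length at most C \<mu> N, which leaves at most q C \<mu> N + 3 numerators. The starts with one fraction have slopes in an
interval of length 2/(q \<tau>), hence lie in an interval of length 2/(q \<tau> \<mu>); being q apart, there are at most
1 + 2/(q^2 \<tau> \<mu>) of them. The product of these bounds is summed over q \<le> \<tau>.\<close>

lemma card_block_starts_le:
  fixes g :: "nat \<Rightarrow> real" and \<mu> C :: real and q :: "nat \<Rightarrow> nat" and a :: "nat \<Rightarrow> int"
  assumes AB: "A < B" and \<mu>: "\<mu> > 0" and C: "C \<ge> 1" and \<tau>: "\<tau> > 0"
    and slope: "\<And>m n. A \<le> m \<Longrightarrow> m \<le> n \<Longrightarrow> n < B \<Longrightarrow>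
        \<mu> * (real n - real m) \<le> g n - g m \<and> g n - g m \<le> C * \<mu> * (real n - real m)"
    and S: "S \<subseteq> {A..<B}"
    and q: "\<And>s. s \<in> S \<Longrightarrow> 0 < q s \<and> q s \<le> \<tau>"
    and approx: "\<And>s. s \<in> S \<Longrightarrow> \<bar>real (q s) * g s - of_int (a s)\<bar> \<le> 1 / real \<tau>"
    and sep: "\<And>s s'. s \<in> S \<Longrightarrow> s' \<in> S \<Longrightarrow> s < s' \<Longrightarrow> s + q s \<le> s'"
    and N: "N = real B - real A"
  shows "real (card S) \<le> C * \<mu> * N * real \<tau> ^ 2 + 3 * real \<tau> +
           2 * C * N * harm \<tau> / real \<tau> + 6 * harm \<tau> / (real \<tau> * \<mu>)"
proof -
  have fin: "finite S" using S finite_subset by blast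
  have N0: "N \<ge> 0" using AB N by simp
  define I where "I r = {b::int. real r * g A - 1 \<le> of_int b \<and>
      of_int b \<le> real r * g A + real r * C * \<mu> * N + 1}" for r
  define F where "F r b = {s\<in>S. q s = r \<and> a s = b}" for r b
  have nn: "real r * C * \<mu> * N \<ge> 0" for r using N0 \<mu> C by auto
  have I_fin: "finite (I r)" and I_card: "real (card (I r)) \<le> real r * C * \<mu> * N + 3" for r
    using card_int_interval_le[of "real r * g A - 1" "real r * g A + real r * C * \<mu> * N + 1"] nn[of r]
    unfolding I_def by auto
  have F_card: "real (card (F r b)) \<le> 1 + 2 / (real r ^ 2 * real \<tau> * \<mu>)" if r: "r > 0" for r b
  proof -
    have len: "real s' - real s \<le> 2 / (real r * real \<tau> * \<mu>)"
      if s: "s \<in> F r b" "s' \<in> F r b" "s < s'" for s s'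
    proof -
      have "real r * \<mu> * (real s' - real s) \<le> real r * (g s' - g s)"
      proof -
        have "A \<le> s" "s \<le> s'" "s' < B" using s S by (auto simp: F_def)
        then have "\<mu> * (real s' - real s) \<le> g s' - g s" using slope by blast
        then show ?thesis by (simp add: mult.assoc mult_left_mono)
      qed
      also have "\<dots> \<le> 2 / real \<tau>"
        using approx[of s] approx[of s'] s unfolding F_def by (simp add: algebra_simps abs_le_iff)
      finally show ?thesis using r \<tau> \<mu> by (simp add: field_simps)
    qed
    have "real (card (F r b)) \<le> 1 + 2 / (real r * real \<tau> * \<mu>) / real r"
      by (rule card_le_of_separated) (use len fin sep r \<mu> in \<open>auto simp: F_def\<close>)
    then show ?thesis by (simp add: power2_eq_square mult_ac)
  qed
  have cover: "S \<subseteq> (\<Union>r\<in>{1..\<tau>}. \<Union>b\<in>I r. F r b)"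
  proof
    fix s assume s: "s \<in> S"
    have sAB: "A \<le> s" "s < B" using S s by auto
    have g: "0 \<le> g s - g A" "g s - g A \<le> C * \<mu> * N"
    proof -
      have "0 \<le> \<mu> * (real s - real A)" using sAB \<mu> by simp
      then show "0 \<le> g s - g A" using slope[of A s] sAB by auto
      have "C * \<mu> * (real s - real A) \<le> C * \<mu> * N" using sAB N C \<mu> by (intro mult_left_mono) auto
      then show "g s - g A \<le> C * \<mu> * N" using slope[of A s] sAB by auto
    qed
    have "1 / real \<tau> \<le> 1" using \<tau> by simp
    then have "\<bar>real (q s) * g s - of_int (a s)\<bar> \<le> 1" using approx[OF s] by linarith
    moreover have "0 \<le> real (q s) * (g s - g A)" using g by simp
    moreover have "real (q s) * (g s - g A) \<le> real (q s) * (C * \<mu> * N)"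
      using g by (intro mult_left_mono) auto
    ultimately have "a s \<in> I (q s)" unfolding I_def by (simp add: algebra_simps abs_le_iff)
    then show "s \<in> (\<Union>r\<in>{1..\<tau>}. \<Union>b\<in>I r. F r b)"
      using q[OF s] s by (auto simp: F_def)
  qed
  have "card S \<le> card (\<Union>r\<in>{1..\<tau>}. \<Union>b\<in>I r. F r b)"
    by (rule card_mono) (use cover I_fin fin in \<open>auto simp: F_def\<close>)
  also have "\<dots> \<le> (\<Sum>r\<in>{1..\<tau>}. card (\<Union>b\<in>I r. F r b))"
    by (rule card_UN_le) simp
  also have "\<dots> \<le> (\<Sum>r\<in>{1..\<tau>}. \<Sum>b\<in>I r. card (F r b))"
    by (intro sum_mono card_UN_le I_fin)
  finally have "real (card S) \<le> (\<Sum>r\<in>{1..\<tau>}. \<Sum>b\<in>I r. real (card (F r b)))"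
    by (metis (mono_tags, lifting) of_nat_mono of_nat_sum sum.cong)
  also have "\<dots> \<le> (\<Sum>r\<in>{1..\<tau>}. \<Sum>b\<in>I r. 1 + 2 / (real r ^ 2 * real \<tau> * \<mu>))"
    by (intro sum_mono F_card) auto
  also have "\<dots> = (\<Sum>r\<in>{1..\<tau>}. real (card (I r)) * (1 + 2 / (real r ^ 2 * real \<tau> * \<mu>)))"
    by simp
  also have "\<dots> \<le> (\<Sum>r\<in>{1..\<tau>}. real \<tau> * (C * \<mu> * N) + 3 + (2 * C * N / real \<tau>) * inverse (real r) +
       6 / (real \<tau> * \<mu>) * inverse (real r))"
  proof (rule sum_mono)
    fix r assume "r \<in> {1..\<tau>}"
    then have r: "r \<ge> 1" "r \<le> \<tau>" by auto
    have "real (card (I r)) * (1 + 2 / (real r ^ 2 * real \<tau> * \<mu>)) \<le>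
        (real r * C * \<mu> * N + 3) * (1 + 2 / (real r ^ 2 * real \<tau> * \<mu>))"
      using I_card \<mu> by (intro mult_right_mono) auto
    also have "\<dots> = real r * (C * \<mu> * N) + 3 + (2 * C * N / real \<tau>) * inverse (real r) +
       6 / (real \<tau> * \<mu>) * inverse (real r ^ 2)"
      using r \<tau> \<mu> by (simp add: field_simps power2_eq_square)
    also have "\<dots> \<le> real \<tau> * (C * \<mu> * N) + 3 + (2 * C * N / real \<tau>) * inverse (real r) +
       6 / (real \<tau> * \<mu>) * inverse (real r)"
    proof -
      have "real r * (C * \<mu> * N) \<le> real \<tau> * (C * \<mu> * N)"
        using r C \<mu> N0 by (intro mult_right_mono) auto
      moreover have "inverse (real r ^ 2) \<le> inverse (real r)"
        using r by (intro le_imp_inverse_le) (auto simp: power2_eq_square)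
      then have "6 / (real \<tau> * \<mu>) * inverse (real r ^ 2) \<le> 6 / (real \<tau> * \<mu>) * inverse (real r)"
        using \<mu> by (intro mult_left_mono) auto
      ultimately show ?thesis by linarith
    qed
    finally show "real (card (I r)) * (1 + 2 / (real r ^ 2 * real \<tau> * \<mu>)) \<le> \<dots>" .
  qed
  also have "\<dots> = C * \<mu> * N * real \<tau> ^ 2 + 3 * real \<tau> +
           2 * C * N * harm \<tau> / real \<tau> + 6 * harm \<tau> / (real \<tau> * \<mu>)"
  proof -
    have "(\<Sum>r\<in>{1..\<tau>}. X + 3 + P * inverse (real r) + Q * inverse (real r)) =
        real \<tau> * (X + 3) + P * harm \<tau> + Q * harm \<tau>" for X P Q :: real
      by (simp add: sum.distrib harm_def sum_distrib_left algebra_simps)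
    from this[of "real \<tau> * (C * \<mu> * N)" "2 * C * N / real \<tau>" "6 / (real \<tau> * \<mu>)"] show ?thesis
      by (simp only:) (simp add: power2_eq_square algebra_simps)
  qed
  finally show ?thesis .
qed

text \<open>Vinogradov's method. The sequence \<open>g\<close> plays the part of the derivative of \<open>f\<close>, and \<mu> that of the order of
magnitude of the second derivative. In a block of length q \<le> \<tau> the distance to the rational line is
O(\<mu> \<tau>^2 + 1/\<tau>), so the condition \<tau>^3 \<mu> \<le> 1 bounds each block sum by a constant.\<close>

lemma abs_sum_sawtooth_le:
  fixes f g :: "nat \<Rightarrow> real" and \<mu> C :: real
  assumes AB: "A < B" and \<mu>: "\<mu> > 0" and C: "C \<ge> 1" and \<tau>: "\<tau> > 0" "real \<tau> ^ 3 * \<mu> \<le> 1"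
    and slope: "\<And>m n. A \<le> m \<Longrightarrow> m \<le> n \<Longrightarrow> n < B \<Longrightarrow>
        \<mu> * (real n - real m) \<le> g n - g m \<and> g n - g m \<le> C * \<mu> * (real n - real m)"
    and taylor: "\<And>m k. A \<le> m \<Longrightarrow> m + k < B \<Longrightarrow> \<bar>f (m + k) - f m - g m * real k\<bar> \<le> C * \<mu> * real k ^ 2"
    and N: "N = real B - real A"
  shows "\<bar>\<Sum>n\<in>{A..<B}. sawtooth (f n)\<bar> \<le> (2 * C + 5/2) *
          (C * \<mu> * N * real \<tau> ^ 2 + 3 * real \<tau> + 2 * C * N * harm \<tau> / real \<tau> + 6 * harm \<tau> / (real \<tau> * \<mu>)) + real \<tau>"
proof -
  have "\<exists>h k. coprime h k \<and> 0 < k \<and> k \<le> int \<tau> \<and> \<bar>of_int k * g m - of_int h\<bar> < 1 / real \<tau>" for m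
    using Dirichlet_approx_coprime[OF \<tau>(1), of "g m"] by metis
  then obtain a k where ak: "\<And>m. coprime (a m) (k m)" "\<And>m. (0::int) < k m" "\<And>m. k m \<le> int \<tau>"
    "\<And>m. \<bar>of_int (k m) * g m - of_int (a m)\<bar> < 1 / real \<tau>" by metis
  define q where "q m = nat (k m)" for m
  have kq: "k m = int (q m)" for m using ak(2)[of m] by (simp add: q_def)
  have q: "0 < q m" "q m \<le> \<tau>" "coprime (a m) (int (q m))"
      "\<bar>real (q m) * g m - of_int (a m)\<bar> < 1 / real \<tau>" for m
    using ak[of m] unfolding kq by auto
  \<comment> \<open>the first summand is the deviation from the tangent, the second that of the slope from a/q\<close>
  define \<delta> where "\<delta> = C * \<mu> * real \<tau> ^ 2 + 1 / real \<tau>"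
  have \<delta>0: "\<delta> \<ge> 0" using C \<mu> by (simp add: \<delta>_def)
  have block: "\<bar>\<Sum>n\<in>{m..<m + q m}. sawtooth (f n)\<bar> \<le> 2 * C + 5/2" if m: "m \<ge> A" "m + q m \<le> B" for m
  proof -
    have "\<bar>\<Sum>k<q m. sawtooth (f (m + k))\<bar> \<le> 2 * real (q m) * \<delta> + 1/2"
    proof (rule abs_sum_sawtooth_near_rational_line[where \<beta> = "f m" and a = "a m"])
      fix k assume k: "k < q m"
      have "\<bar>f (m + k) - f m - g m * real k\<bar> \<le> C * \<mu> * real k ^ 2"
        using taylor[of m k] m k by simp
      also have "\<dots> \<le> C * \<mu> * real \<tau> ^ 2"
        using C \<mu> k q(2)[of m] by (intro mult_left_mono power_mono) auto
      finally have 1: "\<bar>f (m + k) - f m - g m * real k\<bar> \<le> C * \<mu> * real \<tau> ^ 2" .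
      have "\<bar>g m * real k - of_int (a m) * real k / real (q m)\<bar> =
          \<bar>real (q m) * g m - of_int (a m)\<bar> * (real k / real (q m))"
      proof -
        have "g m * real k - of_int (a m) * real k / real (q m) =
            (real (q m) * g m - of_int (a m)) * (real k / real (q m))"
          using q(1)[of m] by (simp add: field_simps)
        then show ?thesis by (simp add: abs_mult)
      qed
      also have "\<dots> \<le> (1 / real \<tau>) * 1"
        using q(4)[of m] k by (intro mult_mono) auto
      finally show "\<bar>f (m + k) - (f m + of_int (a m) * real k / real (q m))\<bar> \<le> \<delta>"
        using 1 unfolding \<delta>_def by linarith
    qed (use q in auto)
    also have "(\<Sum>k<q m. sawtooth (f (m + k))) = (\<Sum>n\<in>{m..<m + q m}. sawtooth (f n))"
      by (rule sum.reindex_bij_witness[of _ "\<lambda>n. n - m" "\<lambda>k. m + k"]) auto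
    also have "2 * real (q m) * \<delta> + 1/2 \<le> 2 * real \<tau> * \<delta> + 1/2"
      using q(2)[of m] \<delta>0 by (simp add: mult_right_mono)
    also have "2 * real \<tau> * \<delta> = 2 * C * (real \<tau> ^ 3 * \<mu>) + 2"
      using \<tau>(1) by (simp add: \<delta>_def field_simps power2_eq_square power3_eq_cube)
    also have "\<dots> \<le> 2 * C * 1 + 2" using C \<tau>(2) by (intro add_right_mono mult_left_mono) auto
    finally show ?thesis by simp
  qed
  have "\<exists>S\<subseteq>{A..<B}. (\<forall>s\<in>S. \<forall>s'\<in>S. s < s' \<longrightarrow> s + q s \<le> s') \<and>
      \<bar>\<Sum>n\<in>{A..<B}. sawtooth (f n)\<bar> \<le> (2 * C + 5/2) * real (card S) + real \<tau>"
  proof (rule greedy_blocks[of A q \<tau>])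
    show "\<bar>sawtooth (f n)\<bar> \<le> 1" for n using abs_sawtooth_le[of "f n"] by linarith
  qed (use q block in auto)
  then obtain S where S: "S \<subseteq> {A..<B}" "\<And>s s'. s \<in> S \<Longrightarrow> s' \<in> S \<Longrightarrow> s < s' \<Longrightarrow> s + q s \<le> s'"
      "\<bar>\<Sum>n\<in>{A..<B}. sawtooth (f n)\<bar> \<le> (2 * C + 5/2) * real (card S) + real \<tau>" by blast
  have "real (card S) \<le> C * \<mu> * N * real \<tau> ^ 2 + 3 * real \<tau> +
           2 * C * N * harm \<tau> / real \<tau> + 6 * harm \<tau> / (real \<tau> * \<mu>)"
    by (rule card_block_starts_le[OF AB \<mu> C \<tau>(1) slope S(1), where q = q and a = a])
       (use q S N in \<open>auto intro: less_imp_le\<close>)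
  then have "(2 * C + 5/2) * real (card S) \<le> (2 * C + 5/2) * (C * \<mu> * N * real \<tau> ^ 2 + 3 * real \<tau> +
           2 * C * N * harm \<tau> / real \<tau> + 6 * harm \<tau> / (real \<tau> * \<mu>))"
    using C by (intro mult_left_mono) auto
  then show ?thesis using S(3) by linarith
qed

text \<open>The choice \<tau> = \<lfloor>A/z\<rfloor> makes each of the four terms of the general bound O(z log x). The
condition \<mu> A^3 \<le> z^3 serves both to bound the term with \<tau>^2 and to ensure \<tau>^3 \<mu> \<le> 1; the lower bound for \<mu> A
controls the term with 1/(\<tau> \<mu>).\<close>

lemma abs_sum_sawtooth_dyadic:
  fixes f g h :: "real \<Rightarrow> real" and x z \<mu> :: real
  assumes z: "z \<ge> 1" "z ^ 4 = x"
    and A: "z \<le> real A" "real A ^ 3 \<le> x" "A < B" "B \<le> 2 * A"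
    and f: "\<And>t. real A \<le> t \<Longrightarrow> t \<le> real B \<Longrightarrow> (f has_real_derivative g t) (at t)"
    and g: "\<And>t. real A \<le> t \<Longrightarrow> t \<le> real B \<Longrightarrow> (g has_real_derivative h t) (at t)"
    and h: "\<And>t. real A \<le> t \<Longrightarrow> t \<le> real B \<Longrightarrow> \<mu> \<le> h t \<and> h t \<le> 16 * \<mu>"
    and \<mu>: "\<mu> > 0" "\<mu> * real A ^ 3 \<le> z ^ 3" "1/8 \<le> \<mu> * real A"
  shows "\<bar>\<Sum>n\<in>{A..<B}. sawtooth (f (real n))\<bar> \<le> 6200 * z * (1 + ln x)"
proof -
  define \<tau> where "\<tau> = nat \<lfloor>real A / z\<rfloor>"
  have zA: "1 \<le> real A / z" using z A by (simp add: field_simps)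
  have A1: "real A \<ge> 1" using z A by linarith
  have x1: "x \<ge> 1" using z by (metis one_le_power)
  have \<tau>_le: "real \<tau> \<le> real A / z" unfolding \<tau>_def using zA by simp
  have \<tau>1: "\<tau> \<ge> 1" unfolding \<tau>_def using zA by (simp add: le_nat_iff)
  have "real A / z < real \<tau> + 1" unfolding \<tau>_def using zA by linarith
  also have "\<dots> \<le> 2 * real \<tau>" using \<tau>1 by simp
  finally have \<tau>_ge: "real A / z < 2 * real \<tau>" .
  \<comment> \<open>A is at most the cube root of x = z^4, hence below its square root\<close>
  have Az: "real A \<le> z ^ 2"
  proof -
    have "real A ^ 3 \<le> z ^ 4" using A z by simp
    also have "\<dots> \<le> z ^ 6" using z(1) by (intro power_increasing) auto
    finally have "real A ^ 3 \<le> (z ^ 2) ^ 3" by (simp flip: power_mult)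
    then show ?thesis by (rule power_le_imp_le_base[of _ 2, simplified]) (use z in auto)
  qed
  have \<tau>z: "real \<tau> \<le> z"
    using \<tau>_le Az z by (smt (verit) divide_right_mono nonzero_mult_div_cancel_left power2_eq_square)
  define l where "l = 1 + ln x"
  have l: "l \<ge> 1" using x1 by (simp add: l_def)
  have harm: "harm \<tau> \<le> l"
  proof -
    have "real \<tau> \<le> real A" using \<tau>_le z(1) A1 by (smt (verit) divide_le_eq_1 le_divide_eq_1 divide_le_eq mult_le_cancel_left1)
    also have "real A \<le> real A ^ 3" using A1 by (simp add: self_le_power)
    also have "\<dots> \<le> x" by (rule A)
    finally have "ln (real \<tau>) \<le> ln x" using \<tau>1 by simp
    moreover have "harm \<tau> \<le> ln (real \<tau>) + 1" using euler_mascheroni_sequence_decreasing[of 1 \<tau>] \<tau>1 by (simp add: harm_expand)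
    ultimately show ?thesis by (simp add: l_def)
  qed
  define N where "N = real B - real A"
  have N: "0 \<le> N" "N \<le> real A" using A by (auto simp: N_def)
  have slope: "\<mu> * (t - s) \<le> g t - g s \<and> g t - g s \<le> 16 * \<mu> * (t - s)"
    if "real A \<le> s" "s \<le> t" "t \<le> real B" for s t
  proof (cases "s = t")
    case False
    then have "s < t" using that by simp
    moreover have "(g has_real_derivative h u) (at u)" if "s \<le> u" "u \<le> t" for u
      using g \<open>real A \<le> s\<close> \<open>t \<le> real B\<close> that by auto
    ultimately obtain \<xi> where "s < \<xi>" "\<xi> < t" "g t - g s = (t - s) * h \<xi>"
      using MVT2 by blast
    then show ?thesis using h[of \<xi>] that
      by (auto simp: mult.commute mult_left_mono intro!: mult_left_mono)
  qed auto
  have taylor: "\<bar>f (s + k) - f s - g s * k\<bar> \<le> 16 * \<mu> * k ^ 2"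
    if "real A \<le> s" "s + k \<le> real B" "k \<ge> 0" for s k
  proof (cases "k = 0")
    case False
    then have "s < s + k" using that by simp
    moreover have "(f has_real_derivative g u) (at u)" if "s \<le> u" "u \<le> s + k" for u
      using f \<open>real A \<le> s\<close> \<open>s + k \<le> real B\<close> that by auto
    ultimately obtain \<xi> where \<xi>: "s < \<xi>" "\<xi> < s + k" "f (s + k) - f s = (s + k - s) * g \<xi>"
      using MVT2 by blast
    have "0 \<le> \<mu> * (\<xi> - s)" using \<xi> \<mu> by simp
    then have "0 \<le> g \<xi> - g s" using slope[of s \<xi>] \<xi> that by auto
    moreover have "g \<xi> - g s \<le> 16 * \<mu> * (\<xi> - s)" using slope[of s \<xi>] \<xi> that by auto
    moreover have "16 * \<mu> * (\<xi> - s) \<le> 16 * \<mu> * k" using \<xi> \<mu> by (intro mult_left_mono) auto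
    ultimately have "\<bar>g \<xi> - g s\<bar> \<le> 16 * \<mu> * k" by linarith
    then have "k * \<bar>g \<xi> - g s\<bar> \<le> k * (16 * \<mu> * k)" using that by (intro mult_left_mono) auto
    moreover have "f (s + k) - f s - g s * k = k * (g \<xi> - g s)" using \<xi>(3) by (simp add: algebra_simps)
    ultimately show ?thesis using that by (simp add: abs_mult power2_eq_square mult_ac)
  qed auto
  have \<tau>\<mu>: "real \<tau> ^ 3 * \<mu> \<le> 1"
  proof -
    have "real \<tau> ^ 3 * \<mu> \<le> (real A / z) ^ 3 * \<mu>" using \<tau>_le \<mu> by (intro mult_right_mono power_mono) auto
    also have "\<dots> = \<mu> * real A ^ 3 / z ^ 3" by (simp add: power_divide)
    also have "\<dots> \<le> 1" using \<mu> z by simp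
    finally show ?thesis .
  qed
  let ?Q = "16 * \<mu> * N * real \<tau> ^ 2 + 3 * real \<tau> + 2 * 16 * N * harm \<tau> / real \<tau> + 6 * harm \<tau> / (real \<tau> * \<mu>)"
  have "\<bar>\<Sum>n\<in>{A..<B}. sawtooth (f (real n))\<bar> \<le> (2 * 16 + 5/2) * ?Q + real \<tau>"
  proof (rule abs_sum_sawtooth_le[where g = "\<lambda>n. g (real n)"])
    fix m k assume "A \<le> m" "m + k < B"
    then show "\<bar>f (real (m + k)) - f (real m) - g (real m) * real k\<bar> \<le> 16 * \<mu> * real k ^ 2"
      using taylor[of "real m" "real k"] by (simp flip: of_nat_add)
  qed (use A \<mu> \<tau>\<mu> \<tau>1 slope N_def in auto)
  also have "?Q \<le> 179 * z * l"
  proof -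
    have zl: "z \<le> z * l" using z l by simp
    have "\<mu> * N * real \<tau> ^ 2 \<le> \<mu> * real A * (real A / z) ^ 2"
      using \<mu> N \<tau>_le by (intro mult_mono power_mono mult_left_mono) auto
    also have "\<dots> = \<mu> * real A ^ 3 / z ^ 2" by (simp add: power_divide power2_eq_square power3_eq_cube)
    also have "\<dots> \<le> z ^ 3 / z ^ 2" using \<mu> by (intro divide_right_mono) auto
    also have "\<dots> = z" using z by (simp add: power2_eq_square power3_eq_cube)
    finally have 1: "\<mu> * N * real \<tau> ^ 2 \<le> z" .
    have inv: "1 / real \<tau> \<le> 2 * z / real A"
      using \<tau>_ge \<tau>1 A1 z by (simp add: field_simps)
    have h0: "(0::real) \<le> harm \<tau>" by (rule harm_nonneg)
    have "N * harm \<tau> * (1 / real \<tau>) \<le> real A * l * (2 * z / real A)"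
      using N harm inv h0 l by (intro mult_mono) auto
    also have "\<dots> = 2 * z * l" using A1 by simp
    finally have 2: "N * harm \<tau> / real \<tau> \<le> 2 * z * l" by simp
    have "1 / \<mu> \<le> 8 * real A" using \<mu> by (simp add: field_simps)
    then have "harm \<tau> * (1 / real \<tau>) * (1 / \<mu>) \<le> l * (2 * z / real A) * (8 * real A)"
      using harm inv h0 l \<mu> z by (intro mult_mono) auto
    also have "\<dots> = 16 * z * l" using A1 by simp
    finally have 3: "harm \<tau> / (real \<tau> * \<mu>) \<le> 16 * z * l" by simp
    show ?thesis using 1 2 3 zl \<tau>z by simp
  qed
  also have "real \<tau> \<le> z * l"
  proof -
    have "real \<tau> \<le> z" by (rule \<tau>z)
    also have "z \<le> z * l" using z l by simp
    finally show ?thesis .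
  qed
  finally have "\<bar>\<Sum>n\<in>{A..<B}. sawtooth (f (real n))\<bar> \<le> (2 * 16 + 5/2) * (179 * z * l) + z * l" by simp
  also have "\<dots> \<le> 6200 * z * l" using z l by simp
  finally show ?thesis unfolding l_def .
qed

text \<open>Repeated halving of the range; a range below 2z is estimated trivially.\<close>

lemma abs_sum_le_dyadic:
  fixes \<phi> :: "nat \<Rightarrow> real" and z R :: real
  assumes small: "\<And>n. \<bar>\<phi> n\<bar> \<le> 1" and R: "2 * z \<le> R" "0 \<le> R"
    and block: "\<And>A B. z \<le> real A \<Longrightarrow> 1 \<le> A \<Longrightarrow> A < B \<Longrightarrow> B \<le> 2 * A \<Longrightarrow> B \<le> Y + 1 \<Longrightarrow>
                  \<bar>\<Sum>n\<in>{A..<B}. \<phi> n\<bar> \<le> R"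
    and M: "M \<le> 2 ^ j" "M \<le> Y + 1"
  shows "\<bar>\<Sum>n\<in>{1..<M}. \<phi> n\<bar> \<le> real (j + 1) * R"
  using M
proof (induction j arbitrary: M)
  case 0
  then have "{1..<M} = {}" by auto
  then show ?case using R by simp
next
  case (Suc j)
  define A where "A = (M + 1) div 2"
  show ?case
  proof (cases "M \<le> 1 \<or> real A < z")
    case True
    have "\<bar>\<Sum>n\<in>{1..<M}. \<phi> n\<bar> \<le> (\<Sum>n\<in>{1..<M}. 1)"
      by (rule order_trans[OF sum_abs sum_mono]) (use small in auto)
    also have "\<dots> = real (M - 1)" by simp
    also have "\<dots> \<le> R"
    proof (cases "M \<le> 1")
      case True
      then show ?thesis using R by simp
    next
      case False
      then have "real A < z" using \<open>M \<le> 1 \<or> real A < z\<close> by auto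
      moreover have "M \<le> 2 * A" by (simp add: A_def)
      then have "real M \<le> 2 * real A" by linarith
      moreover have "real (M - 1) \<le> real M" by simp
      ultimately show ?thesis using R by linarith
    qed
    also have "R \<le> real (Suc j + 1) * R" using R by (simp add: algebra_simps)
    finally show ?thesis .
  next
    case False
    then have M2: "M \<ge> 2" and zA: "z \<le> real A" by auto
    have A: "1 \<le> A" "A < M" "M \<le> 2 * A" "A \<le> 2 ^ j" "A \<le> Y + 1"
      using M2 Suc.prems by (auto simp: A_def)
    have "(\<Sum>n\<in>{1..<M}. \<phi> n) = (\<Sum>n\<in>{1..<A}. \<phi> n) + (\<Sum>n\<in>{A..<M}. \<phi> n)"
      by (rule sum.atLeastLessThan_concat[symmetric]) (use A in auto)
    moreover have "\<bar>\<Sum>n\<in>{1..<A}. \<phi> n\<bar> \<le> real (j + 1) * R" using Suc.IH A by simp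
    moreover have "\<bar>\<Sum>n\<in>{A..<M}. \<phi> n\<bar> \<le> R" using block[OF zA A(1-3) Suc.prems(2)] .
    ultimately show ?thesis by (simp add: algebra_simps)
  qed
qed

lemma abs_sum_sawtooth_upto:
  fixes f :: "nat \<Rightarrow> real" and x z :: real
  assumes z: "z \<ge> 1" "z ^ 4 = x" and Y: "real Y ^ 3 \<le> x"
    and block: "\<And>A B. z \<le> real A \<Longrightarrow> real A ^ 3 \<le> x \<Longrightarrow> 1 \<le> A \<Longrightarrow> A < B \<Longrightarrow> B \<le> 2 * A \<Longrightarrow>
                  \<bar>\<Sum>n\<in>{A..<B}. sawtooth (f n)\<bar> \<le> 6200 * z * (1 + ln x)"
  shows "\<bar>\<Sum>n\<in>{1..Y}. sawtooth (f n)\<bar> \<le> 24800 * z * (1 + ln x) ^ 2"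
proof -
  have x1: "x \<ge> 1" using z by (metis one_le_power)
  \<comment> \<open>the number of halvings, which contributes the second logarithm\<close>
  define j where "j = nat \<lceil>log 2 (real Y + 1)\<rceil>"
  define R where "R = 6200 * z * (1 + ln x)"
  have l: "1 + ln x \<ge> 1" using x1 by simp
  have "z * 1 \<le> z * (1 + ln x)" using z l by (intro mult_left_mono) auto
  then have R: "2 * z \<le> R" "0 \<le> R" using z unfolding R_def by auto
  have "real (Y + 1) = 2 powr log 2 (real Y + 1)" by simp
  also have "\<dots> \<le> 2 powr real j" unfolding j_def by (intro powr_mono) linarith+
  also have "\<dots> = real (2 ^ j)" by (simp add: powr_realpow)
  finally have Yj: "Y + 1 \<le> 2 ^ j" by (simp only: of_nat_le_iff)
  have "\<bar>\<Sum>n\<in>{1..<Y + 1}. sawtooth (f n)\<bar> \<le> real (j + 1) * R"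
  proof (rule abs_sum_le_dyadic[where Y = Y and z = z])
    show "\<bar>sawtooth (f n)\<bar> \<le> 1" for n using abs_sawtooth_le[of "f n"] by linarith
    fix A B assume AB: "z \<le> real A" "1 \<le> A" "A < B" "B \<le> 2 * A" "B \<le> Y + 1"
    then have "real A ^ 3 \<le> real Y ^ 3" by (intro power_mono) auto
    then have "real A ^ 3 \<le> x" using Y by linarith
    then show "\<bar>\<Sum>n\<in>{A..<B}. sawtooth (f n)\<bar> \<le> R" unfolding R_def using block AB by auto
  qed (use R Yj in auto)
  also have "real (j + 1) \<le> 4 * (1 + ln x)"
  proof -
    have "real Y \<le> x"
    proof (cases "Y = 0")
      case False
      then have "real Y \<le> real Y ^ 3" by (intro self_le_power) auto
      then show ?thesis using Y by linarith
    qed (use x1 in auto)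
    then have "log 2 (real Y + 1) \<le> log 2 (2 * x)" using x1 by simp
    also have "\<dots> = 1 + ln x / ln 2" using x1 by (simp add: log_def ln_mult add_divide_distrib)
    also have "ln x / ln 2 \<le> ln x / (1 / 2)"
      using x1 ln2_ge_two_thirds by (intro divide_left_mono) auto
    finally have "log 2 (real Y + 1) \<le> 1 + 2 * ln x" by simp
    moreover have "real j \<le> log 2 (real Y + 1) + 1"
    proof -
      have "0 \<le> log 2 (real Y + 1)" by simp
      then show ?thesis unfolding j_def using of_int_ceiling_le_add_one[of "log 2 (real Y + 1)"] by simp
    qed
    moreover have "ln x \<ge> 0" using x1 by simp
    ultimately show ?thesis by simp
  qed
  then have "real (j + 1) * R \<le> 4 * (1 + ln x) * R" using R by (intro mult_right_mono)
  also have "\<dots> = 24800 * z * (1 + ln x) ^ 2" by (simp add: R_def power2_eq_square algebra_simps)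
  finally show ?thesis by (simp add: atLeastLessThanSuc_atLeastAtMost)
qed

lemma abs_sum_sawtooth_inverse_square:
  fixes x z :: real
  assumes z: "z \<ge> 1" "z ^ 4 = x" and Y: "real Y ^ 3 \<le> x"
  shows "\<bar>\<Sum>n\<in>{1..Y}. sawtooth (x / real n ^ 2)\<bar> \<le> 24800 * z * (1 + ln x) ^ 2"
proof (rule abs_sum_sawtooth_upto[OF z Y])
  fix A B :: nat
  assume A: "z \<le> real A" "real A ^ 3 \<le> x" "1 \<le> A" "A < B" "B \<le> 2 * A"
  have x: "x > 0" using z by (metis one_le_power less_le_trans zero_less_one)
  have A0: "real A > 0" using A by simp
  \<comment> \<open>the second derivative 6x / t^4 at t = 2A\<close>
  define \<mu> where "\<mu> = 3 * x / (8 * real A ^ 4)"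
  show "\<bar>\<Sum>n\<in>{A..<B}. sawtooth (x / real n ^ 2)\<bar> \<le> 6200 * z * (1 + ln x)"
  proof (rule abs_sum_sawtooth_dyadic[OF z A(1,2,4,5), where f = "\<lambda>t. x / t ^ 2"
        and g = "\<lambda>t. - 2 * x / t ^ 3" and h = "\<lambda>t. 6 * x / t ^ 4" and \<mu> = \<mu>])
    fix t assume t: "real A \<le> t" "t \<le> real B"
    then have t0: "t > 0" using A0 by linarith
    show "((\<lambda>t. x / t ^ 2) has_real_derivative - 2 * x / t ^ 3) (at t)"
      using t0 by (auto intro!: derivative_eq_intros simp: field_simps eval_nat_numeral)
    show "((\<lambda>t. - 2 * x / t ^ 3) has_real_derivative 6 * x / t ^ 4) (at t)"
      using t0 by (auto intro!: derivative_eq_intros simp: field_simps eval_nat_numeral)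
    have "t \<le> 2 * real A" using t A by linarith
    then have "t ^ 4 \<le> (2 * real A) ^ 4" using t0 by (intro power_mono) auto
    then have "6 * x / (2 * real A) ^ 4 \<le> 6 * x / t ^ 4"
      using t0 A0 x by (intro divide_left_mono) auto
    moreover have "6 * x / t ^ 4 \<le> 6 * x / real A ^ 4"
      using t t0 A0 x by (intro divide_left_mono power_mono) auto
    ultimately show "\<mu> \<le> 6 * x / t ^ 4 \<and> 6 * x / t ^ 4 \<le> 16 * \<mu>"
      by (simp add: \<mu>_def power_mult_distrib)
  next
    show "\<mu> > 0" using x A0 by (simp add: \<mu>_def)
    have "\<mu> * real A ^ 3 = 3 / 8 * (z ^ 4 / real A)"
      using A0 z by (simp add: \<mu>_def eval_nat_numeral)
    also have "z ^ 4 / real A \<le> z ^ 4 / z" using A z A0 by (intro divide_left_mono) auto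
    also have "z ^ 4 / z = z ^ 3" using z(1) by (simp add: eval_nat_numeral)
    moreover have "z ^ 3 \<ge> 0" using z by simp
    ultimately show "\<mu> * real A ^ 3 \<le> z ^ 3" by linarith
    have "\<mu> * real A = 3 / 8 * (x / real A ^ 3)"
      using A0 by (simp add: \<mu>_def eval_nat_numeral)
    moreover have "1 \<le> x / real A ^ 3" using A A0 by simp
    ultimately show "1/8 \<le> \<mu> * real A" by linarith
  qed
qed

lemma abs_sum_sawtooth_inverse_sqrt:
  fixes x z :: real
  assumes z: "z \<ge> 1" "z ^ 4 = x" and Y: "real Y ^ 3 \<le> x"
  shows "\<bar>\<Sum>n\<in>{1..Y}. sawtooth (sqrt (x / real n))\<bar> \<le> 24800 * z * (1 + ln x) ^ 2"
proof (rule abs_sum_sawtooth_upto[OF z Y])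
  fix A B :: nat
  assume A: "z \<le> real A" "real A ^ 3 \<le> x" "1 \<le> A" "A < B" "B \<le> 2 * A"
  have A0: "real A > 0" using A by simp
  have sx: "sqrt x = z ^ 2" using z by (intro real_sqrt_unique) (auto simp flip: power_mult)
  have z0: "z > 0" using z by simp
  \<comment> \<open>one sixth of the second derivative at A, a lower bound on [A, 2A] since its value
    at 2A is smaller by the factor 2 to the 5/2, which is below 6\<close>
  define \<mu> where "\<mu> = z ^ 2 / (8 * real A ^ 2 * sqrt (real A))"
  have "sqrt (real A) ^ 6 = (sqrt (real A) ^ 2) ^ 3" by (subst power_mult[symmetric]) simp
  also have "\<dots> = real A ^ 3" by simp
  also have "\<dots> \<le> (z ^ 2) ^ 2" using A z by (simp flip: power_mult)
  finally have "(sqrt (real A)) ^ 6 \<le> (z ^ 2) ^ 2" .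
  then have "((sqrt (real A)) ^ 3) ^ 2 \<le> (z ^ 2) ^ 2" by (simp flip: power_mult)
  then have cube: "sqrt (real A) ^ 3 \<le> z ^ 2" by (rule power2_le_imp_le) simp
  have "\<bar>\<Sum>n\<in>{A..<B}. sawtooth (z ^ 2 / sqrt (real n))\<bar> \<le> 6200 * z * (1 + ln x)"
  proof (rule abs_sum_sawtooth_dyadic[OF z A(1,2,4,5), where f = "\<lambda>t. z ^ 2 / sqrt t"
        and g = "\<lambda>t. - (z ^ 2) / (2 * t * sqrt t)" and h = "\<lambda>t. 3 * z ^ 2 / (4 * t ^ 2 * sqrt t)" and \<mu> = \<mu>])
    fix t assume t: "real A \<le> t" "t \<le> real B"
    then have t0: "t > 0" using A0 by linarith
    show "((\<lambda>t. z ^ 2 / sqrt t) has_real_derivative - (z ^ 2) / (2 * t * sqrt t)) (at t)"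
      using t0 by (auto intro!: derivative_eq_intros simp: field_simps)
    show "((\<lambda>t. - (z ^ 2) / (2 * t * sqrt t)) has_real_derivative 3 * z ^ 2 / (4 * t ^ 2 * sqrt t)) (at t)"
      using t0 by (auto intro!: derivative_eq_intros simp: field_simps power2_eq_square)
    have "t \<le> 2 * real A" using t A by linarith
    then have "4 * t ^ 2 * sqrt t \<le> 4 * (2 * real A) ^ 2 * sqrt (2 * real A)"
      using t0 by (intro mult_mono power_mono) auto
    also have "\<dots> \<le> 24 * real A ^ 2 * sqrt (real A)"
    proof -
      have "sqrt 2 \<le> 3 / 2" by (rule real_le_lsqrt) (auto simp: power2_eq_square)
      then have "sqrt 2 * (real A ^ 2 * sqrt (real A)) \<le> 3 / 2 * (real A ^ 2 * sqrt (real A))"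
        by (intro mult_right_mono) auto
      then show ?thesis by (simp add: real_sqrt_mult power_mult_distrib mult_ac)
    qed
    finally have "3 * z ^ 2 / (24 * real A ^ 2 * sqrt (real A)) \<le> 3 * z ^ 2 / (4 * t ^ 2 * sqrt t)"
      using t0 A0 by (intro divide_left_mono) auto
    moreover have "3 * z ^ 2 / (4 * t ^ 2 * sqrt t) \<le> 3 * z ^ 2 / (4 * real A ^ 2 * sqrt (real A))"
      using t t0 A0 by (intro divide_left_mono mult_mono power_mono) auto
    moreover have "3 * z ^ 2 / (4 * real A ^ 2 * sqrt (real A)) \<le> 16 * \<mu>"
      using A0 by (simp add: \<mu>_def field_simps)
    ultimately show "\<mu> \<le> 3 * z ^ 2 / (4 * t ^ 2 * sqrt t) \<and> 3 * z ^ 2 / (4 * t ^ 2 * sqrt t) \<le> 16 * \<mu>"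
      by (simp add: \<mu>_def mult_ac)
  next
    show "\<mu> > 0" using z0 A0 by (simp add: \<mu>_def)
    define a where "a = sqrt (real A)"
    have a: "a > 0" "real A = a ^ 2" using A0 by (auto simp: a_def)
    have a3: "a ^ 3 \<le> z ^ 2" using cube by (simp add: a_def)
    have \<mu>a: "\<mu> = z ^ 2 / (8 * a ^ 5)" unfolding \<mu>_def a_def[symmetric] using a by (simp add: eval_nat_numeral)
    have "a ^ 3 \<le> z ^ 3"
      using a3 z power_increasing[of 2 3 z] by linarith
    then have "a \<le> z" by (rule power_le_imp_le_base[of _ 2, simplified]) (use z in auto)
    then have "z ^ 2 * a \<le> z ^ 2 * z" by (intro mult_left_mono) auto
    moreover have "\<mu> * real A ^ 3 = z ^ 2 * a / 8"
      unfolding \<mu>a a(2) using a(1) by (simp add: eval_nat_numeral)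
    moreover have "z ^ 2 * z = z ^ 3" by (simp add: eval_nat_numeral)
    moreover have "z ^ 3 \<ge> 0" using z by simp
    ultimately show "\<mu> * real A ^ 3 \<le> z ^ 3" by linarith
    have "\<mu> * real A = z ^ 2 / a ^ 3 / 8"
      unfolding \<mu>a a(2) using a(1) by (simp add: eval_nat_numeral)
    moreover have "1 / 8 \<le> z ^ 2 / a ^ 3 / 8" using a3 a by (intro divide_right_mono) auto
    ultimately show "1/8 \<le> \<mu> * real A" by simp
  qed
  then show "\<bar>\<Sum>n\<in>{A..<B}. sawtooth (sqrt (x / real n))\<bar> \<le> 6200 * z * (1 + ln x)"
    by (simp add: real_sqrt_divide sx)
qed

section \<open>Analytic continuation of zeta and its partial sums\<close>

text \<open>The difference between m^(-w) and the integral of t^(-w) over [m, m+1], where m = n + 1. Subtracting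
the integral makes the series converge for Re w > 0.\<close>

definition zeta_term :: "nat \<Rightarrow> complex \<Rightarrow> complex" where
  "zeta_term n w = 1 / of_nat (Suc n) powr w -
     (of_nat (Suc (Suc n)) powr (1 - w) - of_nat (Suc n) powr (1 - w)) / (1 - w)"

lemma norm_powr_diff_le:
  fixes w :: complex and m t :: real
  assumes m: "m > 0" "m \<le> t" "t \<le> m + 1" and w: "Re w \<ge> 0"
  shows "norm (of_real t powr - w - of_real m powr - w) \<le> norm w * m powr (- Re w - 1)"
proof -
  let ?S = "closed_segment (of_real m) (of_real (m + 1)) :: complex set"
  have S_eq: "?S = of_real ` {m..m + 1}"
    by (simp only: closed_segment_of_real closed_segment_eq_real_ivl) simp
  have S: "\<exists>s. z = of_real s \<and> m \<le> s" if "z \<in> ?S" for z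
    using that unfolding S_eq by auto
  have "norm (of_real t powr - w - of_real m powr - w) \<le> (norm w * m powr (- Re w - 1)) * norm (of_real t - of_real m :: complex)"
  proof (rule field_differentiable_bound[where S = ?S and f = "\<lambda>z. z powr - w" and f' = "\<lambda>z. - w * z powr (- w - 1)"])
    show "convex ?S" by (rule convex_closed_segment)
    fix z assume "z \<in> ?S"
    then obtain s where s: "z = of_real s" "m \<le> s" using S by blast
    then have s0: "s > 0" using m by linarith
    show "((\<lambda>z. z powr - w) has_field_derivative - w * z powr (- w - 1)) (at z within ?S)"
      using s s0 by (auto intro!: derivative_eq_intros)
    have "norm (z powr (- w - 1)) = s powr (- Re w - 1)"
      using s s0 by (simp add: norm_powr_real_powr)
    also have "\<dots> \<le> m powr (- Re w - 1)"
      using s m w by (intro powr_mono2') auto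
    finally show "norm (- w * z powr (- w - 1)) \<le> norm w * m powr (- Re w - 1)"
      by (simp add: norm_mult mult_left_mono)
  qed (use m in \<open>simp_all only: S_eq, auto\<close>)
  also have "norm (of_real t - of_real m :: complex) = t - m"
    using m by (simp flip: of_real_diff)
  also have "norm w * m powr (- Re w - 1) * (t - m) \<le> norm w * m powr (- Re w - 1)"
    using m by (intro mult_left_le) auto
  finally show ?thesis .
qed

text \<open>Up to sign, the term is the increment over [m, m+1] of
z^(1-w)/(1-w) - z m^(-w) for m = n + 1, whose derivative z^(-w) - m^(-w) is small by the preceding lemma.\<close>

lemma norm_zeta_term_le:
  assumes w: "Re w > 0" "w \<noteq> 1"
  shows "norm (zeta_term n w) \<le> norm w * real (Suc n) powr (- Re w - 1)"
proof -
  define m where "m = real (Suc n)"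
  have m: "m > 0" by (simp add: m_def)
  let ?S = "closed_segment (of_real m) (of_real (m + 1)) :: complex set"
  let ?G = "\<lambda>z::complex. z powr (1 - w) / (1 - w) - z * of_real m powr - w"
  have S_eq: "?S = of_real ` {m..m + 1}"
    by (simp only: closed_segment_of_real closed_segment_eq_real_ivl) simp
  have S: "\<exists>s. z = of_real s \<and> m \<le> s \<and> s \<le> m + 1" if "z \<in> ?S" for z
    using that unfolding S_eq by auto
  have "norm (?G (of_real (m + 1)) - ?G (of_real m)) \<le>
      (norm w * m powr (- Re w - 1)) * norm (of_real (m + 1) - of_real m :: complex)"
  proof (rule field_differentiable_bound[where S = ?S and f = ?G and f' = "\<lambda>z. z powr - w - of_real m powr - w"])
    show "convex ?S" by (rule convex_closed_segment)
    fix z assume "z \<in> ?S"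
    then obtain s where s: "z = of_real s" "m \<le> s" "s \<le> m + 1" using S by blast
    then have s0: "s > 0" using m by linarith
    show "(?G has_field_derivative z powr - w - of_real m powr - w) (at z within ?S)"
      using s s0 w(2) by (auto intro!: derivative_eq_intros)
    show "norm (z powr - w - of_real m powr - w) \<le> norm w * m powr (- Re w - 1)"
      unfolding s(1) using m s w by (intro norm_powr_diff_le) auto
  qed auto
  also have "?G (of_real (m + 1)) - ?G (of_real m) = - zeta_term n w"
  proof -
    have "(A / (1 - w) - (M + 1) * q) - (B / (1 - w) - M * q) = - (q - (A - B) / (1 - w))" for A B M q :: complex
      by (simp add: algebra_simps diff_divide_distrib)
    moreover define M :: complex where "M = of_nat (Suc n)"
    moreover have "of_real (m + 1) = M + 1" "of_real m = M" "of_nat (Suc (Suc n)) = M + 1"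
      by (simp_all add: m_def M_def)
    ultimately show ?thesis
      by (simp only: zeta_term_def powr_minus inverse_eq_divide flip: M_def)
  qed
  finally show ?thesis by (simp add: m_def)
qed

lemma summable_zeta_bound: "\<delta> > 0 \<Longrightarrow> summable (\<lambda>n. real (Suc n) powr (- \<delta> - 1))"
  using summable_real_powr_iff[of "- \<delta> - 1"] by (subst summable_Suc_iff) simp

definition zeta_cont :: "complex \<Rightarrow> complex" where
  "zeta_cont w = 1 / (w - 1) + (\<Sum>n. zeta_term n w)"

lemma summable_zeta_term:
  assumes "Re w > 0" "w \<noteq> 1"
  shows "summable (\<lambda>n. zeta_term n w)"
  by (rule summable_comparison_test'[OF summable_mult[OF summable_zeta_bound[OF assms(1)], of "norm w"], of 0])
     (use norm_zeta_term_le[OF assms] in auto)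

lemma zeta_cont_holomorphic: "zeta_cont holomorphic_on ({w. 0 < Re w} - {1})"
proof -
  let ?S = "{w. 0 < Re w} - {1 :: complex}"
  have op: "open ?S" by (intro open_Diff open_halfspace_Re_gt) auto
  have "(\<lambda>w. \<Sum>n. zeta_term n w) holomorphic_on ?S"
  proof (rule holomorphic_uniform_sequence[OF op, where f = "\<lambda>N w. \<Sum>n<N. zeta_term n w"])
    show "(\<lambda>w. \<Sum>n<N. zeta_term n w) holomorphic_on ?S" for N
      unfolding zeta_term_def by (intro holomorphic_intros) auto
    fix x assume x: "x \<in> ?S"
    define d where "d = min (Re x / 2) (norm (x - 1) / 2)"
    have d: "d > 0" "d \<le> Re x / 2" "d < norm (x - 1)" using x by (auto simp: d_def min_def)
    have w: "Re w \<ge> Re x / 2 \<and> norm w \<le> norm x + d \<and> w \<noteq> 1" if "w \<in> cball x d" for w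
    proof -
      have n: "norm (x - w) \<le> d" using that by (simp add: dist_norm)
      have "Re (x - w) \<le> d" using n complex_Re_le_cmod order_trans by blast
      then have "Re w \<ge> Re x / 2" using d by simp
      moreover have "norm w \<le> norm x + d"
        using n norm_triangle_ineq2[of w x] by (simp add: norm_minus_commute)
      moreover have "w \<noteq> 1" using n d by auto
      ultimately show ?thesis by simp
    qed
    have Rx: "Re x / 2 > 0" using x by simp
    have "uniform_limit (cball x d) (\<lambda>N w. \<Sum>n<N. zeta_term n w) (\<lambda>w. \<Sum>n. zeta_term n w) sequentially"
    proof (rule Weierstrass_m_test)
      show "summable (\<lambda>n. (norm x + d) * real (Suc n) powr (- (Re x / 2) - 1))"
        by (intro summable_mult summable_zeta_bound Rx)
      fix n w assume w': "w \<in> cball x d"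
      have "norm (zeta_term n w) \<le> norm w * real (Suc n) powr (- Re w - 1)"
        using w[OF w'] Rx by (intro norm_zeta_term_le) auto
      also have "\<dots> \<le> (norm x + d) * real (Suc n) powr (- (Re x / 2) - 1)"
        using w[OF w'] d by (intro mult_mono powr_mono) auto
      finally show "norm (zeta_term n w) \<le> (norm x + d) * real (Suc n) powr (- (Re x / 2) - 1)" .
    qed
    moreover have "cball x d \<subseteq> ?S" using w Rx by force
    ultimately show "\<exists>d>0. cball x d \<subseteq> ?S \<and>
        uniform_limit (cball x d) (\<lambda>N w. \<Sum>n<N. zeta_term n w) (\<lambda>w. \<Sum>n. zeta_term n w) sequentially"
      using d by blast
  qed
  then show ?thesis unfolding zeta_cont_def by (intro holomorphic_intros) auto
qed

lemma sum_zeta_term: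
  "(\<Sum>n<N. zeta_term n w) =
     (\<Sum>n<N. 1 / of_nat (Suc n) powr w) - (of_nat (Suc N) powr (1 - w) - 1) / (1 - w)"
  by (induction N) (simp_all add: zeta_term_def diff_divide_distrib)

lemma zeta_cont_sums:
  assumes w: "Re w > 1"
  shows "(\<lambda>n. 1 / of_nat (Suc n) powr w) sums zeta_cont w"
  unfolding sums_def
proof -
  have w1: "w \<noteq> 1" using w by auto
  have "(\<lambda>N. real (Suc N) powr (1 - Re w)) \<longlonglongrightarrow> 0"
    using w by (intro LIMSEQ_Suc tendsto_neg_powr filterlim_real_sequentially) auto
  then have "(\<lambda>N. norm (of_nat (Suc N) powr (1 - w) :: complex)) \<longlonglongrightarrow> 0"
  proof -
    have "norm (of_nat (Suc N) powr (1 - w) :: complex) = real (Suc N) powr (1 - Re w)" for N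
      using norm_powr_real_powr[of "of_nat (Suc N)" "1 - w"] by (simp del: of_nat_Suc)
    then show ?thesis using \<open>(\<lambda>N. real (Suc N) powr (1 - Re w)) \<longlonglongrightarrow> 0\<close> by (simp only:)
  qed
  then have 1: "(\<lambda>N. of_nat (Suc N) powr (1 - w) :: complex) \<longlonglongrightarrow> 0" by (rule tendsto_norm_zero_cancel)
  have 2: "(\<lambda>N. \<Sum>n<N. zeta_term n w) \<longlonglongrightarrow> (\<Sum>n. zeta_term n w)"
    using summable_LIMSEQ[OF summable_zeta_term] w w1 by simp
  have "(\<lambda>N. (\<Sum>n<N. zeta_term n w) + (of_nat (Suc N) powr (1 - w) - 1) / (1 - w))
      \<longlonglongrightarrow> (\<Sum>n. zeta_term n w) + (0 - 1) / (1 - w)"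
    by (intro tendsto_intros 1 2) (use w1 in auto)
  also have "(\<Sum>n. zeta_term n w) + (0 - 1) / (1 - w) = zeta_cont w"
    using w1 by (simp add: zeta_cont_def field_simps)
  finally show "(\<lambda>N. \<Sum>n<N. 1 / of_nat (Suc n) powr w) \<longlonglongrightarrow> zeta_cont w"
    by (simp add: sum_zeta_term)
qed

lemma zeta_eq_zeta_cont: "Re s > 0 \<Longrightarrow> s \<noteq> 1 \<Longrightarrow> zeta s = zeta_cont s"
  by (rule zeta_eqI[where c = 0]) (use zeta_cont_holomorphic zeta_cont_sums in auto)

lemma zeta_sums: "Re s > 1 \<Longrightarrow> (\<lambda>n. 1 / of_nat (Suc n) powr s) sums zeta s"
  by (subst zeta_eq_zeta_cont) (auto intro: zeta_cont_sums simp del: of_nat_Suc)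

text \<open>The analytic continuation at 1/2, evaluated by means of the series of the \<open>zeta_term\<close>s, whose
integrals telescope.\<close>

lemma tendsto_sum_inverse_sqrt:
  "(\<lambda>N. (\<Sum>n<N. 1 / sqrt (real (Suc n))) - 2 * sqrt (real (Suc N))) \<longlonglongrightarrow> Re (zeta (1/2))"
proof -
  have pw: "(of_nat k :: complex) powr (1/2) = of_real (sqrt (real k))" for k
    using powr_of_real[of "real k" "1/2"] by (simp add: powr_half_sqrt)
  have "(\<Sum>n<N. zeta_term n (1/2)) = of_real ((\<Sum>n<N. 1 / sqrt (real (Suc n))) - 2 * sqrt (real (Suc N)) + 2)" for N
    unfolding sum_zeta_term using pw by (simp del: of_nat_Suc)
  moreover have "(\<lambda>N. \<Sum>n<N. zeta_term n (1/2)) \<longlonglongrightarrow> (\<Sum>n. zeta_term n (1/2))"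
    by (rule summable_LIMSEQ[OF summable_zeta_term]) auto
  ultimately have "(\<lambda>N. of_real ((\<Sum>n<N. 1 / sqrt (real (Suc n))) - 2 * sqrt (real (Suc N)) + 2) :: complex)
     \<longlonglongrightarrow> (\<Sum>n. zeta_term n (1/2))" by simp
  then have "(\<lambda>N. Re (of_real ((\<Sum>n<N. 1 / sqrt (real (Suc n))) - 2 * sqrt (real (Suc N)) + 2)) - 2)
     \<longlonglongrightarrow> Re (\<Sum>n. zeta_term n (1/2)) - 2" by (intro tendsto_intros)
  moreover have "zeta (1/2) = (\<Sum>n. zeta_term n (1/2)) - 2"
    by (subst zeta_eq_zeta_cont) (auto simp: zeta_cont_def)
  ultimately show ?thesis by simp
qed

text \<open>The sequence \<open>s\<close> is increasing and \<open>s + b\<close> is decreasing, with the same limit. This replaces summing the tail of a series.\<close>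

lemma limit_minus_partial_le:
  fixes s b :: "nat \<Rightarrow> real"
  assumes step: "\<And>n. n \<ge> 1 \<Longrightarrow> 0 \<le> s (Suc n) - s n \<and> s (Suc n) - s n \<le> b n - b (Suc n)"
    and lim: "s \<longlonglongrightarrow> L" "b \<longlonglongrightarrow> 0" and N: "N \<ge> 1"
  shows "0 \<le> L - s N \<and> L - s N \<le> b N"
proof -
  have N': "Suc (N - 1) = N" using N by simp
  have "incseq (\<lambda>n. s (Suc n))" by (rule incseq_SucI) (use step in force)
  then have "s (Suc (N - 1)) \<le> L" by (rule incseq_le) (rule LIMSEQ_Suc[OF lim(1)])
  moreover have "decseq (\<lambda>n. s (Suc n) + b (Suc n))"
  proof (rule decseq_SucI)
    show "s (Suc (Suc n)) + b (Suc (Suc n)) \<le> s (Suc n) + b (Suc n)" for n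
      using step[of "Suc n"] by simp
  qed
  then have "L + 0 \<le> s (Suc (N - 1)) + b (Suc (N - 1))"
    by (rule decseq_ge) (intro tendsto_intros LIMSEQ_Suc lim)
  ultimately show ?thesis using N' by simp
qed

text \<open>The term 1/(2 sqrt N) has to be made explicit: multiplied by sqrt x with N about x^(1/3), it
contributes the order x^(1/3), which must cancel.\<close>

lemma sum_inverse_sqrt_expansion:
  assumes "N \<ge> 1"
  defines "e \<equiv> Re (zeta (1/2)) - ((\<Sum>n=1..N. 1 / sqrt (real n)) - 2 * sqrt (real N) - 1 / (2 * sqrt (real N)))"
  shows "0 \<le> e \<and> e \<le> 1 / real N"
  unfolding e_def
proof (rule limit_minus_partial_le[where b = "\<lambda>n. 1 / real n"])
  define S where "S N = (\<Sum>n=1..N. 1 / sqrt (real n))" for N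
  have S: "S N = (\<Sum>n<N. 1 / sqrt (real (Suc n)))" for N
    unfolding S_def by (rule sum.reindex_bij_witness[of _ Suc "\<lambda>n. n - 1"]) auto
  have "(\<lambda>N. sqrt (real (Suc N)) - sqrt (real N)) \<longlonglongrightarrow> 0" by real_asymp
  moreover have "(\<lambda>N. 1 / (2 * sqrt (real N))) \<longlonglongrightarrow> 0" by real_asymp
  ultimately have "(\<lambda>N. (S N - 2 * sqrt (real (Suc N))) + 2 * (sqrt (real (Suc N)) - sqrt (real N)) - 1 / (2 * sqrt (real N)))
      \<longlonglongrightarrow> Re (zeta (1/2)) + 2 * 0 - 0"
    unfolding S by (intro tendsto_intros tendsto_sum_inverse_sqrt)
  then show "(\<lambda>N. (\<Sum>n=1..N. 1 / sqrt (real n)) - 2 * sqrt (real N) - 1 / (2 * sqrt (real N))) \<longlonglongrightarrow> Re (zeta (1/2))"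
    by (simp add: S_def)
  fix n :: nat assume n: "n \<ge> 1"
  define a where "a = sqrt (real n)"
  define b where "b = sqrt (real (Suc n))"
  have ab: "a \<ge> 1" "b \<ge> 1" "a\<^sup>2 = real n" "b\<^sup>2 = real n + 1" using n by (auto simp: a_def b_def)
  have sq: "(b - a) * (a + b) = 1" using ab by (simp add: power2_eq_square algebra_simps)
  then have d: "b - a = 1 / (a + b)" using ab by (simp add: field_simps)
  have "(S (Suc n) - 2 * b - 1 / (2 * b)) - (S n - 2 * a - 1 / (2 * a)) = 1 / (2 * a) + 1 / (2 * b) - 2 * (b - a)"
  proof -
    have "S (Suc n) = S n + 1 / b" by (simp add: S_def b_def)
    moreover have "(s + p - 2 * b - p / 2) - (s - 2 * a - q) = q + p / 2 - 2 * (b - a)" for s p q :: real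
      by simp
    from this[of "S n" "1 / b" "1 / (2 * a)"]
    have "(S n + 1 / b - 2 * b - 1 / (2 * b)) - (S n - 2 * a - 1 / (2 * a)) = 1 / (2 * a) + 1 / (2 * b) - 2 * (b - a)"
      by (simp only: divide_divide_eq_left mult.commute[of b])
    ultimately show ?thesis by (simp only:)
  qed
  also have "1 / (2 * a) + 1 / (2 * b) = (a + b) / (2 * a * b)"
    using ab by (simp add: add_divide_distrib)
  also have "2 * (b - a) = 2 / (a + b)" unfolding d by simp
  also have "(a + b) / (2 * a * b) - 2 / (a + b) = (b - a)\<^sup>2 / (2 * a * b * (a + b))"
  proof -
    have "(a + b)\<^sup>2 - 4 * a * b = (b - a)\<^sup>2" by (simp add: power2_eq_square algebra_simps)
    moreover have "(a + b) / (2 * a * b) - 2 / (a + b) = ((a + b)\<^sup>2 - 4 * a * b) / (2 * a * b * (a + b))"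
      using ab by (subst diff_frac_eq) (auto simp: power2_eq_square mult_ac)
    ultimately show ?thesis by simp
  qed
  finally have eq: "(S (Suc n) - 2 * b - 1 / (2 * b)) - (S n - 2 * a - 1 / (2 * a)) = (b - a)\<^sup>2 / (2 * a * b * (a + b))" .
  have "(b - a)\<^sup>2 / (2 * a * b * (a + b)) \<le> 1 / (a\<^sup>2 * b\<^sup>2)"
  proof -
    have "(b - a)\<^sup>2 / (2 * a * b * (a + b)) = 1 / (2 * a * b * (a + b) ^ 3)"
      unfolding d by (simp add: power_divide power3_eq_cube power2_eq_square mult_ac)
    also have "\<dots> \<le> 1 / (a\<^sup>2 * b\<^sup>2)"
    proof (intro divide_left_mono)
      have "0 < a" "0 < b" "0 < a + b" using ab by linarith+
      then show "0 < (2 * a * b * (a + b) ^ 3) * (a\<^sup>2 * b\<^sup>2)"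
        by (intro mult_pos_pos zero_less_power) simp_all
      have "a * b \<le> (a + b) * (a + b)" using ab by (intro mult_mono) auto
      also have "\<dots> \<le> (a + b) * (a + b) * (a + b)" using ab by (simp add: mult_le_cancel_left1)
      also have "\<dots> \<le> 2 * (a + b) ^ 3" using ab by (simp add: power3_eq_cube)
      finally have "a * b * (a * b) \<le> a * b * (2 * (a + b) ^ 3)" using ab by (intro mult_left_mono) auto
      then show "a\<^sup>2 * b\<^sup>2 \<le> 2 * a * b * (a + b) ^ 3" by (simp add: power2_eq_square mult_ac)
    qed simp
    finally show ?thesis .
  qed
  also have "1 / (a\<^sup>2 * b\<^sup>2) = 1 / real n - 1 / real (Suc n)"
    unfolding ab using n by (simp add: field_simps)
  finally show "0 \<le> (\<Sum>k=1..Suc n. 1 / sqrt (real k)) - 2 * sqrt (real (Suc n)) - 1 / (2 * sqrt (real (Suc n))) -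
        ((\<Sum>k=1..n. 1 / sqrt (real k)) - 2 * sqrt (real n) - 1 / (2 * sqrt (real n))) \<and>
     (\<Sum>k=1..Suc n. 1 / sqrt (real k)) - 2 * sqrt (real (Suc n)) - 1 / (2 * sqrt (real (Suc n))) -
        ((\<Sum>k=1..n. 1 / sqrt (real k)) - 2 * sqrt (real n) - 1 / (2 * sqrt (real n))) \<le> 1 / real n - 1 / real (Suc n)"
    unfolding S_def[symmetric] a_def[symmetric] b_def[symmetric] eq using ab by auto
next
  show "(\<lambda>n. 1 / real n) \<longlonglongrightarrow> 0" by real_asymp
qed (rule assms)

lemma sums_zeta_2: "(\<lambda>n. 1 / real (Suc n) ^ 2) sums Re (zeta 2)"
proof -
  have "(\<lambda>n. 1 / of_nat (Suc n) powr 2 :: complex) sums zeta 2" by (rule zeta_sums) auto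
  also have "(\<lambda>n. 1 / of_nat (Suc n) powr 2 :: complex) = (\<lambda>n. of_real (1 / real (Suc n) ^ 2))"
  proof
    fix n
    have "(of_nat (Suc n) :: complex) powr of_nat 2 = of_nat (Suc n) ^ 2"
      by (rule powr_nat'[THEN trans]) simp_all
    then show "1 / of_nat (Suc n) powr 2 = (of_real (1 / real (Suc n) ^ 2) :: complex)"
      by (simp del: of_nat_Suc)
  qed
  finally show ?thesis using sums_Re[of "\<lambda>n. of_real (1 / real (Suc n) ^ 2)"] by (simp only: Re_complex_of_real)
qed

text \<open>As for the preceding expansion, the term 1/(2 N^2) contributes the order x^(1/3) to the lattice point
count.\<close>

lemma sum_inverse_square_expansion:
  assumes "N \<ge> 1"
  defines "e \<equiv> Re (zeta 2) - ((\<Sum>n=1..N. 1 / real n ^ 2) + 1 / real N - 1 / (2 * real N ^ 2))"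
  shows "0 \<le> e \<and> e \<le> 1 / real N ^ 3"
  unfolding e_def
proof (rule limit_minus_partial_le[where b = "\<lambda>n. 1 / real n ^ 3"])
  define S where "S N = (\<Sum>n=1..N. 1 / real n ^ 2)" for N
  have S: "S N = (\<Sum>n<N. 1 / real (Suc n) ^ 2)" for N
    unfolding S_def by (rule sum.reindex_bij_witness[of _ Suc "\<lambda>n. n - 1"]) auto
  have "S \<longlonglongrightarrow> Re (zeta 2)" using sums_zeta_2 unfolding sums_def S[symmetric] .
  moreover have "(\<lambda>N. 1 / real N) \<longlonglongrightarrow> 0" by real_asymp
  moreover have "(\<lambda>N. 1 / (2 * real N ^ 2)) \<longlonglongrightarrow> 0" by real_asymp
  ultimately have "(\<lambda>N. S N + 1 / real N - 1 / (2 * real N ^ 2)) \<longlonglongrightarrow> Re (zeta 2) + 0 - 0"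
    by (rule tendsto_diff[OF tendsto_add])
  then show "(\<lambda>N. (\<Sum>n=1..N. 1 / real n ^ 2) + 1 / real N - 1 / (2 * real N ^ 2)) \<longlonglongrightarrow> Re (zeta 2)"
    by (simp add: S_def)
  fix n :: nat assume n: "n \<ge> 1"
  define t where "t = real n"
  have t: "t \<ge> 1" using n by (simp add: t_def)
  have "(S (Suc n) + 1 / real (Suc n) - 1 / (2 * real (Suc n) ^ 2)) - (S n + 1 / real n - 1 / (2 * real n ^ 2))
     = 1 / (t + 1)\<^sup>2 + 1 / (t + 1) - 1 / (2 * (t + 1)\<^sup>2) - 1 / t + 1 / (2 * t\<^sup>2)"
    by (simp add: S_def t_def add_ac)
  also have "\<dots> = 1 / (2 * t\<^sup>2 * (t + 1)\<^sup>2)"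
    using t by (simp add: divide_simps) (simp add: power2_eq_square algebra_simps)
  finally have eq: "(S (Suc n) + 1 / real (Suc n) - 1 / (2 * real (Suc n) ^ 2)) - (S n + 1 / real n - 1 / (2 * real n ^ 2))
     = 1 / (2 * t\<^sup>2 * (t + 1)\<^sup>2)" .
  have "1 / (2 * t\<^sup>2 * (t + 1)\<^sup>2) = (t * (t + 1) / 2) / (t ^ 3 * (t + 1) ^ 3)"
    using t by (simp add: divide_simps power2_eq_square power3_eq_cube)
  also have "\<dots> \<le> (3 * t\<^sup>2 + 3 * t + 1) / (t ^ 3 * (t + 1) ^ 3)"
    using t by (intro divide_right_mono) (auto simp: power2_eq_square algebra_simps)
  also have "\<dots> = 1 / t ^ 3 - 1 / (t + 1) ^ 3"
    using t by (simp add: divide_simps) (simp add: power2_eq_square power3_eq_cube algebra_simps)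
  finally have "1 / (2 * t\<^sup>2 * (t + 1)\<^sup>2) \<le> 1 / real n ^ 3 - 1 / real (Suc n) ^ 3"
    by (simp add: t_def add_ac)
  then show "0 \<le> (\<Sum>k=1..Suc n. 1 / real k ^ 2) + 1 / real (Suc n) - 1 / (2 * real (Suc n) ^ 2) -
        ((\<Sum>k=1..n. 1 / real k ^ 2) + 1 / real n - 1 / (2 * real n ^ 2)) \<and>
     (\<Sum>k=1..Suc n. 1 / real k ^ 2) + 1 / real (Suc n) - 1 / (2 * real (Suc n) ^ 2) -
        ((\<Sum>k=1..n. 1 / real k ^ 2) + 1 / real n - 1 / (2 * real n ^ 2)) \<le> 1 / real n ^ 3 - 1 / real (Suc n) ^ 3"
    unfolding S_def[symmetric] eq by auto
next
  show "(\<lambda>n. 1 / real n ^ 3) \<longlonglongrightarrow> 0" by real_asymp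
qed (rule assms)

section \<open>Counting the pairs with a times b squared at most x\<close>

definition lattice_count :: "real \<Rightarrow> real" where
  "lattice_count x = (\<Sum>n\<in>{1..nat \<lfloor>x\<rfloor>}. square_divisor_count n)"

lemma square_ind_eq_card: "m > 0 \<Longrightarrow> square_ind m = real (card {b. b > 0 \<and> b ^ 2 = m})"
proof -
  assume m: "m > 0"
  show ?thesis
  proof (cases "is_nth_power 2 m")
    case True
    then obtain c where c: "m = c ^ 2" by (auto simp: is_nth_power_def)
    then have "{b. b > 0 \<and> b ^ 2 = m} = {c}" using m by auto
    then show ?thesis using True m by (simp add: square_ind_def)
  next
    case False
    then have "{b. b > 0 \<and> b ^ 2 = m} = {}" by (auto simp: is_nth_power_def)
    then have "card {b. b > 0 \<and> b ^ 2 = m} = 0" by (simp only: card.empty)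
    then show ?thesis using False by (simp add: square_ind_def)
  qed
qed

lemma square_divisor_count_eq_card:
  assumes n: "n > 0"
  shows "square_divisor_count n = real (card {(a, b). a > 0 \<and> b > 0 \<and> a * b ^ 2 = n})"
proof -
  have fin: "finite {b::nat. b > 0 \<and> b ^ 2 = m}" for m
    by (rule finite_subset[of _ "{..m}"]) (auto simp: power2_nat_le_imp_le)
  have "square_divisor_count n = (\<Sum>a | a dvd n. square_ind (n div a))"
    by (simp add: square_divisor_count_def dirichlet_conv_def)
  also have "\<dots> = (\<Sum>a | a dvd n. real (card {b. b > 0 \<and> b ^ 2 = n div a}))"
    using n by (intro sum.cong refl square_ind_eq_card) (auto elim: dvdE)
  also have "\<dots> = real (card (SIGMA a:{a. a dvd n}. {b. b > 0 \<and> b ^ 2 = n div a}))"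
    using n fin by (subst card_SigmaI) auto
  also have "(SIGMA a:{a. a dvd n}. {b. b > 0 \<and> b ^ 2 = n div a}) = {(a, b). a > 0 \<and> b > 0 \<and> a * b ^ 2 = n}"
    using n by (auto intro!: gr0I)
  finally show ?thesis .
qed

lemma lattice_count_eq_card:
  assumes x: "x \<ge> 0"
  shows "lattice_count x = real (card {(a, b). a > 0 \<and> b > 0 \<and> real (a * b ^ 2) \<le> x})"
    and "finite {(a, b). a > 0 \<and> b > 0 \<and> real (a * b ^ 2) \<le> x}"
proof -
  let ?P = "{(a, b). a > 0 \<and> b > 0 \<and> real (a * b ^ 2) \<le> x}"
  let ?F = "\<lambda>n::nat. {(a, b). a > 0 \<and> b > 0 \<and> a * b ^ 2 = n}"
  have iff: "real n \<le> x \<longleftrightarrow> n \<le> nat \<lfloor>x\<rfloor>" for n using x by (simp add: le_nat_iff le_floor_iff)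
  have P: "?P = (\<Union>n\<in>{1..nat \<lfloor>x\<rfloor>}. ?F n)" by (auto simp: iff simp del: of_nat_mult of_nat_power)
  have fin: "finite (?F n)" for n
  proof (rule finite_subset[of _ "{..n} \<times> {..n}"])
    show "?F n \<subseteq> {..n} \<times> {..n}"
    proof
      fix ab assume "ab \<in> ?F n"
      then obtain a b where ab: "ab = (a, b)" "a > 0" "b > 0" "n = a * b ^ 2" by auto
      have "a * 1 \<le> a * b ^ 2" using ab by (intro mult_le_mono) auto
      moreover have "1 * b \<le> a * b ^ 2" using ab by (intro mult_le_mono) (auto simp: power2_eq_square)
      ultimately show "ab \<in> {..n} \<times> {..n}" using ab by simp
    qed
  qed auto
  show "finite ?P" unfolding P using fin by blast
  have "card ?P = (\<Sum>n\<in>{1..nat \<lfloor>x\<rfloor>}. card (?F n))"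
    unfolding P by (rule card_UN_disjoint) (use fin in auto)
  then show "lattice_count x = real (card ?P)"
    by (simp add: lattice_count_def square_divisor_count_eq_card)
qed

text \<open>With Y = \<lfloor>x^(1/3)\<rfloor>, a pair with a b^2 \<le> x has a \<le> Y or b \<le> Y, and all pairs with both satisfy
a b^2 \<le> x.\<close>

lemma lattice_count_hyperbola:
  assumes Y: "real Y ^ 3 \<le> x" "x < real (Suc Y) ^ 3"
  shows "lattice_count x = (\<Sum>b=1..Y. of_int \<lfloor>x / real b ^ 2\<rfloor>) + (\<Sum>a=1..Y. of_int \<lfloor>sqrt (x / real a)\<rfloor>) - real Y ^ 2"
proof -
  have x: "x \<ge> 0" using Y(1) by (meson order_trans zero_le_power of_nat_0_le_iff)
  let ?P = "{(a, b). a > 0 \<and> b > 0 \<and> real (a * b ^ 2) \<le> x}"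
  define U where "U = {(a, b) \<in> ?P. b \<le> Y}"
  define V where "V = {(a, b) \<in> ?P. a \<le> Y}"
  have fin: "finite U" "finite V"
    using lattice_count_eq_card(2)[OF x] by (auto simp: U_def V_def intro: finite_subset[rotated])
  have "?P \<subseteq> U \<union> V"
  proof (rule subsetI, rule ccontr)
    fix ab assume *: "ab \<in> ?P" "ab \<notin> U \<union> V"
    obtain a b where "ab = (a, b)" by (cases ab)
    with * have "real (a * b ^ 2) \<le> x" "Suc Y \<le> a" "Suc Y \<le> b"
      by (auto simp: U_def V_def not_le Suc_le_eq simp del: of_nat_mult of_nat_power)
    then have "real (Suc Y) * real (Suc Y) ^ 2 \<le> real a * real b ^ 2" by (intro mult_mono power_mono) auto
    also have "\<dots> \<le> x" using \<open>real (a * b ^ 2) \<le> x\<close> by simp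
    finally show False using Y(2) by (simp add: power3_eq_cube power2_eq_square)
  qed
  then have P: "?P = U \<union> V" by (auto simp: U_def V_def)
  have UV: "U \<inter> V = {1..Y} \<times> {1..Y}"
  proof -
    have "real (a * b ^ 2) \<le> x" if "a \<le> Y" "b \<le> Y" for a b
    proof -
      have "real a * real b ^ 2 \<le> real Y * real Y ^ 2" using that by (intro mult_mono power_mono) auto
      then show ?thesis using Y(1) by (simp add: power3_eq_cube power2_eq_square)
    qed
    then show ?thesis by (auto simp: U_def V_def simp del: of_nat_mult of_nat_power)
  qed
  have "real (card U) = (\<Sum>b=1..Y. of_int \<lfloor>x / real b ^ 2\<rfloor>)"
  proof -
    have "card U = card (SIGMA b:{1..Y}. {1..nat \<lfloor>x / real b ^ 2\<rfloor>})"
    proof (rule bij_betw_same_card[of prod.swap], rule bij_betw_byWitness[of _ prod.swap])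
      have "real (a * b ^ 2) \<le> x \<longleftrightarrow> a \<le> nat \<lfloor>x / real b ^ 2\<rfloor>" if "b > 0" for a b
        using that x by (simp add: le_nat_iff le_floor_iff pos_le_divide_eq)
      then show "prod.swap ` U \<subseteq> (SIGMA b:{1..Y}. {1..nat \<lfloor>x / real b ^ 2\<rfloor>})"
        "prod.swap ` (SIGMA b:{1..Y}. {1..nat \<lfloor>x / real b ^ 2\<rfloor>}) \<subseteq> U"
        by (auto simp: U_def simp del: of_nat_mult of_nat_power)
    qed auto
    also have "\<dots> = (\<Sum>b=1..Y. nat \<lfloor>x / real b ^ 2\<rfloor>)" by (subst card_SigmaI) auto
    finally show ?thesis using x by simp
  qed
  moreover have "real (card V) = (\<Sum>a=1..Y. of_int \<lfloor>sqrt (x / real a)\<rfloor>)"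
  proof -
    have "card V = card (SIGMA a:{1..Y}. {1..nat \<lfloor>sqrt (x / real a)\<rfloor>})"
    proof (rule arg_cong[of _ _ card])
      have "real (a * b ^ 2) \<le> x \<longleftrightarrow> b \<le> nat \<lfloor>sqrt (x / real a)\<rfloor>" if "a > 0" for a b
      proof -
        have "real (a * b ^ 2) \<le> x \<longleftrightarrow> real b ^ 2 \<le> x / real a"
          using that by (simp add: pos_le_divide_eq mult.commute)
        also have "\<dots> \<longleftrightarrow> real b \<le> sqrt (x / real a)"
          using real_sqrt_le_iff[of "real b ^ 2" "x / real a"] by simp
        also have "\<dots> \<longleftrightarrow> b \<le> nat \<lfloor>sqrt (x / real a)\<rfloor>"
          using x by (simp add: le_nat_iff le_floor_iff)
        finally show ?thesis .
      qed
      then show "V = (SIGMA a:{1..Y}. {1..nat \<lfloor>sqrt (x / real a)\<rfloor>})"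
        by (auto simp: V_def simp del: of_nat_mult of_nat_power)
    qed
    also have "\<dots> = (\<Sum>a=1..Y. nat \<lfloor>sqrt (x / real a)\<rfloor>)" by (subst card_SigmaI) auto
    finally show ?thesis using x by simp
  qed
  moreover have "real (card ?P) + real (card (U \<inter> V)) = real (card U) + real (card V)"
    unfolding P using card_Un_Int[OF fin] by simp
  ultimately show ?thesis
    using lattice_count_eq_card(1)[OF x] by (simp add: UV power2_eq_square)
qed

text \<open>Writing u = sqrt(x/Y) for Y = \<lfloor>x^(1/3)\<rfloor>, the smooth terms other than the two main terms add up to
-(u - Y)^2 + u^2/(2Y) - Y + u/2. They are bounded because Y \<le> u \<le> Y + 3.\<close>

lemma lattice_count_estimate:
  fixes x z :: real
  assumes z: "z \<ge> 1" "z ^ 4 = x"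
  shows "\<bar>lattice_count x - Re (zeta 2) * x - Re (zeta (1/2)) * sqrt x\<bar> \<le> 60000 * z * (1 + ln x) ^ 2"
proof -
  have x1: "x \<ge> 1" using z by (metis one_le_power)
  define Y where "Y = nat \<lfloor>x powr (1/3)\<rfloor>"
  have c1: "x powr (1/3) \<ge> 1" using x1 by (simp add: ge_one_powr_ge_zero)
  have c3: "(x powr (1/3)) ^ 3 = x" using x1 by (simp add: powr_power)
  have Yle: "real Y \<le> x powr (1/3)" and Ylt: "x powr (1/3) < real (Suc Y)"
    unfolding Y_def using c1 by linarith+
  have Y1: "Y \<ge> 1" unfolding Y_def using c1 by (simp add: le_nat_iff)
  have Y: "real Y ^ 3 \<le> x" "x < real (Suc Y) ^ 3"
    using power_mono[OF Yle, of 3] power_strict_mono[OF Ylt, of 3] c1 c3 by auto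
  define y where "y = real Y"
  have y: "y \<ge> 1" "y ^ 3 \<le> x" "x < (y + 1) ^ 3" using Y Y1 by (auto simp: y_def add.commute)
  \<comment> \<open>with this substitution all smooth terms become polynomials in u and 1/y\<close>
  define u where "u = sqrt (x / y)"
  have u2: "u ^ 2 = x / y" and u0: "u \<ge> 0" using y x1 by (auto simp: u_def)
  have xu: "x = u ^ 2 * y" using u2 y by (simp add: field_simps)
  have sx: "sqrt x = z ^ 2" using z by (intro real_sqrt_unique) (auto simp flip: power_mult)
  have uy: "y \<le> u" "u \<le> y + 3"
  proof -
    have "y ^ 2 * y \<le> u ^ 2 * y" using y xu by (simp add: power3_eq_cube power2_eq_square)
    then have "y ^ 2 \<le> u ^ 2" using y by simp
    then show "y \<le> u" using u0 by (rule power2_le_imp_le)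
    have "u ^ 2 * y \<le> (y + 1) ^ 3" using y xu by simp
    also have "\<dots> \<le> (y + 3) ^ 2 * y" using y by (simp add: power3_eq_cube power2_eq_square algebra_simps)
    finally have "u ^ 2 \<le> (y + 3) ^ 2" using y by simp
    then show "u \<le> y + 3" by (rule power2_le_imp_le) (use y in auto)
  qed
  define e1 where "e1 = Re (zeta 2) - ((\<Sum>n=1..Y. 1 / real n ^ 2) + 1 / y - 1 / (2 * y ^ 2))"
  define e2 where "e2 = Re (zeta (1/2)) - ((\<Sum>n=1..Y. 1 / sqrt (real n)) - 2 * sqrt y - 1 / (2 * sqrt y))"
  have e1: "0 \<le> e1" "e1 \<le> 1 / y ^ 3"
    using sum_inverse_square_expansion[OF Y1] by (simp_all add: e1_def y_def)
  have e2: "0 \<le> e2" "e2 \<le> 1 / y"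
    using sum_inverse_sqrt_expansion[OF Y1] by (simp_all add: e2_def y_def)
  define S1 where "S1 = (\<Sum>n=1..Y. sawtooth (x / real n ^ 2))"
  define S2 where "S2 = (\<Sum>n=1..Y. sawtooth (sqrt (x / real n)))"
  have S1: "\<bar>S1\<bar> \<le> 24800 * z * (1 + ln x) ^ 2" and S2: "\<bar>S2\<bar> \<le> 24800 * z * (1 + ln x) ^ 2"
    unfolding S1_def S2_def using abs_sum_sawtooth_inverse_square[OF z Y(1)] abs_sum_sawtooth_inverse_sqrt[OF z Y(1)] by auto
  have fl: "of_int \<lfloor>t\<rfloor> = t - 1/2 - sawtooth t" for t by (simp add: sawtooth_def frac_def)
  have F1: "(\<Sum>b=1..Y. of_int \<lfloor>x / real b ^ 2\<rfloor>) = x * (\<Sum>n=1..Y. 1 / real n ^ 2) - y / 2 - S1"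
    by (simp add: fl S1_def sum_subtractf sum_distrib_left y_def)
  have F2: "(\<Sum>a=1..Y. of_int \<lfloor>sqrt (x / real a)\<rfloor>) = sqrt x * (\<Sum>n=1..Y. 1 / sqrt (real n)) - y / 2 - S2"
    by (simp add: fl S2_def sum_subtractf sum_distrib_left y_def real_sqrt_divide)
  have "sqrt x = u * sqrt y" using y by (simp add: u_def real_sqrt_divide)
  then have sq: "sqrt x * (2 * sqrt y) = 2 * u * y" "sqrt x * (1 / (2 * sqrt y)) = u / 2" using y by simp_all
  have xs: "x * (1 / y) = u ^ 2" "x * (1 / (2 * y ^ 2)) = u ^ 2 / (2 * y)"
    using y unfolding xu by (simp_all add: power2_eq_square)
  have G1: "x * (\<Sum>n=1..Y. 1 / real n ^ 2) = Re (zeta 2) * x - x * e1 - u ^ 2 + u ^ 2 / (2 * y)"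
  proof -
    have "x * (\<Sum>n=1..Y. 1 / real n ^ 2) = x * (Re (zeta 2) - e1) - x * (1 / y) + x * (1 / (2 * y ^ 2))"
      by (simp only: e1_def) (simp add: algebra_simps)
    then show ?thesis unfolding xs by (simp add: algebra_simps)
  qed
  have G2: "sqrt x * (\<Sum>n=1..Y. 1 / sqrt (real n)) = Re (zeta (1/2)) * sqrt x - sqrt x * e2 + 2 * u * y + u / 2"
  proof -
    have "sqrt x * (\<Sum>n=1..Y. 1 / sqrt (real n)) = sqrt x * (Re (zeta (1/2)) - e2) + sqrt x * (2 * sqrt y) + sqrt x * (1 / (2 * sqrt y))"
      by (simp only: e2_def) (simp add: algebra_simps)
    then show ?thesis unfolding sq by (simp add: algebra_simps)
  qed
  define M where "M = - (u ^ 2) + u ^ 2 / (2 * y) + 2 * u * y + u / 2 - y - y ^ 2"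
  have total: "lattice_count x - Re (zeta 2) * x - Re (zeta (1/2)) * sqrt x = M - x * e1 - sqrt x * e2 - S1 - S2"
    unfolding lattice_count_hyperbola[OF Y] F1 F2 G1 G2 M_def by (simp add: y_def)
  define e where "e = u - y"
  have e: "0 \<le> e" "e \<le> 3" using uy by (auto simp: e_def)
  have "M = - (e ^ 2) + 3 / 2 * e + e ^ 2 / (2 * y)"
  proof -
    have u: "u = y + e" by (simp add: e_def)
    show ?thesis unfolding M_def u using y by (simp add: field_simps power2_eq_square)
  qed
  moreover have "0 \<le> e ^ 2" "e ^ 2 \<le> 9" using power_mono[OF e(2,1), of 2] by auto
  moreover have "0 \<le> e ^ 2 / (2 * y)" "e ^ 2 / (2 * y) \<le> 9"
  proof -
    show "0 \<le> e ^ 2 / (2 * y)" using y by simp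
    have "e ^ 2 / (2 * y) \<le> e ^ 2 / 1" using y by (intro divide_left_mono) auto
    then show "e ^ 2 / (2 * y) \<le> 9" using \<open>e ^ 2 \<le> 9\<close> by simp
  qed
  ultimately have M: "\<bar>M\<bar> \<le> 18" using e by linarith
  have cub: "(y + 1) ^ 3 \<le> (2 * y) ^ 3" using y by (intro power_mono) auto
  have xe1: "0 \<le> x * e1" "x * e1 \<le> 8"
  proof -
    show "0 \<le> x * e1" using x1 e1 by simp
    have "x * e1 \<le> (2 * y) ^ 3 * (1 / y ^ 3)" using x1 e1 y cub by (intro mult_mono) auto
    then show "x * e1 \<le> 8" using y by (simp add: power_mult_distrib)
  qed
  have xe2: "0 \<le> sqrt x * e2" "sqrt x * e2 \<le> 2 * z"
  proof -
    show "0 \<le> sqrt x * e2" using x1 e2 by simp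
    have "z ^ 3 \<le> z ^ 4" using z by (intro power_increasing) auto
    also have "\<dots> \<le> (2 * y) ^ 3" using z y cub by linarith
    finally have "z \<le> 2 * y" by (rule power_le_imp_le_base[of _ 2, simplified]) (use y in auto)
    then have "z * z \<le> 2 * z * y" using z by simp
    have "sqrt x * e2 \<le> z ^ 2 * (1 / y)" unfolding sx using e2 by (intro mult_left_mono) auto
    also have "\<dots> \<le> 2 * z" using \<open>z * z \<le> 2 * z * y\<close> y by (simp add: divide_le_eq power2_eq_square)
    finally show "sqrt x * e2 \<le> 2 * z" .
  qed
  have "z * 1 \<le> z * (1 + ln x) ^ 2" using z x1 by (intro mult_left_mono one_le_power) auto
  then have zl: "z \<le> z * (1 + ln x) ^ 2" by simp
  show ?thesis unfolding total using M xe1 xe2 S1 S2 zl z(1) by linarith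
qed

text \<open>For x \<ge> 1 the power x^\<epsilon> absorbs the logarithms. For x < 1 the count is 0 and both main terms are O(x^(1/4+\<epsilon>)) because
1/4 + \<epsilon> \<le> 1/2.\<close>

lemma lattice_count_asymptotic:
  assumes \<epsilon>: "0 < \<epsilon>" "\<epsilon> \<le> 1/4"
  shows "\<exists>K. \<forall>x>0. \<bar>lattice_count x - Re (zeta 2) * x - Re (zeta (1/2)) * sqrt x\<bar> \<le> K * x powr (1/4 + \<epsilon>)"
proof -
  define K1 where "K1 = 60000 * (1 + 2 / \<epsilon>) ^ 2"
  define K2 where "K2 = \<bar>Re (zeta 2)\<bar> + \<bar>Re (zeta (1/2))\<bar>"
  have K: "K1 \<ge> 0" "K2 \<ge> 0" by (auto simp: K1_def K2_def)
  have "\<bar>lattice_count x - Re (zeta 2) * x - Re (zeta (1/2)) * sqrt x\<bar> \<le> (K1 + K2) * x powr (1/4 + \<epsilon>)" if x: "x > 0" for x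
  proof (cases "x \<ge> 1")
    case True
    define z where "z = x powr (1/4)"
    have z: "z \<ge> 1" "z ^ 4 = x" using True by (simp_all add: z_def ge_one_powr_ge_zero powr_power)
    have "ln x \<le> x powr (\<epsilon> / 2) / (\<epsilon> / 2)" using True \<epsilon> by (intro ln_powr_bound) auto
    moreover have "1 \<le> x powr (\<epsilon> / 2)" using True \<epsilon> by (simp add: ge_one_powr_ge_zero)
    moreover have "x powr (\<epsilon> / 2) / (\<epsilon> / 2) = 2 / \<epsilon> * x powr (\<epsilon> / 2)" by simp
    ultimately have "1 + ln x \<le> (1 + 2 / \<epsilon>) * x powr (\<epsilon> / 2)"
      unfolding distrib_right by linarith
    then have "(1 + ln x) ^ 2 \<le> ((1 + 2 / \<epsilon>) * x powr (\<epsilon> / 2)) ^ 2" using True by (intro power_mono) auto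
    also have "\<dots> = (1 + 2 / \<epsilon>) ^ 2 * x powr \<epsilon>" using x by (simp add: power_mult_distrib powr_power)
    finally have "60000 * z * (1 + ln x) ^ 2 \<le> 60000 * z * ((1 + 2 / \<epsilon>) ^ 2 * x powr \<epsilon>)"
      using z by (intro mult_left_mono) auto
    also have "\<dots> = K1 * x powr (1/4 + \<epsilon>)" by (simp add: K1_def z_def powr_add)
    also have "\<dots> \<le> (K1 + K2) * x powr (1/4 + \<epsilon>)" using K by (intro mult_right_mono) auto
    finally show ?thesis using lattice_count_estimate[OF z] by linarith
  next
    case False
    then have "\<lfloor>x\<rfloor> = 0" using x by (simp add: floor_eq_iff)
    then have lc: "lattice_count x = 0" by (simp add: lattice_count_def)
    have "x powr 1 \<le> x powr (1/4 + \<epsilon>)"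
      by (rule powr_mono') (use x False \<epsilon> in auto)
    moreover have "x powr (1/2) \<le> x powr (1/4 + \<epsilon>)"
      by (rule powr_mono') (use x False \<epsilon> in auto)
    ultimately have "x \<le> x powr (1/4 + \<epsilon>)" "sqrt x \<le> x powr (1/4 + \<epsilon>)" using x by (auto simp: powr_half_sqrt)
    then have "\<bar>Re (zeta 2)\<bar> * x + \<bar>Re (zeta (1/2))\<bar> * sqrt x \<le> K2 * x powr (1/4 + \<epsilon>)"
      unfolding K2_def distrib_right by (intro add_mono mult_left_mono) auto
    moreover have "\<bar>Re (zeta 2) * x\<bar> = \<bar>Re (zeta 2)\<bar> * x" "\<bar>Re (zeta (1/2)) * sqrt x\<bar> = \<bar>Re (zeta (1/2))\<bar> * sqrt x"
      using x by (auto simp: abs_mult)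
    moreover have "K2 * x powr (1/4 + \<epsilon>) \<le> (K1 + K2) * x powr (1/4 + \<epsilon>)" using K by (intro mult_right_mono) auto
    ultimately show ?thesis unfolding lc by linarith
  qed
  then show ?thesis by blast
qed

section \<open>Assembling the theorem\<close>

lemma multiplicative_times:
  assumes "multiplicative f" and "h 1 = 1" and "\<And>m n. m > 0 \<Longrightarrow> n > 0 \<Longrightarrow> h (m * n) = h m * h n"
  shows "multiplicative (\<lambda>n. f n * h n)"
  using assms by (simp add: multiplicative_def)

text \<open>Comparing p^(-\<sigma> k) with 2^(-\<sigma> k) separates the dependence on p, which is
p^(-4\<sigma>), from that on k.\<close>

lemma abs_v_coeff_prime_power_powr_le:
  assumes p: "prime p" and \<sigma>: "\<sigma> > 0"
  shows "\<bar>v_coeff (p ^ (k + 4)) * real (p ^ (k + 4)) powr - \<sigma>\<bar>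
           \<le> (16 * real p powr (- 4 * \<sigma>)) * (real (Suc k) * (2 powr - \<sigma>) ^ k)"
proof -
  have p2: "real p \<ge> 2" using p prime_ge_2_nat by fastforce
  have "real (p ^ (k + 4)) powr - \<sigma> = real p powr (- 4 * \<sigma>) * (real p powr - \<sigma>) ^ k"
  proof -
    have "real (p ^ (k + 4)) powr - \<sigma> = (real p powr real (k + 4)) powr - \<sigma>"
      using powr_realpow[of "real p" "k + 4"] p2 by simp
    also have "\<dots> = real p powr (- 4 * \<sigma> + - \<sigma> * real k)"
      by (simp add: powr_powr algebra_simps)
    also have "\<dots> = real p powr (- 4 * \<sigma>) * real p powr (- \<sigma> * real k)"
      by (rule powr_add)
    also have "real p powr (- \<sigma> * real k) = (real p powr - \<sigma>) ^ k"
      using p2 by (simp add: powr_powr flip: powr_realpow)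
    finally show ?thesis .
  qed
  moreover have "(real p powr - \<sigma>) ^ k \<le> (2 powr - \<sigma>) ^ k"
    using p2 \<sigma> by (intro power_mono powr_mono2') auto
  moreover have "\<bar>v_coeff (p ^ (k + 4))\<bar> \<le> 16 * real (Suc k)"
    using abs_v_fps_nth_le[of k] by (simp add: v_coeff_prime_power[OF p])
  ultimately have "\<bar>v_coeff (p ^ (k + 4)) * real (p ^ (k + 4)) powr - \<sigma>\<bar>
      \<le> (16 * real (Suc k)) * (real p powr (- 4 * \<sigma>) * (2 powr - \<sigma>) ^ k)"
    by (simp only: abs_mult) (intro mult_mono mult_left_mono, auto)
  moreover have "(16 * m) * (P * Q) = (16 * P) * (m * Q)" for m P Q :: real by simp
  ultimately show ?thesis by metis
qed

text \<open>The Euler factor of |v| at p is 1 + O(p^(-4\<sigma>)) and 4\<sigma> > 1.\<close>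

lemma abs_summable_v_coeff:
  assumes \<sigma>: "\<sigma> > 1/4"
  shows "(\<lambda>n. v_coeff n * real n powr - \<sigma>) abs_summable_on UNIV"
proof -
  define f where "f n = v_coeff n * real n powr - \<sigma>" for n
  define q where "q = (2::real) powr - \<sigma>"
  have q: "0 < q" "q < 1" using \<sigma> by (auto simp: q_def powr_less_one)
  \<comment> \<open>from the sum of (k + 1) q^k over all k\<close>
  define K where "K = 16 * (1 / (1 - q)\<^sup>2)"
  have K0: "K \<ge> 0" by (simp add: K_def)
  have mf: "multiplicative f"
    unfolding f_def by (rule multiplicative_times[OF multiplicative_v_coeff]) (auto simp: powr_mult)
  have geo: "(\<lambda>k. real (Suc k) * q ^ k) sums (1 / (1 - q)\<^sup>2)"
    using geometric_deriv_sums[of q] q by simp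
  have small: "f (p ^ 0) = 1" "f (p ^ 1) = 0" "f (p ^ 2) = 0" "f (p ^ 3) = 0" if "prime p" for p
    using v_coeff_prime_power[OF that] v_fps_nth_less_4 prime_gt_0_nat[OF that]
    unfolding f_def by (simp_all only: v_coeff_prime_power[OF that]) simp_all
  have bound: "summable (\<lambda>k. \<bar>f (p ^ k)\<bar>) \<and> (\<Sum>k. \<bar>f (p ^ k)\<bar>) \<le> 1 + K * real p powr (- 4 * \<sigma>)"
    if p: "prime p" for p
  proof -
    have le: "\<bar>f (p ^ (k + 4))\<bar> \<le> (16 * real p powr (- 4 * \<sigma>)) * (real (Suc k) * q ^ k)" for k
      using abs_v_coeff_prime_power_powr_le[OF p, of \<sigma> k] \<sigma> by (simp only: f_def q_def)
    have sm: "(\<lambda>k. (16 * real p powr (- 4 * \<sigma>)) * (real (Suc k) * q ^ k)) sums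
        ((16 * real p powr (- 4 * \<sigma>)) * (1 / (1 - q)\<^sup>2))"
      by (rule sums_mult[OF geo])
    have s4: "summable (\<lambda>k. \<bar>f (p ^ (k + 4))\<bar>)"
      by (rule summable_comparison_test'[OF sums_summable[OF sm], of 0]) (use le in auto)
    then have s: "summable (\<lambda>k. \<bar>f (p ^ k)\<bar>)" by (subst (asm) summable_iff_shift)
    have "(\<Sum>k. \<bar>f (p ^ k)\<bar>) = (\<Sum>k. \<bar>f (p ^ (k + 4))\<bar>) + (\<Sum>k<4. \<bar>f (p ^ k)\<bar>)"
      by (rule suminf_split_initial_segment[OF s])
    also have "(\<Sum>k<4. \<bar>f (p ^ k)\<bar>) = 1"
      using small[OF p] by (simp add: eval_nat_numeral)
    also have "(\<Sum>k. \<bar>f (p ^ (k + 4))\<bar>) \<le> (16 * real p powr (- 4 * \<sigma>)) * (1 / (1 - q)\<^sup>2)"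
      using suminf_le[OF le s4 sums_summable[OF sm]] sums_unique[OF sm] by simp
    finally show ?thesis using s by (simp add: K_def mult_ac)
  qed
  have sz: "summable (\<lambda>n. real n powr (- 4 * \<sigma>))"
    using \<sigma> by (subst summable_real_powr_iff) auto
  have "f abs_summable_on UNIV"
  proof (rule abs_summable_multiplicative[OF mf])
    show "f 0 = 0" by (simp add: f_def)
    show "summable (\<lambda>k. \<bar>f (p ^ k)\<bar>)" if "prime p" for p using bound[OF that] by simp
    fix N
    have "(\<Prod>p<N. euler_factor (\<lambda>n. \<bar>f n\<bar>) p) \<le> (\<Prod>p<N. 1 + K * real p powr (- 4 * \<sigma>))"
    proof (intro prod_mono conjI)
      fix p
      show "euler_factor (\<lambda>n. \<bar>f n\<bar>) p \<le> 1 + K * real p powr (- 4 * \<sigma>)"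
        using bound[of p] K0 by (auto simp: euler_factor_def)
      show "0 \<le> euler_factor (\<lambda>n. \<bar>f n\<bar>) p"
        using bound[of p] by (auto simp: euler_factor_def intro!: suminf_nonneg)
    qed
    also have "\<dots> \<le> exp (\<Sum>p<N. K * real p powr (- 4 * \<sigma>))"
      by (rule prod_le_exp_sum) (use K0 in auto)
    also have "\<dots> \<le> exp (\<Sum>n. K * real n powr (- 4 * \<sigma>))"
      using sum_le_suminf[OF summable_mult[OF sz, of K], of "{..<N}"] K0 by simp
    finally show "(\<Prod>p<N. euler_factor (\<lambda>n. \<bar>f n\<bar>) p) \<le> exp (\<Sum>n. K * real n powr (- 4 * \<sigma>))" .
  qed
  then show ?thesis unfolding f_def .
qed

definition dirichlet_weight :: "complex \<Rightarrow> nat \<Rightarrow> complex" where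
  "dirichlet_weight s n = 1 / of_nat n powr s"

lemma dirichlet_weight_0 [simp]: "dirichlet_weight s 0 = 0"
  by (simp add: dirichlet_weight_def)

lemma dirichlet_weight_mult: "dirichlet_weight s (m * n) = dirichlet_weight s m * dirichlet_weight s n"
  unfolding dirichlet_weight_def of_nat_mult by (subst powr_times_real) auto

lemma norm_dirichlet_weight: "norm (dirichlet_weight s n) = real n powr - Re s"
proof (cases "n = 0")
  case False
  then show ?thesis
    using norm_powr_real_powr[of "of_nat n" s] by (simp add: dirichlet_weight_def norm_divide powr_minus_divide)
qed (simp add: dirichlet_weight_def)

lemma has_sum_positive_iff:
  fixes F :: "nat \<Rightarrow> 'a :: {comm_monoid_add, topological_space}"
  assumes "F 0 = 0"
  shows "(F has_sum S) UNIV \<longleftrightarrow> ((\<lambda>n. F (Suc n)) has_sum S) UNIV"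
proof -
  have "(F has_sum S) UNIV \<longleftrightarrow> (F has_sum S) {0<..}"
    by (rule has_sum_cong_neutral) (use assms in auto)
  also have "\<dots> \<longleftrightarrow> ((\<lambda>n. F (Suc n)) has_sum S) UNIV"
    by (rule has_sum_reindex_bij_witness[of _ Suc "\<lambda>n. n - 1"]) auto
  finally show ?thesis .
qed

lemma abs_summable_dirichlet_weight: "Re s > 1 \<Longrightarrow> dirichlet_weight s abs_summable_on UNIV"
  unfolding norm_dirichlet_weight
  by (intro summable_nonneg_imp_summable_on) (auto simp: summable_real_powr_iff)

lemma has_sum_dirichlet_weight:
  assumes "Re s > 1"
  shows "(dirichlet_weight s has_sum zeta s) UNIV"
proof -
  have "summable (\<lambda>n. norm (dirichlet_weight s (Suc n)))"
    using assms unfolding norm_dirichlet_weight by (subst summable_Suc_iff) (simp add: summable_real_powr_iff)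
  then have "((\<lambda>n. dirichlet_weight s (Suc n)) has_sum zeta s) UNIV"
    by (rule norm_summable_imp_has_sum) (use zeta_sums[OF assms] in \<open>simp only: dirichlet_weight_def\<close>)
  then show ?thesis by (subst has_sum_positive_iff) auto
qed

lemma has_sum_squares:
  fixes h :: "nat \<Rightarrow> 'a :: real_normed_field"
  assumes "h 0 = 0"
  shows "((\<lambda>n. of_real (square_ind n) * h n) has_sum S) UNIV \<longleftrightarrow> ((\<lambda>b. h (b\<^sup>2)) has_sum S) UNIV"
proof -
  have "((\<lambda>n. of_real (square_ind n) * h n) has_sum S) UNIV \<longleftrightarrow> (h has_sum S) (range (\<lambda>b. b\<^sup>2))"
    by (rule has_sum_cong_neutral) (use assms in \<open>auto simp: square_ind_def is_nth_power_def\<close>)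
  also have "\<dots> \<longleftrightarrow> ((\<lambda>b. h (b\<^sup>2)) has_sum S) UNIV"
    by (subst has_sum_reindex) (auto simp: inj_on_def o_def)
  finally show ?thesis .
qed

lemma dirichlet_weight_square: "dirichlet_weight s (b\<^sup>2) = dirichlet_weight (2 * s) b"
proof -
  have "dirichlet_weight s (b\<^sup>2) = dirichlet_weight s b * dirichlet_weight s b"
    by (simp add: power2_eq_square dirichlet_weight_mult)
  also have "\<dots> = dirichlet_weight (2 * s) b"
    by (simp only: dirichlet_weight_def mult_2 powr_add) simp
  finally show ?thesis .
qed

lemma has_sum_square_ind:
  assumes "Re s > 1/2"
  shows "((\<lambda>n. of_real (square_ind n) * dirichlet_weight s n) has_sum zeta (2 * s)) UNIV"
  using has_sum_dirichlet_weight[of "2 * s"] assms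
  by (subst has_sum_squares) (simp_all add: dirichlet_weight_square)

lemma abs_summable_square_ind:
  assumes "Re s > 1/2"
  shows "(\<lambda>n. of_real (square_ind n) * dirichlet_weight s n) abs_summable_on UNIV"
proof -
  have "(\<lambda>b. norm (dirichlet_weight s (b\<^sup>2))) summable_on UNIV"
    using abs_summable_dirichlet_weight[of "2 * s"] assms by (simp add: dirichlet_weight_square)
  then obtain S where "((\<lambda>b. norm (dirichlet_weight s (b\<^sup>2))) has_sum S) UNIV" by (auto simp: summable_on_def)
  then have "((\<lambda>n. of_real (square_ind n) * norm (dirichlet_weight s n)) has_sum S) UNIV"
    by (subst has_sum_squares) auto
  moreover have "norm (of_real (square_ind n) * dirichlet_weight s n) = of_real (square_ind n) * norm (dirichlet_weight s n)" for n
    by (simp add: norm_mult square_ind_def)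
  ultimately show ?thesis by (auto simp: summable_on_def)
qed

lemma abs_summable_v_coeff_complex:
  assumes "Re s > 1/4"
  shows "(\<lambda>n. of_real (v_coeff n) * dirichlet_weight s n) abs_summable_on UNIV"
  using abs_summable_v_coeff[OF assms] by (simp add: norm_mult norm_dirichlet_weight abs_mult)

text \<open>In the half-plane Re s > 1 the series of 1, of the indicator of the squares and of v all converge
absolutely, so the Dirichlet series of their convolution is the product of the three.\<close>

lemma has_sum_t_e:
  assumes s: "Re s > 1"
  shows "((\<lambda>n. of_real (dirichlet_conv square_divisor_count v_coeff n) * dirichlet_weight s n) has_sum
           zeta s * zeta (2 * s) * infsum (\<lambda>n. of_real (v_coeff n) * dirichlet_weight s n) UNIV) UNIV"
proof -
  have s': "Re s > 1/2" "Re s > 1/4" using s by auto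
  have one: "(\<lambda>n. of_real 1 * dirichlet_weight s n) abs_summable_on UNIV"
    "((\<lambda>n. of_real 1 * dirichlet_weight s n) has_sum zeta s) UNIV"
    using abs_summable_dirichlet_weight[OF s] has_sum_dirichlet_weight[OF s] by simp_all
  note sq = abs_summable_square_ind[OF s'(1)] has_sum_square_ind[OF s'(1)]
  note v = abs_summable_v_coeff_complex[OF s'(2)]
  have r: "(\<lambda>n. of_real (square_divisor_count n) * dirichlet_weight s n) abs_summable_on UNIV"
    "((\<lambda>n. of_real (square_divisor_count n) * dirichlet_weight s n) has_sum zeta s * zeta (2 * s)) UNIV"
    unfolding square_divisor_count_def
    by (rule abs_summable_dirichlet_conv[OF _ _ one(1) sq(1)] has_sum_dirichlet_conv[OF _ _ one sq];
        simp add: dirichlet_weight_mult)+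
  show ?thesis
    by (rule has_sum_dirichlet_conv[OF _ _ r v has_sum_infsum[OF abs_summable_summable[OF v]]])
       (simp_all add: dirichlet_weight_mult)
qed

lemma t_e_dirichlet_series:
  assumes s: "Re s > 1"
  shows "(\<lambda>n. of_nat (t_e (Suc n)) / of_nat (Suc n) powr s) sums
           (zeta s * zeta (2 * s) * (\<Sum>n. of_real (v_coeff (Suc n)) / of_nat (Suc n) powr s))"
proof -
  have s': "Re s > 1/4" using s by simp
  have "((\<lambda>n. of_real (v_coeff n) * dirichlet_weight s n) has_sum infsum (\<lambda>n. of_real (v_coeff n) * dirichlet_weight s n) UNIV) UNIV"
    by (rule has_sum_infsum[OF abs_summable_summable[OF abs_summable_v_coeff_complex[OF s']]])
  then have "(\<lambda>n. of_real (v_coeff (Suc n)) * dirichlet_weight s (Suc n)) sums infsum (\<lambda>n. of_real (v_coeff n) * dirichlet_weight s n) UNIV"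
    by (subst (asm) has_sum_positive_iff) (auto intro: has_sum_imp_sums)
  then have V: "infsum (\<lambda>n. of_real (v_coeff n) * dirichlet_weight s n) UNIV = (\<Sum>n. of_real (v_coeff (Suc n)) / of_nat (Suc n) powr s)"
    by (simp add: sums_iff dirichlet_weight_def del: of_nat_Suc)
  have "(\<lambda>n. of_real (dirichlet_conv square_divisor_count v_coeff (Suc n)) * dirichlet_weight s (Suc n)) sums
      (zeta s * zeta (2 * s) * infsum (\<lambda>n. of_real (v_coeff n) * dirichlet_weight s n) UNIV)"
    using has_sum_t_e[OF s] by (subst (asm) has_sum_positive_iff) (auto intro: has_sum_imp_sums)
  moreover have "complex_of_real (dirichlet_conv square_divisor_count v_coeff (Suc n)) = of_nat (t_e (Suc n))" for n
    using t_e_eq_dirichlet_conv[of "Suc n"] by (metis of_real_of_nat_eq zero_less_Suc)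
  ultimately show ?thesis unfolding V by (simp add: dirichlet_weight_def del: of_nat_Suc)
qed

lemma summable_v_coeff_complex:
  assumes "Re s > 1/4"
  shows "summable (\<lambda>n. norm (of_real (v_coeff (Suc n)) / of_nat (Suc n) powr s :: complex))"
proof -
  have "summable (\<lambda>n. norm (of_real (v_coeff n) * dirichlet_weight s n))"
    by (rule summable_on_imp_summable[OF abs_summable_v_coeff_complex[OF assms]])
  then have "summable (\<lambda>n. norm (of_real (v_coeff (Suc n)) * dirichlet_weight s (Suc n)))"
    by (subst summable_Suc_iff)
  then show ?thesis by (simp add: dirichlet_weight_def del: of_nat_Suc)
qed

definition V_at_1 :: real where "V_at_1 = infsum (\<lambda>n. v_coeff n * (1 / real n)) UNIV"
definition V_at_half :: real where "V_at_half = infsum (\<lambda>n. v_coeff n * real n powr - (1/2)) UNIV"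

lemma has_sum_V_at_1: "((\<lambda>n. v_coeff n * (1 / real n)) has_sum V_at_1) UNIV"
  and abs_summable_V_at_1: "(\<lambda>n. v_coeff n * (1 / real n)) abs_summable_on UNIV"
proof -
  have "real n powr - 1 = 1 / real n" for n by (cases "n = 0") (auto simp: powr_minus_divide)
  then show *: "(\<lambda>n. v_coeff n * (1 / real n)) abs_summable_on UNIV"
    using abs_summable_v_coeff[of 1] by simp
  show "((\<lambda>n. v_coeff n * (1 / real n)) has_sum V_at_1) UNIV"
    unfolding V_at_1_def by (rule has_sum_infsum[OF abs_summable_summable[OF *]])
qed

lemma has_sum_V_at_half: "((\<lambda>n. v_coeff n * real n powr - (1/2)) has_sum V_at_half) UNIV"
  unfolding V_at_half_def by (rule has_sum_infsum[OF abs_summable_summable[OF abs_summable_v_coeff]]) simp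

lemma has_sum_w_coeff:
  shows "((\<lambda>n. w_coeff n * (1 / real n)) has_sum Re (zeta 2) * V_at_1) UNIV"
    and "(\<lambda>n. w_coeff n * (1 / real n)) abs_summable_on UNIV"
proof -
  have "summable (\<lambda>n. norm (1 / real (Suc n) ^ 2))"
    using sums_summable[OF sums_zeta_2] by simp
  then have "((\<lambda>n. 1 / real (Suc n) ^ 2) has_sum Re (zeta 2)) UNIV"
    by (rule norm_summable_imp_has_sum[OF _ sums_zeta_2])
  then have "((\<lambda>n. 1 / real n ^ 2) has_sum Re (zeta 2)) UNIV"
    by (subst has_sum_positive_iff) auto
  then have sq: "((\<lambda>n. of_real (square_ind n) * (1 / real n)) has_sum Re (zeta 2)) UNIV"
    by (subst has_sum_squares) auto
  have norm_eq: "norm (of_real (square_ind n) * (1 / real n)) = of_real (square_ind n) * (1 / real n)" for n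
    by (simp add: square_ind_def)
  have sq': "(\<lambda>n. of_real (square_ind n) * (1 / real n)) abs_summable_on UNIV"
    unfolding norm_eq by (rule has_sum_imp_summable[OF sq])
  have v: "(\<lambda>n. of_real (v_coeff n) * (1 / real n)) abs_summable_on UNIV"
    "((\<lambda>n. of_real (v_coeff n) * (1 / real n)) has_sum V_at_1) UNIV"
    using abs_summable_V_at_1 has_sum_V_at_1 by simp_all
  show "((\<lambda>n. w_coeff n * (1 / real n)) has_sum Re (zeta 2) * V_at_1) UNIV"
    using has_sum_dirichlet_conv[OF _ _ sq' sq v] by (simp add: w_coeff_def)
  show "(\<lambda>n. w_coeff n * (1 / real n)) abs_summable_on UNIV"
    using abs_summable_dirichlet_conv[OF _ _ sq' v(1)] by (simp add: w_coeff_def)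
qed

text \<open>The Euler factor of \<zeta>(2s) V(s) is (1 - X) T(X), with the coefficients 2^\<omega>(a) - 2^\<omega>(a-1). For
1 \<le> a \<le> 5 they vanish except for a = 2, where the coefficient is 1. The product in C1 is therefore
the Euler product at s = 1.\<close>

lemma C1_eq:
  shows "prime p \<Longrightarrow> summable (\<lambda>a. C1_term p (a + 6))"
    and "convergent_prod C1_factor" and "C1 = Re (zeta 2) * V_at_1"
proof -
  define f where "f n = w_coeff n * (1 / real n)" for n
  have "multiplicative f"
    unfolding f_def by (rule multiplicative_times[OF multiplicative_w_coeff]) auto
  moreover have "f abs_summable_on UNIV" unfolding f_def by (rule has_sum_w_coeff(2))
  ultimately have f: "multiplicative f" "f 0 = 0" "f abs_summable_on UNIV"
    by (simp_all add: f_def)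
  have fp: "f (p ^ Suc k) = C1_term p (Suc k)" if "prime p" for p k
    using w_coeff_prime_power[OF that, of k] by (simp add: f_def C1_term_def)
  have sm: "summable (\<lambda>k. f (p ^ k))" if "prime p" for p
    by (rule summable_rabs_cancel[OF summable_prime_powers[OF f(3) that]])
  have fp6: "f (p ^ (k + 6)) = C1_term p (k + 6)" if "prime p" for p k
  proof -
    have "k + 6 = Suc (k + 5)" by simp
    then show ?thesis using fp[OF that] by (simp only:)
  qed
  show "summable (\<lambda>a. C1_term p (a + 6))" if "prime p" for p
    using summable_ignore_initial_segment[OF sm[OF that], of 6] by (simp only: fp6[OF that])
  have factor: "euler_factor f p = C1_factor p" for p
  proof (cases "prime p")
    case True
    have "(\<Sum>k. f (p ^ k)) = (\<Sum>k. f (p ^ (k + 6))) + (\<Sum>k<6. f (p ^ k))"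
      by (rule suminf_split_initial_segment[OF sm[OF True]])
    also have "(\<Sum>k<6. f (p ^ k)) = f 1 + (\<Sum>k<5. f (p ^ Suc k))"
      using sum.lessThan_Suc_shift[of "\<lambda>k. f (p ^ k)" 5] by simp
    also have "(\<Sum>k<5. f (p ^ Suc k)) = (\<Sum>k<5. C1_term p (Suc k))" by (simp only: fp[OF True])
    also have "\<dots> = C1_term p 1 + C1_term p 2 + C1_term p 3 + C1_term p 4 + C1_term p 5"
      by (simp add: eval_nat_numeral)
    also have "\<dots> = 1 / real p ^ 2"
      by (simp add: C1_term_def omega_small)
    also have "(\<Sum>k. f (p ^ (k + 6))) = (\<Sum>k. C1_term p (k + 6))" by (simp only: fp6[OF True])
    finally show ?thesis using True f(1) by (simp add: euler_factor_def C1_factor_def)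
  qed (simp add: euler_factor_def C1_factor_def)
  then have eq: "C1_factor = euler_factor f" by auto
  show "convergent_prod C1_factor" unfolding eq by (rule euler_product[OF f])
  show "C1 = Re (zeta 2) * V_at_1"
    unfolding C1_def eq euler_product(2)[OF f] using infsumI[OF has_sum_w_coeff(1)] by (simp only: f_def[abs_def])
qed

text \<open>The Euler product of V(s) at s = 1/2.\<close>

lemma C2_eq:
  shows "prime p \<Longrightarrow> summable (\<lambda>a. C2_term p (a + 4))"
    and "convergent_prod C2_factor" and "C2 = Re (zeta (1/2)) * V_at_half"
proof -
  define f where "f n = v_coeff n * real n powr - (1/2)" for n
  have "multiplicative f"
    unfolding f_def by (rule multiplicative_times[OF multiplicative_v_coeff]) (auto simp: powr_mult)
  moreover have "f abs_summable_on UNIV" unfolding f_def by (rule abs_summable_v_coeff) simp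
  ultimately have f: "multiplicative f" "f 0 = 0" "f abs_summable_on UNIV"
    by (simp_all add: f_def)
  have fp: "f (p ^ k) = fps_nth v_fps k / real p powr (real k / 2)" if "prime p" for p k
  proof -
    have "real p > 0" using that prime_gt_0_nat by simp
    then have "real (p ^ k) powr - (1/2) = real p powr - (real k / 2)"
      by (simp add: powr_powr flip: powr_realpow)
    then show ?thesis by (simp add: f_def v_coeff_prime_power[OF that] powr_minus_divide)
  qed
  have sm: "summable (\<lambda>k. f (p ^ k))" if "prime p" for p
    by (rule summable_rabs_cancel[OF summable_prime_powers[OF f(3) that]])
  have fp4: "f (p ^ (k + 4)) = C2_term p (k + 4)" if "prime p" for p k
    using v_fps_nth_ge_3[of "k + 4"] by (simp only: fp[OF that] C2_term_def)
  show "summable (\<lambda>a. C2_term p (a + 4))" if "prime p" for p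
    using summable_ignore_initial_segment[OF sm[OF that], of 4] by (simp only: fp4[OF that])
  have factor: "euler_factor f p = C2_factor p" for p
  proof (cases "prime p")
    case True
    have "(\<Sum>k. f (p ^ k)) = (\<Sum>k. f (p ^ (k + 4))) + (\<Sum>k<4. f (p ^ k))"
      by (rule suminf_split_initial_segment[OF sm[OF True]])
    also have "(\<Sum>k<4. f (p ^ k)) = f (p ^ 0) + f (p ^ 1) + f (p ^ 2) + f (p ^ 3)"
      by (simp add: eval_nat_numeral)
    also have "\<dots> = 1"
      using prime_gt_0_nat[OF True] by (simp only: fp[OF True] v_fps_nth_less_4) simp
    also have "(\<Sum>k. f (p ^ (k + 4))) = (\<Sum>k. C2_term p (k + 4))" by (simp only: fp4[OF True])
    finally show ?thesis using True by (simp add: euler_factor_def C2_factor_def)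
  qed (simp add: euler_factor_def C2_factor_def)
  then have eq: "C2_factor = euler_factor f" by auto
  show "convergent_prod C2_factor" unfolding eq by (rule euler_product[OF f])
  show "C2 = Re (zeta (1/2)) * V_at_half"
    unfolding C2_def eq euler_product(2)[OF f] by (simp add: f_def[abs_def] V_at_half_def)
qed

text \<open>Group the pairs (d, m) with d m \<le> x by d. The terms with d > x vanish, so the sum
may be extended to all d.\<close>

lemma sum_t_e_eq:
  assumes x: "x > 0"
  shows "((\<lambda>d. v_coeff d * lattice_count (x / real d)) has_sum
           (\<Sum>n\<in>{n. 1 \<le> n \<and> real n \<le> x}. real (t_e n))) UNIV"
proof -
  define N where "N = nat \<lfloor>x\<rfloor>"
  have iff: "real n \<le> x \<longleftrightarrow> n \<le> N" for n using x by (simp add: N_def le_nat_iff le_floor_iff)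
  have le: "m \<le> nat \<lfloor>x / real d\<rfloor> \<longleftrightarrow> d * m \<le> N" if "d > 0" for d m
  proof -
    have "m \<le> nat \<lfloor>x / real d\<rfloor> \<longleftrightarrow> real m \<le> x / real d"
      using x by (simp add: le_nat_iff le_floor_iff)
    also have "\<dots> \<longleftrightarrow> real (d * m) \<le> x" using that by (simp add: pos_le_divide_eq mult.commute)
    also have "\<dots> \<longleftrightarrow> d * m \<le> N" by (rule iff)
    finally show ?thesis .
  qed
  have "(\<Sum>n\<in>{n. 1 \<le> n \<and> real n \<le> x}. real (t_e n)) = (\<Sum>n\<in>{1..N}. dirichlet_conv square_divisor_count v_coeff n)"
    by (rule sum.cong) (auto simp: iff t_e_eq_dirichlet_conv)
  also have "\<dots> = (\<Sum>(n, m)\<in>(SIGMA n:{1..N}. {m. m dvd n}). square_divisor_count m * v_coeff (n div m))"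
    unfolding dirichlet_conv_def by (subst sum.Sigma) auto
  also have "\<dots> = (\<Sum>(d, m)\<in>(SIGMA d:{1..N}. {1..nat \<lfloor>x / real d\<rfloor>}). v_coeff d * square_divisor_count m)"
  proof (rule sum.reindex_bij_witness[of _ "\<lambda>(d, m). (d * m, m)" "\<lambda>(n, m). (n div m, m)"])
    fix a assume "a \<in> (SIGMA n:{1..N}. {m. m dvd n})"
    then obtain m d where a: "a = (d * m, m)" "1 \<le> d * m" "d * m \<le> N"
      by (auto elim!: dvdE simp: mult.commute)
    then have pos: "d > 0" "m > 0" by (auto intro!: gr0I)
    have "d * 1 \<le> d * m" using pos by (intro mult_le_mono) auto
    then have "d \<le> N" using a by linarith
    then show "(case a of (n, m) \<Rightarrow> (n div m, m)) \<in> (SIGMA d:{1..N}. {1..nat \<lfloor>x / real d\<rfloor>})"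
      using a pos le by simp
    show "(case case a of (n, m) \<Rightarrow> (n div m, m) of (d, m) \<Rightarrow> (d * m, m)) = a"
      "(case case a of (n, m) \<Rightarrow> (n div m, m) of (d, m) \<Rightarrow> v_coeff d * square_divisor_count m) = (case a of (n, m) \<Rightarrow> square_divisor_count m * v_coeff (n div m))"
      using a pos by simp_all
  next
    fix b assume "b \<in> (SIGMA d:{1..N}. {1..nat \<lfloor>x / real d\<rfloor>})"
    then obtain d m where b: "b = (d, m)" "1 \<le> d" "1 \<le> m" "m \<le> nat \<lfloor>x / real d\<rfloor>" by auto
    then have "d * m \<le> N" using le by simp
    then show "(case case b of (d, m) \<Rightarrow> (d * m, m) of (n, m) \<Rightarrow> (n div m, m)) = b"
      "(case b of (d, m) \<Rightarrow> (d * m, m)) \<in> (SIGMA n:{1..N}. {m. m dvd n})"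
      using b by auto
  qed
  also have "\<dots> = (\<Sum>d\<in>{1..N}. v_coeff d * lattice_count (x / real d))"
    unfolding lattice_count_def sum_distrib_left by (subst sum.Sigma) auto
  finally have T: "(\<Sum>n\<in>{n. 1 \<le> n \<and> real n \<le> x}. real (t_e n)) = (\<Sum>d\<in>{1..N}. v_coeff d * lattice_count (x / real d))" .
  have "v_coeff d * lattice_count (x / real d) = 0" if "d \<notin> {1..N}" for d
  proof (cases "d = 0")
    case False
    then have "\<not> real d \<le> x" using that iff by auto
    then have "\<lfloor>x / real d\<rfloor> = 0" using x False by (simp add: floor_eq_iff)
    then show ?thesis by (simp add: lattice_count_def)
  qed simp
  then show ?thesis unfolding T
    by (subst has_sum_cong_neutral[where T = "{1..N}" and g = "\<lambda>d. v_coeff d * lattice_count (x / real d)"]) auto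
qed

text \<open>Insert the asymptotic formula for each D(x/d). The main terms bring in exactly the values V(1) and V(1/2), and
the error terms to at most K x^\<theta> \<Sum>|v(d)| d^(-\<theta>) with \<theta> = 1/4 + \<epsilon>.\<close>

lemma sum_t_e_estimate:
  assumes \<epsilon>: "0 < \<epsilon>" "\<epsilon> \<le> 1/4"
  shows "\<exists>K. \<forall>x>0. \<bar>(\<Sum>n\<in>{n. 1 \<le> n \<and> real n \<le> x}. real (t_e n)) - C1 * x - C2 * x powr (1/2)\<bar>
           \<le> K * x powr (1/4 + \<epsilon>)"
proof -
  define \<theta> where "\<theta> = 1/4 + \<epsilon>"
  define E where "E x = lattice_count x - Re (zeta 2) * x - Re (zeta (1/2)) * sqrt x" for x
  obtain K where K: "\<And>x. x > 0 \<Longrightarrow> \<bar>E x\<bar> \<le> K * x powr \<theta>"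
    using lattice_count_asymptotic[OF \<epsilon>] unfolding E_def \<theta>_def by blast
  define M where "M = infsum (\<lambda>n. norm (v_coeff n * real n powr - \<theta>)) UNIV"
  have M: "((\<lambda>n. norm (v_coeff n * real n powr - \<theta>)) has_sum M) UNIV"
    unfolding M_def \<theta>_def using \<epsilon> by (intro has_sum_infsum abs_summable_v_coeff) auto
  have "\<bar>(\<Sum>n\<in>{n. 1 \<le> n \<and> real n \<le> x}. real (t_e n)) - C1 * x - C2 * x powr (1/2)\<bar> \<le> (K * M) * x powr \<theta>"
    if x: "x > 0" for x
  proof -
    define T where "T = (\<Sum>n\<in>{n. 1 \<le> n \<and> real n \<le> x}. real (t_e n))"
    have sq: "sqrt (x / real d) = sqrt x * real d powr - (1/2)" for d
      by (cases "d = 0") (simp_all add: real_sqrt_divide powr_minus_divide powr_half_sqrt)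
    have "((\<lambda>d. v_coeff d * lattice_count (x / real d) - (Re (zeta 2) * x) * (v_coeff d * (1 / real d))
            - (Re (zeta (1/2)) * sqrt x) * (v_coeff d * real d powr - (1/2)))
          has_sum T - (Re (zeta 2) * x) * V_at_1 - (Re (zeta (1/2)) * sqrt x) * V_at_half) UNIV"
      unfolding T_def diff_conv_add_uminus
      by (intro has_sum_add has_sum_uminusI has_sum_cmult_right sum_t_e_eq[OF x] has_sum_V_at_1 has_sum_V_at_half)
    moreover have "v_coeff d * lattice_count (x / real d) - (Re (zeta 2) * x) * (v_coeff d * (1 / real d))
            - (Re (zeta (1/2)) * sqrt x) * (v_coeff d * real d powr - (1/2)) = v_coeff d * E (x / real d)" for d
      unfolding E_def sq by (simp add: algebra_simps)
    ultimately have S: "((\<lambda>d. v_coeff d * E (x / real d)) has_sum T - C1 * x - C2 * x powr (1/2)) UNIV"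
      using x by (simp add: C1_eq(3) C2_eq(3) powr_half_sqrt mult_ac)
    have G: "((\<lambda>d. (K * x powr \<theta>) * norm (v_coeff d * real d powr - \<theta>)) has_sum (K * x powr \<theta>) * M) UNIV"
      by (rule has_sum_cmult_right[OF M])
    have le: "\<bar>v_coeff d * E (x / real d)\<bar> \<le> (K * x powr \<theta>) * norm (v_coeff d * real d powr - \<theta>)" for d
    proof (cases "d = 0")
      case False
      then have "\<bar>E (x / real d)\<bar> \<le> K * (x / real d) powr \<theta>" using K x by simp
      also have "\<dots> = (K * x powr \<theta>) * real d powr - \<theta>"
        using x by (simp add: powr_divide powr_minus_divide)
      finally have "\<bar>v_coeff d\<bar> * \<bar>E (x / real d)\<bar> \<le> \<bar>v_coeff d\<bar> * ((K * x powr \<theta>) * real d powr - \<theta>)"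
        by (intro mult_left_mono) auto
      then show ?thesis by (simp add: abs_mult mult_ac)
    qed simp
    have "T - C1 * x - C2 * x powr (1/2) \<le> (K * x powr \<theta>) * M"
      by (rule has_sum_mono[OF S G]) (use le in \<open>auto simp: abs_le_iff\<close>)
    moreover have "- (T - C1 * x - C2 * x powr (1/2)) \<le> (K * x powr \<theta>) * M"
      by (rule has_sum_mono[OF has_sum_uminusI[OF S] G]) (use le in \<open>auto simp: abs_le_iff\<close>)
    ultimately show ?thesis unfolding T_def[symmetric] by (simp add: abs_le_iff mult_ac)
  qed
  then show ?thesis unfolding \<theta>_def by (intro exI[of _ "K * M"]) simp
qed

lemma sum_t_e_bigo:
  assumes \<epsilon>: "\<epsilon> > 0"
  shows "(\<lambda>x::real. (\<Sum>n\<in>{n::nat. 1 \<le> n \<and> real n \<le> x}. real (t_e n)) - C1 * x - C2 * x powr (1/2))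
          \<in> O(\<lambda>x. x powr (1/4 + \<epsilon>))"
proof -
  \<comment> \<open>a smaller exponent gives a stronger bound for large x\<close>
  define \<delta> where "\<delta> = min \<epsilon> (1/4)"
  have \<delta>: "0 < \<delta>" "\<delta> \<le> 1/4" "\<delta> \<le> \<epsilon>" using \<epsilon> by (auto simp: \<delta>_def)
  obtain K where K: "\<And>x. x > 0 \<Longrightarrow> \<bar>(\<Sum>n\<in>{n. 1 \<le> n \<and> real n \<le> x}. real (t_e n)) - C1 * x - C2 * x powr (1/2)\<bar>
           \<le> K * x powr (1/4 + \<delta>)"
    using sum_t_e_estimate[OF \<delta>(1,2)] by metis
  show ?thesis
  proof (rule bigoI[where c = "\<bar>K\<bar>"], rule eventually_mono[OF eventually_ge_at_top[of 1]])
    fix x :: real assume x: "x \<ge> 1"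
    have "K * x powr (1/4 + \<delta>) \<le> \<bar>K\<bar> * x powr (1/4 + \<epsilon>)"
      using x \<delta> by (intro mult_mono powr_mono) auto
    then show "norm ((\<Sum>n\<in>{n::nat. 1 \<le> n \<and> real n \<le> x}. real (t_e n)) - C1 * x - C2 * x powr (1/2))
        \<le> \<bar>K\<bar> * norm (x powr (1/4 + \<epsilon>))"
      using K[of x] x by simp
  qed
qed

theorem theorem4:
  shows
    "t_e 1 = 1 \<and>
     (\<forall>m n. m > 0 \<longrightarrow> n > 0 \<longrightarrow> coprime m n \<longrightarrow> t_e (m * n) = t_e m * t_e n) \<and>
     (\<forall>p a. prime p \<longrightarrow> a \<ge> 1 \<longrightarrow> t_e (p ^ a) = 2 ^ omega a) \<and>
     (\<exists>v :: nat \<Rightarrow> complex.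
        (\<forall>s. Re s > 1/4 \<longrightarrow> summable (\<lambda>n. norm (v (Suc n) / of_nat (Suc n) powr s))) \<and>
        (\<forall>s. Re s > 1 \<longrightarrow>
           (\<lambda>n. of_nat (t_e (Suc n)) / of_nat (Suc n) powr s) sums
             (zeta s * zeta (2 * s) * (\<Sum>n. v (Suc n) / of_nat (Suc n) powr s)))) \<and>
     (\<forall>p. prime p \<longrightarrow> summable (\<lambda>a. C1_term p (a + 6)) \<and> summable (\<lambda>a. C2_term p (a + 4))) \<and>
     convergent_prod C1_factor \<and> convergent_prod C2_factor \<and>
     (\<forall>\<epsilon>>0.
        (\<lambda>x::real. (\<Sum>n\<in>{n::nat. 1 \<le> n \<and> real n \<le> x}. real (t_e n)) - C1 * x - C2 * x powr (1/2))
          \<in> O(\<lambda>x. x powr (1/4 + \<epsilon>)))"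
proof (intro conjI)
  show "\<exists>v :: nat \<Rightarrow> complex.
        (\<forall>s. Re s > 1/4 \<longrightarrow> summable (\<lambda>n. norm (v (Suc n) / of_nat (Suc n) powr s))) \<and>
        (\<forall>s. Re s > 1 \<longrightarrow>
           (\<lambda>n. of_nat (t_e (Suc n)) / of_nat (Suc n) powr s) sums
             (zeta s * zeta (2 * s) * (\<Sum>n. v (Suc n) / of_nat (Suc n) powr s)))"
    using summable_v_coeff_complex t_e_dirichlet_series
    by (intro exI[of _ "\<lambda>n. of_real (v_coeff n)"]) blast
  show "\<forall>\<epsilon>>0. (\<lambda>x::real. (\<Sum>n\<in>{n::nat. 1 \<le> n \<and> real n \<le> x}. real (t_e n)) - C1 * x - C2 * x powr (1/2))
          \<in> O(\<lambda>x. x powr (1/4 + \<epsilon>))"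
    using sum_t_e_bigo by blast
  show "\<forall>p. prime p \<longrightarrow> summable (\<lambda>a. C1_term p (a + 6)) \<and> summable (\<lambda>a. C2_term p (a + 4))"
    using C1_eq(1) C2_eq(1) by blast
  show "\<forall>m n. m > 0 \<longrightarrow> n > 0 \<longrightarrow> coprime m n \<longrightarrow> t_e (m * n) = t_e m * t_e n"
    using t_e_mult by blast
  show "\<forall>p a. prime p \<longrightarrow> a \<ge> 1 \<longrightarrow> t_e (p ^ a) = 2 ^ omega a"
    using t_e_prime_power by blast
qed (rule t_e_1 C1_eq(2) C2_eq(2))+

end
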